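(* Let $q\in\mathbb C^\times$ not be a root of unity, let $\mathcal F=\oplus_{k\in\mathbb Z}\mathcal F_k$ be the fermionic Fock space and $E,F\in\operatorname{End}(\mathcal F\otimes\mathcal F)$ the operators described in the context. Let $E^{(j)}=E^j/[j]_q!$, $F^{(j)}=F^j/[j]_q!$ ($j=0,1,\dots$). For every $m\in\mathbb Z$ the operator $$A_m(z)=\sum_{j=0}^\infty(-q)^j\frac{1-q^{|m|}z}{1-q^{2j+|m|}z}\begin{cases}E^{(j)}F^{(j+m)},&\text{if }m\ge0,\\ E^{(j-m)}F^{(j)},&\text{if }m\le0,\end{cases}$$ is a well-defined rational function of $z$ with values in $\operatorname{End}(\mathcal F\otimes\mathcal F)$ (when applied to any given vector, only finitely many summands are non-zero). The braiding matrix $$\check R_{k,k'}(z)=(-1)^{\min(k,k')}A_{k-k'}(z)$$ maps $\mathcal F_k\otimes\mathcal F_{k'}$ to $\mathcal F_{k'}\otimes\mathcal F_k$, and it satisfies the Yang--Baxter (braiding) equation $$(\check R_{k_2k_3}(z_2/z_3)\otimes\mathrm{id})(\mathrm{id}\otimes\check R_{k_1k_3}(z_1/z_3))(\check R_{k_1k_2}(z_1/z_2)\otimes\mathrm{id})=(\mathrm{id}\otimes\check R_{k_1k_2}(z_1/z_2))(\check R_{k_1k_3}(z_1/z_3)\otimes\mathrm{id})(\mathrm{id}\otimes\check R_{k_2k_3}(z_2/z_3))$$ on $\mathcal F_{k_1}\otimes\mathcal F_{k_2}\otimes\mathcal F_{k_3}$ for all $k_1,k_2,k_3\in\mathbb Z$,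 and the inversion relation $\check R_{k'k}(z^{-1})\check R_{kk'}(z)=\mathrm{id}$ on $\mathcal F_k\otimes\mathcal F_{k'}$ for all $k,k'\in\mathbb Z$.
   Context: $[n]_q=\frac{q^n-q^{-n}}{q-q^{-1}}$, $[n]_q!=\prod_{j=1}^n[j]_q$, $[0]_q!=1$. $C_\infty$ is the Clifford algebra generated by $b_n,c_n$ ($n\in\mathbb Z+\frac12$) with $b_nc_m+c_mb_n=\delta_{n,-m}$, the $b$'s anticommuting among themselves and the $c$'s anticommuting among themselves. The Fock space $\mathcal F$ is the $C_\infty$-module generated by a vacuum vector $|\mathrm{vac}\rangle$ subject to $b_n|\mathrm{vac}\rangle=c_n|\mathrm{vac}\rangle=0$ for $n>0$. It is $\mathbb Z$-graded, $\mathcal F=\oplus_k\mathcal F_k$, with $|\mathrm{vac}\rangle$ of degree $0$, $b_n$ of degree $1$, $c_n$ of degree $-1$; the parity is the degree mod $2$, and tensor products of maps act with the sign rule $(f\otimes g)(v\otimes w)=(-1)^{|g||v|}fv\otimes gw$. For $i\in\mathbb Z+\frac12$ let $\tilde n_i=b_ic_{-i}$ if $i<0$, $\tilde n_i=-c_{-i}b_i$ if $i>0$, $\tilde t_i=q^{\tilde n_i}$, and $\tilde K_i=\tilde t_i\otimes\tilde t_i^{-1}$. Define operators on $\mathcal F\otimes\mathcal F$ by $$E=\sum_{i}(b_i\otimes c_{-i})\prod_{j>i}\tilde K_j,\qquad F=-\sum_{i}\prod_{j<i}\tilde K_j^{-1}(c_{-i}\otimes b_i),$$ with $i,j$ running over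 $\mathbb Z+\frac12$; acting on any given vector, all but finitely many summands vanish and all but finitely many factors of the products are equal to $1$. *)

theory Defs
  imports
    Complex_Main
    "HOL-Library.Poly_Mapping"
    "HOL-Library.Groups_Big_Fun"
    "HOL-Computational_Algebra.Polynomial"
begin

section \<open>Complex vector spaces with a distinguished basis\<close>

definition cscale :: "complex \<Rightarrow> ('a \<Rightarrow>\<^sub>0 complex) \<Rightarrow> ('a \<Rightarrow>\<^sub>0 complex)" where
  "cscale c v = Poly_Mapping.map (\<lambda>x. c * x) v"

lemma lookup_cscale [simp]: "Poly_Mapping.lookup (cscale c v) a = c * Poly_Mapping.lookup v a"
  by (simp add: cscale_def Poly_Mapping.map.rep_eq when_def)

interpretation cvec: vector_space "cscale :: complex \<Rightarrow> ('a \<Rightarrow>\<^sub>0 complex) \<Rightarrow> _"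
  by unfold_locales (auto intro!: poly_mapping_eqI simp: lookup_add algebra_simps)

abbreviation clin :: "(('a \<Rightarrow>\<^sub>0 complex) \<Rightarrow> ('b \<Rightarrow>\<^sub>0 complex)) \<Rightarrow> bool" where
  "clin \<equiv> Vector_Spaces.linear cscale cscale"

definition ket :: "'a \<Rightarrow> ('a \<Rightarrow>\<^sub>0 complex)" where
  "ket a = Poly_Mapping.single a 1"

definition linext :: "('a \<Rightarrow> ('b \<Rightarrow>\<^sub>0 complex)) \<Rightarrow> ('a \<Rightarrow>\<^sub>0 complex) \<Rightarrow> ('b \<Rightarrow>\<^sub>0 complex)" where
  "linext f v = (\<Sum>a\<in>Poly_Mapping.keys v. cscale (Poly_Mapping.lookup v a) (f a))"

text \<open>The space with basis \<^typ>\<open>'a \<times> 'b\<close> is the tensor product of the spaces with bases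
  \<^typ>\<open>'a\<close> and \<^typ>\<open>'b\<close>; see \<open>tens_universal\<close> below.\<close>

definition tens :: "('a \<Rightarrow>\<^sub>0 complex) \<Rightarrow> ('b \<Rightarrow>\<^sub>0 complex) \<Rightarrow> ('a \<times> 'b \<Rightarrow>\<^sub>0 complex)" where
  "tens v w = linext (\<lambda>a. linext (\<lambda>b. ket (a, b)) w) v"

definition tens_sub :: "('a \<Rightarrow>\<^sub>0 complex) set \<Rightarrow> ('b \<Rightarrow>\<^sub>0 complex) set \<Rightarrow> ('a \<times> 'b \<Rightarrow>\<^sub>0 complex) set" where
  "tens_sub V W = cvec.span {tens v w | v w. v \<in> V \<and> w \<in> W}"

definition assoc :: "(('a \<times> 'b) \<times> 'c \<Rightarrow>\<^sub>0 complex) \<Rightarrow> ('a \<times> 'b \<times> 'c \<Rightarrow>\<^sub>0 complex)" where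
  "assoc = linext (\<lambda>((a, b), c). ket (a, b, c))"

definition unassoc :: "('a \<times> 'b \<times> 'c \<Rightarrow>\<^sub>0 complex) \<Rightarrow> (('a \<times> 'b) \<times> 'c \<Rightarrow>\<^sub>0 complex)" where
  "unassoc = linext (\<lambda>(a, b, c). ket ((a, b), c))"

class graded =
  fixes deg :: "'a \<Rightarrow> int"

instantiation prod :: (graded, graded) graded
begin
definition deg_prod :: "'a \<times> 'b \<Rightarrow> int" where
  "deg_prod p = deg (fst p) + deg (snd p)"
instance ..
end

definition grade :: "int \<Rightarrow> ('a::graded \<Rightarrow>\<^sub>0 complex) set" where
  "grade k = {v. \<forall>a\<in>Poly_Mapping.keys v. deg a = k}"

text \<open>Graded tensor product of maps.  The matrix entry of \<open>g\<close> from the basis vector \<open>b\<close> to \<open>b'\<close> is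
  the part of \<open>g\<close> of degree \<open>deg b' - deg b\<close>; hence this is the sign rule for homogeneous \<open>g\<close>,
  extended additively to arbitrary \<open>g\<close>; see \<open>stensor_tens\<close> below.\<close>

definition stensor :: "(('a::graded \<Rightarrow>\<^sub>0 complex) \<Rightarrow> ('c \<Rightarrow>\<^sub>0 complex)) \<Rightarrow>
    (('b::graded \<Rightarrow>\<^sub>0 complex) \<Rightarrow> ('d::graded \<Rightarrow>\<^sub>0 complex)) \<Rightarrow>
    ('a \<times> 'b \<Rightarrow>\<^sub>0 complex) \<Rightarrow> ('c \<times> 'd \<Rightarrow>\<^sub>0 complex)" where
  "stensor f g = linext (\<lambda>(a, b). tens (f (ket a))
     (linext (\<lambda>b'. cscale ((-1) powi ((deg b' - deg b) * deg a)) (ket b')) (g (ket b))))"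

section \<open>The Fock space\<close>

text \<open>The integer \<open>k\<close> stands for the half-integer \<open>k + 1/2\<close>.  So the half-integer is positive iff
  \<open>0 \<le> k\<close>, the order is that of the integers, and negation becomes:\<close>

definition hneg :: "int \<Rightarrow> int" where
  "hneg k = - k - 1"

text \<open>Put \<open>a\<^sub>i = b\<^sub>i\<close> for \<open>i < 0\<close> and \<open>a\<^sub>i = c\<^sub>-\<^sub>i\<close> for \<open>i > 0\<close>; these are the generators that do not
  annihilate the vacuum.  The basis vector with excited modes \<open>i\<^sub>1 < \<dots> < i\<^sub>r\<close> is
  \<open>a\<^bsub>i\<^sub>1\<^esub> \<dots> a\<^bsub>i\<^sub>r\<^esub> |vac\<rangle>\<close>.  That this realises the module presented by the Clifford relations and
  the vacuum conditions is \<open>fock_universal\<close> below.\<close>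

typedef state = "{S :: int set. finite S}" morphisms excited State
  by blast

type_synonym fock = "state \<Rightarrow>\<^sub>0 complex"

instantiation state :: graded
begin
definition deg_state :: "state \<Rightarrow> int" where
  "deg_state s = int (card {i \<in> excited s. i < 0}) - int (card {i \<in> excited s. 0 \<le> i})"
instance ..
end

definition vac :: fock where
  "vac = ket (State {})"

definition jw :: "int \<Rightarrow> state \<Rightarrow> complex" where
  "jw i s = (-1) ^ card {j \<in> excited s. j < i}"

definition create :: "int \<Rightarrow> fock \<Rightarrow> fock" where
  "create i = linext (\<lambda>s. if i \<in> excited s then 0
     else cscale (jw i s) (ket (State (insert i (excited s)))))"

definition annihilate :: "int \<Rightarrow> fock \<Rightarrow> fock" where
  "annihilate i = linext (\<lambda>s. if i \<in> excited s
     then cscale (jw i s) (ket (State (excited s - {i}))) else 0)"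

definition bop :: "int \<Rightarrow> fock \<Rightarrow> fock" where
  "bop n = (if n < 0 then create n else annihilate n)"

definition cop :: "int \<Rightarrow> fock \<Rightarrow> fock" where
  "cop n = (if n < 0 then create (hneg n) else annihilate (hneg n))"

section \<open>The operators on the tensor square\<close>

text \<open>\<open>q\<^sup>N\<close> for a diagonalisable operator \<open>N\<close> with integer eigenvalues.\<close>

definition qpow :: "complex \<Rightarrow> (('a \<Rightarrow>\<^sub>0 complex) \<Rightarrow> ('a \<Rightarrow>\<^sub>0 complex)) \<Rightarrow> ('a \<Rightarrow>\<^sub>0 complex) \<Rightarrow> ('a \<Rightarrow>\<^sub>0 complex)" where
  "qpow q N = (THE T. clin T \<and>
     (\<forall>(k::int) v. N v = cscale (of_int k) v \<longrightarrow> T v = cscale (q powi k) v))"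

definition ntil :: "int \<Rightarrow> fock \<Rightarrow> fock" where
  "ntil i = (if i < 0 then (\<lambda>v. bop i (cop (hneg i) v)) else (\<lambda>v. - cop (hneg i) (bop i v)))"

definition ttil :: "complex \<Rightarrow> int \<Rightarrow> fock \<Rightarrow> fock" where
  "ttil q i = qpow q (ntil i)"

definition Ktil :: "complex \<Rightarrow> int \<Rightarrow> (state \<times> state \<Rightarrow>\<^sub>0 complex) \<Rightarrow> (state \<times> state \<Rightarrow>\<^sub>0 complex)" where
  "Ktil q i = stensor (ttil q i) (inv (ttil q i))"

text \<open>The product of a family of commuting operators, applied to a vector which is fixed by all
  but finitely many of them.\<close>

definition opprod :: "('i \<Rightarrow> 'v \<Rightarrow> 'v) \<Rightarrow> 'i set \<Rightarrow> 'v \<Rightarrow> 'v" where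
  "opprod K J x = Finite_Set.fold K x {j \<in> J. K j x \<noteq> x}"

text \<open>\<^const>\<open>Sum_any\<close> is the sum over all indices with non-zero summand, provided there are only
  finitely many; this is \<open>finite_Eterm\<close> and \<open>finite_Fterm\<close> below.\<close>

definition Eterm :: "complex \<Rightarrow> int \<Rightarrow> (state \<times> state \<Rightarrow>\<^sub>0 complex) \<Rightarrow> (state \<times> state \<Rightarrow>\<^sub>0 complex)" where
  "Eterm q i x = stensor (bop i) (cop (hneg i)) (opprod (Ktil q) {j. i < j} x)"

definition Eop :: "complex \<Rightarrow> (state \<times> state \<Rightarrow>\<^sub>0 complex) \<Rightarrow> (state \<times> state \<Rightarrow>\<^sub>0 complex)" where
  "Eop q x = Sum_any (\<lambda>i. Eterm q i x)"

definition Fterm :: "complex \<Rightarrow> int \<Rightarrow> (state \<times> state \<Rightarrow>\<^sub>0 complex) \<Rightarrow> (state \<times> state \<Rightarrow>\<^sub>0 complex)" where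
  "Fterm q i x = opprod (\<lambda>j. inv (Ktil q j)) {j. j < i} (stensor (cop (hneg i)) (bop i) x)"

definition Fop :: "complex \<Rightarrow> (state \<times> state \<Rightarrow>\<^sub>0 complex) \<Rightarrow> (state \<times> state \<Rightarrow>\<^sub>0 complex)" where
  "Fop q x = - Sum_any (\<lambda>i. Fterm q i x)"

definition qint :: "complex \<Rightarrow> nat \<Rightarrow> complex" where
  "qint q n = (q ^ n - inverse q ^ n) / (q - inverse q)"

definition qfact :: "complex \<Rightarrow> nat \<Rightarrow> complex" where
  "qfact q n = (\<Prod>j=1..n. qint q j)"

definition divpow :: "complex \<Rightarrow> (('a \<Rightarrow>\<^sub>0 complex) \<Rightarrow> ('a \<Rightarrow>\<^sub>0 complex)) \<Rightarrow> nat \<Rightarrow> ('a \<Rightarrow>\<^sub>0 complex) \<Rightarrow> ('a \<Rightarrow>\<^sub>0 complex)" where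
  "divpow q T j x = cscale (1 / qfact q j) ((T ^^ j) x)"

section \<open>The braiding matrix\<close>

definition EFop :: "complex \<Rightarrow> int \<Rightarrow> nat \<Rightarrow> (state \<times> state \<Rightarrow>\<^sub>0 complex) \<Rightarrow> (state \<times> state \<Rightarrow>\<^sub>0 complex)" where
  "EFop q m j x = (if 0 \<le> m then divpow q (Eop q) j (divpow q (Fop q) (j + nat m) x)
     else divpow q (Eop q) (j + nat (- m)) (divpow q (Fop q) j x))"

text \<open>The value at \<open>z\<close> of the rational function \<open>(1 - q\<^bsup>|m|\<^esup> z) / (1 - q\<^bsup>2j+|m|\<^esup> z)\<close>.  For \<open>j = 0\<close> this
  is the constant 1, also at \<open>z = q\<^bsup>-|m|\<^esup>\<close>, where division in HOL would give \<open>0 / 0 = 0\<close>.\<close>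

definition rcoef :: "complex \<Rightarrow> int \<Rightarrow> nat \<Rightarrow> complex \<Rightarrow> complex" where
  "rcoef q m j z = (if j = 0 then 1
     else (1 - q ^ nat \<bar>m\<bar> * z) / (1 - q ^ (2 * j + nat \<bar>m\<bar>) * z))"

definition poles :: "complex \<Rightarrow> int \<Rightarrow> complex set" where
  "poles q m = {z. \<exists>j\<ge>1. 1 - q ^ (2 * j + nat \<bar>m\<bar>) * z = 0}"

definition Aop :: "complex \<Rightarrow> int \<Rightarrow> complex \<Rightarrow> (state \<times> state \<Rightarrow>\<^sub>0 complex) \<Rightarrow> (state \<times> state \<Rightarrow>\<^sub>0 complex)" where
  "Aop q m z x = Sum_any (\<lambda>j. cscale ((- q) ^ j * rcoef q m j z) (EFop q m j x))"

text \<open>\<open>f\<close> is a vector-valued rational function all of whose poles lie in \<open>P\<close>.\<close>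

definition rational_off :: "complex set \<Rightarrow> (complex \<Rightarrow> ('a \<Rightarrow>\<^sub>0 complex)) \<Rightarrow> bool" where
  "rational_off P f \<longleftrightarrow> (\<exists>(d::complex poly) (n::nat) u. d \<noteq> 0 \<and> (\<forall>z. poly d z = 0 \<longrightarrow> z \<in> P) \<and>
     (\<forall>z. z \<notin> P \<longrightarrow> f z = cscale (1 / poly d z) (\<Sum>k\<le>n. cscale (z ^ k) (u k))))"

definition Rcheck :: "complex \<Rightarrow> int \<Rightarrow> int \<Rightarrow> complex \<Rightarrow> (state \<times> state \<Rightarrow>\<^sub>0 complex) \<Rightarrow> (state \<times> state \<Rightarrow>\<^sub>0 complex)" where
  "Rcheck q k k' z x = cscale ((-1) powi min k k') (Aop q (k - k') z x)"

definition on12 :: "((state \<times> state \<Rightarrow>\<^sub>0 complex) \<Rightarrow> (state \<times> state \<Rightarrow>\<^sub>0 complex)) \<Rightarrow>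
    (state \<times> state \<times> state \<Rightarrow>\<^sub>0 complex) \<Rightarrow> (state \<times> state \<times> state \<Rightarrow>\<^sub>0 complex)" where
  "on12 T x = assoc (stensor T (id :: fock \<Rightarrow> fock) (unassoc x))"

definition on23 :: "((state \<times> state \<Rightarrow>\<^sub>0 complex) \<Rightarrow> (state \<times> state \<Rightarrow>\<^sub>0 complex)) \<Rightarrow>
    (state \<times> state \<times> state \<Rightarrow>\<^sub>0 complex) \<Rightarrow> (state \<times> state \<times> state \<Rightarrow>\<^sub>0 complex)" where
  "on23 T x = stensor (id :: fock \<Rightarrow> fock) T x"

section \<open>Linear maps and tensor products\<close>

abbreviation lin_to :: "(complex \<Rightarrow> 'v \<Rightarrow> 'v::ab_group_add) \<Rightarrow> (('a \<Rightarrow>\<^sub>0 complex) \<Rightarrow> 'v) \<Rightarrow> bool" where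
  "lin_to sc \<equiv> Vector_Spaces.linear cscale sc"

lemma linearI':
  assumes "vector_space s1" "vector_space s2"
    and "\<And>x y. f (x + y) = f x + f y" "\<And>c x. f (s1 c x) = s2 c (f x)"
  shows "Vector_Spaces.linear s1 s2 f"
  using assms by (simp add: Vector_Spaces.linear_iff)

lemmas clinI = linearI'[OF cvec.vector_space_axioms cvec.vector_space_axioms]

lemma linear_add': "Vector_Spaces.linear s1 s2 f \<Longrightarrow> f (x + y) = f x + f y"
  and linear_scale': "Vector_Spaces.linear s1 s2 f \<Longrightarrow> f (s1 c x) = s2 c (f x)"
  by (simp_all add: Vector_Spaces.linear_iff)

lemma linear_0': "Vector_Spaces.linear s1 s2 f \<Longrightarrow> f 0 = 0"
  using linear_add'[of s1 s2 f 0 0] by simp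

lemma linear_neg': "Vector_Spaces.linear s1 s2 f \<Longrightarrow> f (- x) = - f x"
  using linear_add'[of s1 s2 f x "- x"] linear_0'[of s1 s2 f]
  by (simp add: eq_neg_iff_add_eq_0 add.commute)

lemma linear_sum': "Vector_Spaces.linear s1 s2 f \<Longrightarrow> f (\<Sum>a\<in>A. g a) = (\<Sum>a\<in>A. f (g a))"
  by (induction A rule: infinite_finite_induct) (simp_all add: linear_0' linear_add')

lemma linear_comp': "Vector_Spaces.linear s1 s2 f \<Longrightarrow> Vector_Spaces.linear s2 s3 g \<Longrightarrow>
    Vector_Spaces.linear s1 s3 (\<lambda>x. g (f x))"
  by (simp add: Vector_Spaces.linear_iff)

lemma ket_expand: "(\<Sum>a\<in>Poly_Mapping.keys v. cscale (Poly_Mapping.lookup v a) (ket a)) = v"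
proof (rule poly_mapping_eqI)
  fix b
  have "Poly_Mapping.lookup (\<Sum>a\<in>Poly_Mapping.keys v. cscale (Poly_Mapping.lookup v a) (ket a)) b
     = (\<Sum>a\<in>Poly_Mapping.keys v. if a = b then Poly_Mapping.lookup v a else 0)"
    by (simp add: lookup_sum ket_def lookup_single when_def if_distrib cong: if_cong)
  then show "Poly_Mapping.lookup (\<Sum>a\<in>Poly_Mapping.keys v. cscale (Poly_Mapping.lookup v a) (ket a)) b
     = Poly_Mapping.lookup v b"
    by (simp add: in_keys_iff)
qed

lemma lin_expand:
  assumes "lin_to sc f"
  shows "f v = (\<Sum>a\<in>Poly_Mapping.keys v. sc (Poly_Mapping.lookup v a) (f (ket a)))"
  using assms by (subst (1) ket_expand[of v, symmetric]) (simp only: linear_sum' linear_scale')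

lemma lin_eqI:
  assumes "lin_to sc f" "lin_to sc g" "\<And>a. f (ket a) = g (ket a)"
  shows "f v = g v"
  by (simp only: lin_expand[OF assms(1), of v] lin_expand[OF assms(2), of v] assms(3))

lemma lin_extension:
  fixes f :: "'a \<Rightarrow> 'v::ab_group_add"
  assumes "vector_space sc"
  shows "lin_to sc (\<lambda>v. \<Sum>a\<in>Poly_Mapping.keys v. sc (Poly_Mapping.lookup v a) (f a))" (is "lin_to sc ?L")
    and "(\<Sum>a\<in>Poly_Mapping.keys (ket b). sc (Poly_Mapping.lookup (ket b) a) (f a)) = f b"
proof -
  interpret V: vector_space sc by fact
  have sup: "?L v = (\<Sum>a\<in>A. sc (Poly_Mapping.lookup v a) (f a))"
    if "finite A" "Poly_Mapping.keys v \<subseteq> A" for A v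
    by (rule sum.mono_neutral_left) (use that in \<open>auto simp: in_keys_iff\<close>)
  show "lin_to sc ?L"
  proof (rule linearI'[OF cvec.vector_space_axioms assms])
    fix v w :: "'a \<Rightarrow>\<^sub>0 complex" and c
    let ?A = "Poly_Mapping.keys v \<union> Poly_Mapping.keys w"
    have "Poly_Mapping.keys (v + w) \<subseteq> ?A" by (rule keys_add)
    then have "?L (v + w) = (\<Sum>a\<in>?A. sc (Poly_Mapping.lookup (v + w) a) (f a))"
      by (intro sup) simp_all
    also have "\<dots> = (\<Sum>a\<in>?A. sc (Poly_Mapping.lookup v a) (f a)) + (\<Sum>a\<in>?A. sc (Poly_Mapping.lookup w a) (f a))"
      by (simp add: lookup_add V.scale_left_distrib sum.distrib)
    also have "\<dots> = ?L v + ?L w"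
      by (intro arg_cong2[where f = "(+)"] sup[symmetric]) simp_all
    finally show "?L (v + w) = ?L v + ?L w" .
    have "Poly_Mapping.keys (cscale c v) \<subseteq> Poly_Mapping.keys v" by (auto simp: in_keys_iff)
    then have "?L (cscale c v) = (\<Sum>a\<in>Poly_Mapping.keys v. sc (Poly_Mapping.lookup (cscale c v) a) (f a))"
      by (intro sup) simp_all
    then show "?L (cscale c v) = sc c (?L v)"
      by (simp add: V.scale_sum_right)
  qed
  show "(\<Sum>a\<in>Poly_Mapping.keys (ket b). sc (Poly_Mapping.lookup (ket b) a) (f a)) = f b"
    by (simp add: ket_def)
qed

lemma clin_linext [simp]: "clin (linext f)"
  using lin_extension(1)[OF cvec.vector_space_axioms, of f] by (simp add: linext_def[abs_def])

lemma linext_ket [simp]: "linext f (ket a) = f a"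
  using lin_extension(2)[OF cvec.vector_space_axioms, of a f] by (simp add: linext_def)

lemma linext_add_fun: "linext (\<lambda>a. f a + g a) v = linext f v + linext g v"
  by (simp add: linext_def cvec.scale_right_distrib sum.distrib)

lemma linext_scale_fun: "linext (\<lambda>a. cscale c (f a)) v = cscale c (linext f v)"
  by (simp add: linext_def cvec.scale_sum_right mult.commute)

lemma tens_ket [simp]: "tens (ket a) (ket b) = ket (a, b)"
  by (simp add: tens_def)

lemma clin_tens_left: "clin (\<lambda>v. tens v w)"
  by (simp add: tens_def)

lemma clin_tens_right: "clin (tens v)"
  unfolding tens_def
  by (rule clinI) (simp_all add: linear_add'[OF clin_linext] linear_scale'[OF clin_linext]
      linext_add_fun linext_scale_fun)

lemmas tens_simps = linear_add'[OF clin_tens_left] linear_add'[OF clin_tens_right]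
  linear_scale'[OF clin_tens_left] linear_scale'[OF clin_tens_right]

lemma tens_universal:
  assumes "vector_space sc" and r: "\<And>v. lin_to sc (\<beta> v)" and l: "\<And>w. lin_to sc (\<lambda>v. \<beta> v w)"
  shows "\<exists>!L. lin_to sc L \<and> (\<forall>v w. L (tens v w) = \<beta> v w)"
proof (rule ex1I)
  let ?L = "\<lambda>x. \<Sum>p\<in>Poly_Mapping.keys x. sc (Poly_Mapping.lookup x p) (\<beta> (ket (fst p)) (ket (snd p)))"
  note L = lin_extension[OF assms(1), where f = "\<lambda>p. \<beta> (ket (fst p)) (ket (snd p))"]
  have Lk: "?L (ket (a, b)) = \<beta> (ket a) (ket b)" for a b
    using L(2)[of "(a, b)"] by (simp only: fst_conv snd_conv)
  have "?L (tens (ket a) w) = \<beta> (ket a) w" for a w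
    by (rule lin_eqI[OF linear_comp'[OF clin_tens_right L(1)] r]) (simp only: tens_ket Lk)
  then have "?L (tens v w) = \<beta> v w" for v w
    by (rule lin_eqI[OF linear_comp'[OF clin_tens_left L(1)] l])
  with L(1) show "lin_to sc ?L \<and> (\<forall>v w. ?L (tens v w) = \<beta> v w)" by blast
  fix M assume M: "lin_to sc M \<and> (\<forall>v w. M (tens v w) = \<beta> v w)"
  then have Mk: "M (ket (a, b)) = \<beta> (ket a) (ket b)" for a b
    by (metis tens_ket)
  show "M = ?L"
  proof
    fix x show "M x = ?L x"
      by (rule lin_eqI[of sc]) (use M L(1) Lk Mk in auto)
  qed
qed

lemma clin_stensor [simp]: "clin (stensor f g)"
  by (simp add: stensor_def)

lemma keys_sub_linext: "(\<And>a. a \<in> Poly_Mapping.keys v \<Longrightarrow> f a = g a) \<Longrightarrow> linext f v = linext g v"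
  by (simp add: linext_def)

lemma linext_kets [simp]: "linext ket v = v"
  by (simp add: linext_def ket_expand)

lemma stensor_tens:
  fixes v :: "'a::graded \<Rightarrow>\<^sub>0 complex" and w :: "'b::graded \<Rightarrow>\<^sub>0 complex"
    and g :: "('b \<Rightarrow>\<^sub>0 complex) \<Rightarrow> ('d::graded \<Rightarrow>\<^sub>0 complex)"
  assumes f: "clin f" and g: "clin g"
    and deg_g: "\<And>l u. u \<in> grade l \<Longrightarrow> g u \<in> grade (l + p)" and v: "v \<in> grade k"
  shows "stensor f g (tens v w) = cscale ((-1) powi (p * k)) (tens (f v) (g w))"
proof -
  have ab: "stensor f g (tens (ket a) (ket b)) = cscale ((-1) powi (p * deg a)) (tens (f (ket a)) (g (ket b)))"
    for a b
  proof -
    have "ket b \<in> grade (deg b)" by (simp add: grade_def ket_def)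
    from deg_g[OF this] have "deg b' = deg b + p" if "b' \<in> Poly_Mapping.keys (g (ket b))" for b'
      using that by (simp add: grade_def)
    then have "linext (\<lambda>b'. cscale ((-1) powi ((deg b' - deg b) * deg a)) (ket b')) (g (ket b))
      = linext (\<lambda>b'. cscale ((-1) powi (p * deg a)) (ket b')) (g (ket b))"
      by (intro keys_sub_linext) simp
    then show ?thesis by (simp add: stensor_def linext_scale_fun tens_simps)
  qed
  have aw: "stensor f g (tens (ket a) w) = cscale ((-1) powi (p * deg a)) (tens (f (ket a)) (g w))" for a
    by (rule lin_eqI[OF linear_comp'[OF clin_tens_right clin_stensor]
        linear_comp'[OF linear_comp'[OF g clin_tens_right] cvec.linear_scale_self]]) (rule ab)
  have "stensor f g (tens v w) = (\<Sum>a\<in>Poly_Mapping.keys v. cscale (Poly_Mapping.lookup v a) (stensor f g (tens (ket a) w)))"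
    by (rule lin_expand[OF linear_comp'[OF clin_tens_left clin_stensor]])
  also have "\<dots> = (\<Sum>a\<in>Poly_Mapping.keys v. cscale (Poly_Mapping.lookup v a)
      (cscale ((-1) powi (p * k)) (tens (f (ket a)) (g w))))"
    using v by (intro sum.cong) (auto simp: aw grade_def)
  also have "\<dots> = cscale ((-1) powi (p * k)) (tens (f v) (g w))"
    by (rule lin_expand[OF linear_comp'[OF linear_comp'[OF f clin_tens_left] cvec.linear_scale_self], symmetric])
  finally show ?thesis .
qed

section \<open>Clifford relations and universal property of the Fock space\<close>

lemma excited_State [simp]: "finite S \<Longrightarrow> excited (State S) = S"
  by (simp add: State_inverse)

lemma finite_excited [simp]: "finite (excited s)"
  using excited by blast

lemma State_excited [simp]: "State (excited s) = s"
  by (rule excited_inverse)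

lemma card_below_insert:
  assumes "finite S" "j \<notin> S"
  shows "card {k \<in> insert j S. k < (i::int)} = card {k \<in> S. k < i} + (if j < i then 1 else 0)"
proof (cases "j < i")
  case True
  then have "{k \<in> insert j S. k < i} = insert j {k \<in> S. k < i}" by auto
  with assms True show ?thesis by simp
next
  case False
  then have "{k \<in> insert j S. k < i} = {k \<in> S. k < i}" by auto
  with False show ?thesis by simp
qed

lemma jw_insert:
  assumes "finite S" "j \<notin> S"
  shows "jw i (State (insert j S)) = (if j < i then -1 else 1) * jw i (State S)"
  using assms by (simp add: jw_def card_below_insert del: insert_iff)

lemma jw_remove:
  assumes "finite S" "j \<in> S"
  shows "jw i (State (S - {j})) = (if j < i then -1 else 1) * jw i (State S)"
  using jw_insert[of "S - {j}" j i] assms by (simp add: insert_absorb)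

lemma jw_sq [simp]: "jw i s * jw i s = 1"
  by (simp add: jw_def flip: power_mult_distrib)

lemma clin_create [simp]: "clin (create i)" and clin_annihilate [simp]: "clin (annihilate i)"
  by (simp_all add: create_def annihilate_def)

lemma create_ket: "finite S \<Longrightarrow> create i (ket (State S)) =
    (if i \<in> S then 0 else cscale (jw i (State S)) (ket (State (insert i S))))"
  and annihilate_ket: "finite S \<Longrightarrow> annihilate i (ket (State S)) =
    (if i \<in> S then cscale (jw i (State S)) (ket (State (S - {i}))) else 0)"
  by (simp_all add: create_def annihilate_def)

lemmas ca_simps = linear_0'[OF clin_create] linear_0'[OF clin_annihilate]
  linear_scale'[OF clin_create] linear_scale'[OF clin_annihilate] create_ket annihilate_ket

lemma fock_eqI:
  assumes "lin_to sc f" "lin_to sc g" "\<And>S. finite S \<Longrightarrow> f (ket (State S)) = g (ket (State S))"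
  shows "f v = g v"
  using assms(1,2) by (rule lin_eqI) (metis assms(3) State_excited finite_excited)

lemma clin_add: "clin f \<Longrightarrow> clin g \<Longrightarrow> clin (\<lambda>x. f x + g x)"
  by (intro clinI) (simp_all add: linear_add' linear_scale' cvec.scale_right_distrib)

lemma clin_zero: "clin (\<lambda>x. 0)"
  by (intro clinI) simp_all

lemma cscale_uminus: "cscale (- c) v = - cscale c v"
  by (rule poly_mapping_eqI) simp

lemma create_create: "create i (create j v) + create j (create i v) = 0"
proof (rule fock_eqI[of cscale "\<lambda>v. create i (create j v) + create j (create i v)" "\<lambda>_. 0"])
  fix S :: "int set" assume S: "finite S"
  then show "create i (create j (ket (State S))) + create j (create i (ket (State S))) = 0"
    by (cases i j rule: linorder_cases)
      (auto simp: ca_simps jw_insert insert_commute cscale_uminus mult.commute)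
qed (intro clin_add clin_zero linear_comp'[OF clin_create clin_create])+

lemma annihilate_annihilate: "annihilate i (annihilate j v) + annihilate j (annihilate i v) = 0"
proof (rule fock_eqI[of cscale "\<lambda>v. annihilate i (annihilate j v) + annihilate j (annihilate i v)" "\<lambda>_. 0"])
  fix S :: "int set" assume S: "finite S"
  have *: "S - {i} - {j} = S - {j} - {i}" by auto
  show "annihilate i (annihilate j (ket (State S))) + annihilate j (annihilate i (ket (State S))) = 0"
    using S by (cases i j rule: linorder_cases)
      (auto simp: ca_simps jw_remove * cscale_uminus mult.commute)
qed (intro clin_add clin_zero linear_comp'[OF clin_annihilate clin_annihilate])+

lemma create_annihilate: "create i (annihilate j v) + annihilate j (create i v) = (if i = j then v else 0)"
proof (rule fock_eqI[of cscale "\<lambda>v. create i (annihilate j v) + annihilate j (create i v)" "\<lambda>v. if i = j then v else 0"])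
  fix S :: "int set" assume S: "finite S"
  show "create i (annihilate j (ket (State S))) + annihilate j (create i (ket (State S))) = (if i = j then ket (State S) else 0)"
    using S by (cases i j rule: linorder_cases)
      (auto simp: ca_simps jw_insert jw_remove insert_Diff_if cscale_uminus mult.commute insert_absorb)
next
  show "clin (\<lambda>v. if i = j then v else 0)" by (intro clinI) auto
qed (intro clin_add linear_comp'[OF clin_annihilate clin_create] linear_comp'[OF clin_create clin_annihilate])

lemma bop_bop: "bop m (bop n v) + bop n (bop m v) = 0"
  using create_create[of m n v] annihilate_annihilate[of m n v] create_annihilate[of m n v] create_annihilate[of n m v]
  by (simp add: bop_def add.commute split: if_splits)

lemma cop_cop: "cop m (cop n v) + cop n (cop m v) = 0"
  using create_create[of "hneg m" "hneg n" v] annihilate_annihilate[of "hneg m" "hneg n" v]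
    create_annihilate[of "hneg m" "hneg n" v] create_annihilate[of "hneg n" "hneg m" v]
  by (simp add: cop_def hneg_def add.commute split: if_splits)

lemma bop_cop: "bop n (cop m v) + cop m (bop n v) = (if n = hneg m then v else 0)"
  using create_create[of n "hneg m" v] annihilate_annihilate[of n "hneg m" v]
    create_annihilate[of n "hneg m" v] create_annihilate[of "hneg m" n v]
  by (simp add: bop_def cop_def hneg_def add.commute split: if_splits)

lemma bop_vac: "0 \<le> n \<Longrightarrow> bop n vac = 0" and cop_vac: "0 \<le> n \<Longrightarrow> cop n vac = 0"
  by (simp_all add: bop_def cop_def vac_def ca_simps)

lemma fock_universal:
  fixes sc :: "complex \<Rightarrow> 'v \<Rightarrow> 'v::ab_group_add"
  assumes vs: "vector_space sc"
    and linB: "\<And>n. Vector_Spaces.linear sc sc (B n)" and linC: "\<And>n. Vector_Spaces.linear sc sc (C n)"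
    and BB: "\<And>m n v. B m (B n v) + B n (B m v) = 0"
    and CC: "\<And>m n v. C m (C n v) + C n (C m v) = 0"
    and BC: "\<And>n m v. B n (C m v) + C m (B n v) = (if n = hneg m then v else 0)"
    and B0: "\<And>n. 0 \<le> n \<Longrightarrow> B n v0 = 0" and C0: "\<And>n. 0 \<le> n \<Longrightarrow> C n v0 = 0"
  shows "\<exists>!T. lin_to sc T \<and> T vac = v0 \<and> (\<forall>n v. T (bop n v) = B n (T v) \<and> T (cop n v) = C n (T v))"
proof -
  interpret V: vector_space sc by fact
  define A where "A i = (if i < 0 then B i else C (hneg i))" for i
  define Z where "Z i = (if i < 0 then C (hneg i) else B i)" for i
  have B_eq: "B n = (if n < 0 then A n else Z n)" for n by (simp add: A_def Z_def)
  have C_eq: "C n = (if n < 0 then A (hneg n) else Z (hneg n))" for n by (simp add: A_def Z_def hneg_def)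
  have linA: "Vector_Spaces.linear sc sc (A n)" and linZ: "Vector_Spaces.linear sc sc (Z n)" for n
    using linB linC by (simp_all add: A_def Z_def)
  have AA: "A i (A j v) + A j (A i v) = 0" for i j v
    using BB[of i j v] CC[of "hneg i" "hneg j" v] BC[of i "hneg j" v] BC[of j "hneg i" v]
    by (simp add: A_def hneg_def add.commute split: if_splits)
  have AZ: "A i (Z j v) + Z j (A i v) = (if i = j then v else 0)" for i j v
    using BB[of i j v] CC[of "hneg i" "hneg j" v] BC[of i "hneg j" v] BC[of j "hneg i" v]
    by (simp add: A_def Z_def hneg_def add.commute split: if_splits)
  have Z0: "Z i v0 = 0" for i using B0[of i] C0[of "hneg i"] by (simp add: Z_def hneg_def)
  have A_swap: "A i (A j v) = - A j (A i v)" for i j v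
    using AA[of i j v] by (simp add: eq_neg_iff_add_eq_0)
  have A_sq: "A i (A i v) = 0" for i v
  proof -
    have "sc 2 (A i (A i v)) = A i (A i v) + A i (A i v)"
      using V.scale_left_distrib[of 1 1 "A i (A i v)"] by simp
    then show ?thesis using AA[of i i v] by simp
  qed
  have Z_swap: "Z j (A i v) = (if i = j then v else 0) - A i (Z j v)" for i j v
    using AZ[of i j v] by (simp add: algebra_simps)
  define W where "W xs = foldr A xs v0" for xs
  define sg where "sg i xs = (-1 :: complex) ^ length (filter (\<lambda>j. j < i) xs)" for i :: int and xs
  have AW: "A i (W xs) = (if i \<in> set xs then 0 else sc (sg i xs) (W (insort i xs)))"
    if "sorted xs" "distinct xs" for i xs
    using that
  proof (induction xs)
    case Nil
    then show ?case by (simp add: W_def sg_def)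
  next
    case (Cons x xs)
    have lt: "\<forall>y\<in>set xs. x < y" using Cons.prems by (auto simp: order.strict_iff_order)
    have IH: "A i (W xs) = (if i \<in> set xs then 0 else sc (sg i xs) (W (insort i xs)))"
      using Cons by simp
    consider "i < x" | "i = x" | "x < i" by linarith
    then show ?case
    proof cases
      case 1
      then have "filter (\<lambda>j. j < i) xs = []" using lt by (auto simp: filter_empty_conv)
      with 1 lt show ?thesis by (auto simp: W_def sg_def)
    next
      case 2
      then show ?thesis by (simp add: W_def A_sq)
    next
      case 3
      have "A i (W (x # xs)) = - A x (A i (W xs))" using A_swap[of i x "foldr A xs v0"] by (simp add: W_def)
      also have "\<dots> = (if i \<in> set xs then 0 else sc (- sg i xs) (A x (W (insort i xs))))"
        using linear_0'[OF linA] linear_scale'[OF linA] by (simp add: IH)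
      finally show ?thesis using 3 by (simp add: sg_def W_def)
    qed
  qed
  have ZW: "Z i (W xs) = (if i \<in> set xs then sc (sg i xs) (W (remove1 i xs)) else 0)"
    if "sorted xs" "distinct xs" for i xs
    using that
  proof (induction xs)
    case Nil
    then show ?case by (simp add: W_def Z0)
  next
    case (Cons x xs)
    have lt: "\<forall>y\<in>set xs. x < y" using Cons.prems by (auto simp: order.strict_iff_order)
    have IH: "Z i (W xs) = (if i \<in> set xs then sc (sg i xs) (W (remove1 i xs)) else 0)"
      using Cons by simp
    have *: "Z i (W (x # xs)) = (if x = i then W xs else 0) - A x (Z i (W xs))" by (simp add: W_def Z_swap)
    show ?case
    proof (cases "x = i")
      case True
      then have "filter (\<lambda>j. j < i) xs = []" using lt by (auto simp: filter_empty_conv)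
      with True lt show ?thesis
        unfolding * IH using linear_0'[OF linA] by (auto simp: sg_def)
    next
      case False
      then have "i \<in> set xs \<Longrightarrow> x < i" using lt by auto
      with False show ?thesis
        unfolding * IH using linear_0'[OF linA] linear_scale'[OF linA] by (auto simp: sg_def W_def)
    qed
  qed
  have sg_jw: "sg i (sorted_list_of_set S) = jw i (State S)" if "finite S" for i S
  proof -
    have "length (filter (\<lambda>j. j < i) (sorted_list_of_set S)) = card (set (filter (\<lambda>j. j < i) (sorted_list_of_set S)))"
      by (rule distinct_card[symmetric]) simp
    then show ?thesis using that by (simp add: sg_def jw_def)
  qed
  define T where "T v = (\<Sum>s\<in>Poly_Mapping.keys v. sc (Poly_Mapping.lookup v s) (W (sorted_list_of_set (excited s))))" for v
  have T_lin: "lin_to sc T"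
    using lin_extension(1)[OF vs, where f = "\<lambda>s. W (sorted_list_of_set (excited s))"] by (simp add: T_def[abs_def])
  have T_ket: "T (ket (State S)) = W (sorted_list_of_set S)" if "finite S" for S
    using lin_extension(2)[OF vs, where f = "\<lambda>s. W (sorted_list_of_set (excited s))" and b = "State S"] that
    by (simp add: T_def)
  have T_create: "T (create i v) = A i (T v)" for i v
    by (rule fock_eqI[OF linear_comp'[OF clin_create T_lin] linear_comp'[OF T_lin linA]])
      (simp add: create_ket T_ket AW sg_jw linear_0'[OF T_lin] linear_scale'[OF T_lin])
  have T_annihilate: "T (annihilate i v) = Z i (T v)" for i v
    by (rule fock_eqI[OF linear_comp'[OF clin_annihilate T_lin] linear_comp'[OF T_lin linZ]])
      (simp add: annihilate_ket T_ket ZW sg_jw linear_0'[OF T_lin] linear_scale'[OF T_lin] sorted_list_of_set_remove)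
  have T_vac: "T vac = v0" by (simp add: vac_def T_ket W_def)
  have T_bc: "T (bop n v) = B n (T v) \<and> T (cop n v) = C n (T v)" for n v
    by (simp add: bop_def cop_def T_create T_annihilate B_eq C_eq)
  show ?thesis
  proof (rule ex1I[of _ T])
    show "lin_to sc T \<and> T vac = v0 \<and> (\<forall>n v. T (bop n v) = B n (T v) \<and> T (cop n v) = C n (T v))"
      using T_lin T_vac T_bc by blast
    fix M assume M: "lin_to sc M \<and> M vac = v0 \<and> (\<forall>n v. M (bop n v) = B n (M v) \<and> M (cop n v) = C n (M v))"
    have M_create: "M (create i v) = A i (M v)" for i v
    proof (cases "i < 0")
      case True
      then show ?thesis using M by (metis A_def bop_def)
    next
      case False
      then have "hneg i < 0" "hneg (hneg i) = i" by (auto simp: hneg_def)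
      then show ?thesis using M False by (metis A_def cop_def)
    qed
    have "M (ket (State S)) = T (ket (State S))" if "finite S" for S
      using that
    proof (induction S rule: finite_linorder_min_induct)
      case empty
      then show ?case using M T_vac by (simp add: vac_def)
    next
      case (insert b S)
      then have *: "{j \<in> S. j < b} = {}" "b \<notin> S" by auto
      have "jw b (State S) = 1"
        unfolding jw_def excited_State[OF insert.hyps(1)] *(1) by simp
      then have "create b (ket (State S)) = ket (State (insert b S))"
        using insert.hyps(1) *(2) by (simp add: create_ket)
      then show ?case using M_create[of b "ket (State S)"] T_create[of b "ket (State S)"] insert by simp
    qed
    then have "M v = T v" for v
      by (rule fock_eqI[OF conjunct1[OF M] T_lin])
    then show "M = T" by (rule ext)
  qed
qed

lemma subspace_grade: "cvec.subspace (grade k)"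
  unfolding cvec.subspace_def grade_def
  by (auto simp: in_keys_iff lookup_add)

lemma clin_grade:
  assumes "clin f" "\<And>a. deg a = k \<Longrightarrow> f (ket a) \<in> grade l" "v \<in> grade k"
  shows "f v \<in> grade l"
  unfolding lin_expand[OF assms(1), of v]
proof (intro cvec.subspace_sum[OF subspace_grade] cvec.subspace_scale[OF subspace_grade] assms(2))
  show "deg a = k" if "a \<in> Poly_Mapping.keys v" for a
    using assms(3) that by (simp add: grade_def)
qed

lemma ket_grade: "deg a = k \<Longrightarrow> ket a \<in> grade k"
  by (simp add: grade_def ket_def)

lemma deg_insert:
  assumes "finite S" "i \<notin> S"
  shows "deg (State (insert i S)) = deg (State S) + (if i < 0 then 1 else - 1)"
proof -
  have "{j \<in> insert i S. j < 0} = (if i < 0 then insert i {j \<in> S. j < 0} else {j \<in> S. j < 0})"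
    "{j \<in> insert i S. 0 \<le> j} = (if i < 0 then {j \<in> S. 0 \<le> j} else insert i {j \<in> S. 0 \<le> j})"
    by auto
  then show ?thesis using assms by (simp add: deg_state_def)
qed

lemma create_grade: "v \<in> grade k \<Longrightarrow> create i v \<in> grade (k + (if i < 0 then 1 else - 1))"
proof (erule clin_grade[OF clin_create, rotated])
  fix s :: state assume "deg s = k"
  then show "create i (ket s) \<in> grade (k + (if i < 0 then 1 else - 1))"
    using deg_insert[of "excited s" i] cvec.subspace_0[OF subspace_grade]
    by (auto simp: create_def intro!: cvec.subspace_scale[OF subspace_grade] ket_grade)
qed

lemma annihilate_grade: "v \<in> grade k \<Longrightarrow> annihilate i v \<in> grade (k - (if i < 0 then 1 else - 1))"
proof (erule clin_grade[OF clin_annihilate, rotated])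
  fix s :: state assume "deg s = k"
  then show "annihilate i (ket s) \<in> grade (k - (if i < 0 then 1 else - 1))"
    using deg_insert[of "excited s - {i}" i] cvec.subspace_0[OF subspace_grade]
    by (auto simp: annihilate_def insert_absorb intro!: cvec.subspace_scale[OF subspace_grade] ket_grade)
qed

lemma vac_grade: "vac \<in> grade 0"
  by (simp add: vac_def ket_grade deg_state_def)

lemma bop_grade: "v \<in> grade k \<Longrightarrow> bop n v \<in> grade (k + 1)"
  using create_grade[of v k n] annihilate_grade[of v k n] by (auto simp: bop_def)

lemma cop_grade: "v \<in> grade k \<Longrightarrow> cop n v \<in> grade (k - 1)"
  using create_grade[of v k "hneg n"] annihilate_grade[of v k "hneg n"] by (auto simp: cop_def hneg_def)

lemma clin_bop [simp]: "clin (bop n)" and clin_cop [simp]: "clin (cop n)"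
  by (simp_all add: bop_def cop_def)

section \<open>Local finiteness of the sums and products\<close>

definition nval :: "int \<Rightarrow> state \<Rightarrow> int" where
  "nval i s = (if i \<in> excited s then (if i < 0 then 1 else - 1) else 0)"

lemma ntil_ket: "ntil i (ket s) = cscale (of_int (nval i s)) (ket s)"
proof -
  have "ntil i (ket (State S)) = cscale (of_int (nval i (State S))) (ket (State S))" if "finite S" for S
    using that by (simp add: ntil_def bop_def cop_def hneg_def ca_simps nval_def jw_remove insert_absorb
        cscale_uminus split: if_splits)
  from this[of "excited s"] show ?thesis by simp
qed

lemma clin_ntil: "clin (ntil i)"
  using linear_comp'[OF clin_cop[of "hneg i"] clin_bop[of i]]
    linear_comp'[OF linear_comp'[OF clin_bop[of i] clin_cop[of "hneg i"]] cvec.linear_uminus]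
  by (simp add: ntil_def)

definition diagop :: "complex \<Rightarrow> ('a \<Rightarrow> int) \<Rightarrow> ('a \<Rightarrow>\<^sub>0 complex) \<Rightarrow> ('a \<Rightarrow>\<^sub>0 complex)" where
  "diagop q e = linext (\<lambda>a. cscale (q powi e a) (ket a))"

lemma clin_diagop [simp]: "clin (diagop q e)"
  by (simp add: diagop_def)

lemma diagop_ket [simp]: "diagop q e (ket a) = cscale (q powi e a) (ket a)"
  by (simp add: diagop_def)

lemma lookup_diagop [simp]:
  "Poly_Mapping.lookup (diagop q e v) a = q powi e a * Poly_Mapping.lookup v a"
proof -
  have "Poly_Mapping.lookup (diagop q e v) a = (\<Sum>b\<in>Poly_Mapping.keys v. if b = a then q powi e a * Poly_Mapping.lookup v a else 0)"
    unfolding diagop_def linext_def lookup_sum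
    by (intro sum.cong) (auto simp: ket_def lookup_single when_def)
  then show ?thesis by (simp add: in_keys_iff)
qed

lemma qpow_diag:
  assumes N: "clin N" "\<And>a. N (ket a) = cscale (of_int (e a)) (ket a)"
  shows "qpow q N = diagop q e"
  unfolding qpow_def
proof (rule the_equality)
  have look: "Poly_Mapping.lookup (N v) a = of_int (e a) * Poly_Mapping.lookup v a" for v a
  proof -
    have "Poly_Mapping.lookup (N v) a = (\<Sum>b\<in>Poly_Mapping.keys v. if b = a then of_int (e a) * Poly_Mapping.lookup v a else 0)"
      unfolding lin_expand[OF N(1), of v] lookup_sum
      unfolding N(2) by (intro sum.cong) (auto simp: ket_def lookup_single when_def)
    then show ?thesis by (simp add: in_keys_iff)
  qed
  show "clin (diagop q e) \<and> (\<forall>(k::int) v. N v = cscale (of_int k) v \<longrightarrow> diagop q e v = cscale (q powi k) v)"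
  proof (intro conjI allI impI clin_diagop poly_mapping_eqI)
    fix k :: int and v a
    assume "N v = cscale (of_int k) v"
    then have "of_int (e a) * Poly_Mapping.lookup v a = of_int k * Poly_Mapping.lookup v a"
      by (metis look lookup_cscale)
    then show "Poly_Mapping.lookup (diagop q e v) a = Poly_Mapping.lookup (cscale (q powi k) v) a"
      by auto
  qed
  fix T assume T: "clin T \<and> (\<forall>(k::int) v. N v = cscale (of_int k) v \<longrightarrow> T v = cscale (q powi k) v)"
  then have "T (ket a) = diagop q e (ket a)" for a
    by (simp add: N(2))
  then have "T v = diagop q e v" for v
    by (rule lin_eqI[OF conjunct1[OF T] clin_diagop])
  then show "T = diagop q e" by (rule ext)
qed

lemma diagop_diagop:
  assumes "q \<noteq> 0"
  shows "diagop q e (diagop q e' v) = diagop q (\<lambda>a. e a + e' a) v"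
  by (rule poly_mapping_eqI) (simp add: assms power_int_add)

lemma diagop_zero: "diagop q (\<lambda>_. 0) v = v"
  by (rule poly_mapping_eqI) simp

lemma bij_diagop:
  assumes "q \<noteq> 0"
  shows "bij (diagop q e)" "inv (diagop q e) = diagop q (\<lambda>a. - e a)"
proof -
  have 1: "diagop q (\<lambda>a. - e a) (diagop q e v) = v" "diagop q e (diagop q (\<lambda>a. - e a) v) = v" for v
    by (simp_all add: diagop_diagop assms diagop_zero)
  then show "bij (diagop q e)" by (intro o_bij[of "diagop q (\<lambda>a. - e a)"]) auto
  show "inv (diagop q e) = diagop q (\<lambda>a. - e a)"
    using 1 by (intro inv_equality) auto
qed

lemma ttil_eq: "ttil q i = diagop q (nval i)"
  unfolding ttil_def by (rule qpow_diag[OF clin_ntil ntil_ket])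

lemma Ktil_eq:
  assumes "q \<noteq> 0"
  shows "Ktil q i = diagop q (\<lambda>(s, t). nval i s - nval i t)"
proof -
  have "Ktil q i v = diagop q (\<lambda>(s, t). nval i s - nval i t) v" for v
  proof (rule lin_eqI[of cscale "Ktil q i" "diagop q (\<lambda>(s, t). nval i s - nval i t)"])
    fix a :: "state \<times> state"
    obtain s t where a: "a = (s, t)" by (cases a)
    show "Ktil q i (ket a) = diagop q (\<lambda>(s, t). nval i s - nval i t) (ket a)"
      using assms by (simp add: a Ktil_def stensor_def ttil_eq bij_diagop tens_simps linear_scale'[OF clin_linext]
          power_int_diff power_int_minus field_simps)
  qed (simp_all add: Ktil_def)
  then show ?thesis by (rule ext)
qed

lemma diagop_commute: "diagop q e (diagop q e' v) = diagop q e' (diagop q e v)"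
  by (rule poly_mapping_eqI) simp

lemma keys_diagop: "Poly_Mapping.keys (diagop q e v) \<subseteq> Poly_Mapping.keys v"
  by (auto simp: in_keys_iff)

lemma diagop_neq_D: "diagop q e v \<noteq> v \<Longrightarrow> \<exists>a\<in>Poly_Mapping.keys v. e a \<noteq> 0"
proof (rule ccontr)
  assume "diagop q e v \<noteq> v" "\<not> (\<exists>a\<in>Poly_Mapping.keys v. e a \<noteq> 0)"
  moreover from this(2) have "diagop q e v = v"
    by (intro poly_mapping_eqI) (metis (no_types) in_keys_iff lookup_diagop mult_1 mult_zero_right power_int_0_right)
  ultimately show False by blast
qed

lemma finite_nval: "finite {j. \<exists>(s, t)\<in>Poly_Mapping.keys (x :: state \<times> state \<Rightarrow>\<^sub>0 complex). nval j s \<noteq> 0 \<or> nval j t \<noteq> 0}"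
  by (rule finite_subset[of _ "\<Union>(s, t)\<in>Poly_Mapping.keys x. excited s \<union> excited t"])
    (auto simp: nval_def split: if_splits)

lemma finite_Ktil:
  assumes "q \<noteq> 0"
  shows "finite {j. Ktil q j x \<noteq> x}" "finite {j. inv (Ktil q j) x \<noteq> x}"
  by (rule finite_subset[OF _ finite_nval[of x]], force dest!: diagop_neq_D simp: Ktil_eq[OF assms] bij_diagop[OF assms])+

lemma Ktil_commute:
  assumes "q \<noteq> 0"
  shows "Ktil q i (Ktil q j x) = Ktil q j (Ktil q i x)"
    "inv (Ktil q i) (inv (Ktil q j) x) = inv (Ktil q j) (inv (Ktil q i) x)"
  unfolding Ktil_eq[OF assms] bij_diagop(2)[OF assms] by (rule diagop_commute)+

lemma bij_Ktil: "q \<noteq> 0 \<Longrightarrow> bij (Ktil q i)" and bij_ttil: "q \<noteq> 0 \<Longrightarrow> bij (ttil q i)"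
  by (simp_all add: Ktil_eq ttil_eq bij_diagop)

lemma keys_opprod_Ktil:
  assumes "q \<noteq> 0"
  shows "Poly_Mapping.keys (opprod (Ktil q) J x) \<subseteq> Poly_Mapping.keys x"
proof -
  interpret comp_fun_commute "Ktil q"
    by unfold_locales (simp add: fun_eq_iff Ktil_commute(1)[OF assms])
  have "Poly_Mapping.keys (Finite_Set.fold (Ktil q) x S) \<subseteq> Poly_Mapping.keys x" if "finite S" for S
    using that
  proof induction
    case (insert j S)
    have "Finite_Set.fold (Ktil q) x (insert j S) = Ktil q j (Finite_Set.fold (Ktil q) x S)"
      using insert.hyps by (rule fold_insert)
    also have "Poly_Mapping.keys \<dots> \<subseteq> Poly_Mapping.keys (Finite_Set.fold (Ktil q) x S)"
      unfolding Ktil_eq[OF assms] by (rule keys_diagop)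
    finally show ?case using insert.IH by simp
  qed simp
  moreover have "finite {j \<in> J. Ktil q j x \<noteq> x}"
    using finite_Ktil(1)[OF assms, of x] by (rule rev_finite_subset) auto
  ultimately show ?thesis by (simp add: opprod_def)
qed

lemma stensor_neq_0D:
  assumes "stensor f g x \<noteq> 0"
  shows "\<exists>(a, b)\<in>Poly_Mapping.keys x. f (ket a) \<noteq> 0 \<and> g (ket b) \<noteq> 0"
proof (rule ccontr)
  assume *: "\<not> ?thesis"
  have "stensor f g x = (\<Sum>p\<in>Poly_Mapping.keys x. cscale (Poly_Mapping.lookup x p) (stensor f g (ket p)))"
    by (rule lin_expand) simp
  also have "\<dots> = 0"
    using * by (intro sum.neutral)
      (auto simp: stensor_def linear_0'[OF clin_linext] linear_0'[OF clin_tens_left] linear_0'[OF clin_tens_right])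
  finally show False using assms by blast
qed

lemma bop_cop_ket_neq_0:
  assumes "bop i (ket s) \<noteq> 0" "cop (hneg i) (ket t) \<noteq> 0"
  shows "nval i s \<noteq> 0 \<or> nval i t \<noteq> 0"
  using assms by (auto simp: bop_def cop_def hneg_def annihilate_def nval_def split: if_splits)

lemma finite_Eterm:
  assumes "q \<noteq> 0"
  shows "finite {i. Eterm q i x \<noteq> 0}"
  by (rule finite_subset[OF _ finite_nval[of x]])
    (force simp: Eterm_def dest!: stensor_neq_0D bop_cop_ket_neq_0 dest: keys_opprod_Ktil[OF assms, THEN subsetD])

lemma finite_Fterm:
  assumes "q \<noteq> 0"
  shows "finite {i. Fterm q i x \<noteq> 0}"
proof (rule finite_subset[OF _ finite_nval[of x]], rule subsetI, unfold mem_Collect_eq)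
  fix i assume F: "Fterm q i x \<noteq> 0"
  have "stensor (cop (hneg i)) (bop i) x \<noteq> 0"
  proof
    assume "stensor (cop (hneg i)) (bop i) x = 0"
    then have "Fterm q i x = 0"
      by (simp add: Fterm_def opprod_def bij_diagop[OF assms] Ktil_eq[OF assms] linear_0'[OF clin_diagop])
    with F show False ..
  qed
  then show "\<exists>(s, t)\<in>Poly_Mapping.keys x. nval i s \<noteq> 0 \<or> nval i t \<noteq> 0"
    by (force dest!: stensor_neq_0D dest: bop_cop_ket_neq_0)
qed

lemma rcoef_eq:
  "1 - q ^ (2 * j + nat \<bar>m\<bar>) * z \<noteq> 0 \<Longrightarrow>
    rcoef q m j z = (1 - q ^ nat \<bar>m\<bar> * z) / (1 - q ^ (2 * j + nat \<bar>m\<bar>) * z)"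
  by (cases j) (simp_all add: rcoef_def)

end

theory Submission
  imports Defs "HOL-Analysis.Continuum_Not_Denumerable"
begin

text \<open>In the Dirac sea picture a basis vector of the Fock space is a set of occupied modes, and \<open>b\<^sub>i \<otimes> c\<^sub>-\<^sub>i\<close>
  moves a particle of mode \<open>i\<close> from the second tensor factor to the first.  Call the tensor factors strands.  Then
  \<open>E\<close> moves one particle between two neighbouring strands and \<open>F\<close> moves one back, and on \<open>n\<close> strands the operators
  for all pairs of neighbours generate an action of quantum \<open>gl\<^sub>n\<close> (skew Howe duality).  The braiding matrix of two
  strands lies in the completion of the quantum \<open>sl\<^sub>2\<close> that belongs to them.

  Inversion: on an irreducible \<open>sl\<^sub>2\<close>-module the braiding matrix is a scalar multiple of the reflection of the weights
  (\<open>braid_string\<close>).  The scalar is the product \<open>\<Prod>\<^sub>t (z - q\<^bsup>2t+m\<^esup>) / (1 - q\<^bsup>2t+m\<^esup> z)\<close>, because the series for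
  \<open>A\<^sub>m(z)\<close> is its partial fraction expansion (\<open>eigcoef_sum\<close>), and \<open>z \<mapsto> 1/z\<close> inverts it.  Every weight
  vector is a sum of vectors in irreducible modules (\<open>span_string_vectors\<close>).

  Yang-Baxter: if every strand carries one particle, the equation follows from the Hecke relation
  (\<open>yang_baxter_111\<close>).  Larger particle numbers are reached by fusion: a strand with \<open>c + 1\<close> particles can be split
  into one with \<open>c\<close> particles and one with a single particle, which are braided separately with the spectral
  parameters \<open>q z\<close> and \<open>q\<^bsup>-c\<^esup> z\<close> (\<open>fusion\<close>).  On four strands this deduces the equation for \<open>(a, b, c + 1)\<close>
  from those for \<open>(a, b, c)\<close> and \<open>(a, b, 1)\<close> (\<open>yang_baxter_fuse_empty\<close>), and the inversion relation permutes the
  three particle numbers.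

  A vector of the Fock space involves finitely many modes.  On a finite window of modes the degree is the particle
  number up to a constant, and a choice of signs for the basis vectors (\<open>gauge\<close>) removes all fermionic signs, so that
  the preceding argument applies.  It needs \<open>z\<close> to be neither zero nor a power of \<open>q\<close>; the remaining values are
  limits of such \<open>z\<close>, and away from the poles both sides are continuous (\<open>Aop_yang_baxter\<close>, \<open>Aop_inverse\<close>).\<close>

section \<open>Quantum integers and partial fractions\<close>

notation cscale (infixr "\<cdot>" 75)

text \<open>The quantum integer \<open>[k]\<^sub>q\<close> of a weight \<open>k\<close>, which may be negative; for natural numbers it agrees with
  \<^const>\<open>qint\<close> (\<open>qnum_of_nat\<close>).\<close>

definition qnum :: "complex \<Rightarrow> int \<Rightarrow> complex" where
  "qnum q k = (q powi k - q powi (- k)) / (q - inverse q)"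

lemma qnum_0 [simp]: "qnum q 0 = 0"
  by (simp add: qnum_def)

lemma qnum_minus [simp]: "qnum q (- k) = - qnum q k"
  by (simp add: qnum_def minus_divide_left)

lemma qnum_of_nat: "qnum q (int n) = qint q n"
  by (simp add: qnum_def qint_def power_int_minus power_inverse)

lemma qfact_0 [simp]: "qfact q 0 = 1"
  by (simp add: qfact_def)

lemma qfact_Suc: "qfact q (Suc n) = qint q (Suc n) * qfact q n"
  by (simp add: qfact_def)

locale generic_q =
  fixes q :: complex
  assumes q_nonzero: "q \<noteq> 0" and q_not_root: "\<And>n. 0 < n \<Longrightarrow> q ^ n \<noteq> 1"
begin

lemma powi_neq_1: "k \<noteq> 0 \<Longrightarrow> q powi k \<noteq> 1"
  using q_not_root[of "nat \<bar>k\<bar>"] q_nonzero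
  by (cases "k \<ge> 0") (auto simp: power_int_def field_simps)

lemma powi_inject: "q powi j = q powi k \<longleftrightarrow> j = k"
proof
  assume "q powi j = q powi k"
  then have "q powi (j - k) = 1" using q_nonzero by (simp add: power_int_diff)
  then show "j = k" using powi_neq_1[of "j - k"] by auto
qed simp

lemma q_minus_inverse: "q - inverse q \<noteq> 0"
  using powi_inject[of 1 "- 1"] by (simp add: power_int_minus)

lemma qnum_eq_0_iff: "qnum q k = 0 \<longleftrightarrow> k = 0"
  using powi_inject[of k "- k"] q_minus_inverse by (auto simp: qnum_def)

lemma qnum_1 [simp]: "qnum q 1 = 1"
  using q_minus_inverse by (simp add: qnum_def power_int_minus)

lemma qint_eq_0_iff: "qint q n = 0 \<longleftrightarrow> n = 0"
  using qnum_eq_0_iff[of "int n"] by (simp add: qnum_of_nat)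

lemma qint_0 [simp]: "qint q 0 = 0" and qint_1 [simp]: "qint q (Suc 0) = 1"
  using qnum_of_nat[of q 0] qnum_of_nat[of q 1] by simp_all

lemma qfact_nonzero [simp]: "qfact q n \<noteq> 0"
  by (simp add: qfact_def qint_eq_0_iff)

lemma qfact_1 [simp]: "qfact q (Suc 0) = 1"
  by (simp add: qfact_Suc)

text \<open>Every identity between products of two \<open>q\<close>-numbers becomes linear in the numbers
  \<open>q powi k + q powi (- k)\<close>.\<close>

lemma qnum_mult: "qnum q a * qnum q b =
    (q powi (a + b) + q powi (- a - b) - q powi (a - b) - q powi (b - a)) / (q - inverse q)\<^sup>2"
proof -
  have "(q powi a - q powi (- a)) * (q powi b - q powi (- b)) =
      q powi (a + b) + q powi (- a - b) - q powi (a - b) - q powi (b - a)"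
    using q_nonzero by (simp add: algebra_simps flip: power_int_add)
  then show ?thesis by (simp add: qnum_def power2_eq_square)
qed

lemma qnum_exchange: "qnum q a * qnum q b + qnum q (c - a - b) * qnum q c = qnum q (c - a) * qnum q (c - b)"
  unfolding qnum_mult add_divide_distrib[symmetric]
  by (simp add: algebra_simps)

lemma qnum_times: "qnum q k * (q - inverse q) = q powi k - q powi (- k)"
  using q_minus_inverse by (simp add: qnum_def)

lemma qnum_two: "qnum q 2 = q + inverse q"
proof -
  have "qnum q 2 * (q - inverse q) = (q + inverse q) * (q - inverse q)"
    using q_nonzero by (simp only: qnum_times) (simp add: power_int_minus algebra_simps power2_eq_square)
  then show ?thesis using q_minus_inverse by simp
qed

lemma qnum_diff: "qnum q a - q * qnum q (a - 1) = q powi (1 - a)"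
  and qnum_diff': "q * qnum q a - qnum q (a - 1) = q powi a"
proof -
  have "(qnum q a - q * qnum q (a - 1)) * (q - inverse q) = q powi (1 - a) * (q - inverse q)"
    "(q * qnum q a - qnum q (a - 1)) * (q - inverse q) = q powi a * (q - inverse q)"
    using q_nonzero unfolding left_diff_distrib[of "_ :: complex" _ "q - inverse q"] mult.assoc qnum_times
    by (simp_all add: power_int_minus power_int_diff power_int_add field_simps)
  then show "qnum q a - q * qnum q (a - 1) = q powi (1 - a)" "q * qnum q a - qnum q (a - 1) = q powi a"
    using q_minus_inverse by simp_all
qed

lemma powi_diff_eq_qnum: "1 - q powi (2 * k) = - (q - inverse q) * q powi k * qnum q k"
proof -
  have "q powi k * (q powi k - q powi (- k)) = q powi (2 * k) - 1"
    using q_nonzero by (simp add: right_diff_distrib flip: power_int_add)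
  then have "1 - q powi (2 * k) = - (q powi k * (qnum q k * (q - inverse q)))"
    unfolding qnum_times by simp
  also have "\<dots> = - (q - inverse q) * q powi k * qnum q k"
    by algebra
  finally show ?thesis .
qed

lemma prod_qint_shift: "(\<Prod>t=1..n. qint q (t + k)) * qfact q k = qfact q (n + k)"
  by (induction n) (simp_all add: qfact_Suc mult_ac)

text \<open>The coefficient by which \<open>divpow q E l\<close> after \<open>divpow q F (l + m)\<close> takes a vector of weight \<open>m\<close> in an irreducible
  module of highest weight \<open>2n + m\<close> to the vector of weight \<open>- m\<close>, in a basis of divided powers.\<close>

definition eigcoef :: "nat \<Rightarrow> nat \<Rightarrow> nat \<Rightarrow> complex" where
  "eigcoef n m l = qfact q (n + m + l) / (qfact q l * qfact q (l + m) * qfact q (n - l))"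

text \<open>The two sides of \<open>eigcoef_sum_poly\<close> at \<open>z = q\<^bsup>-(2l+m)\<^esup>\<close>, where a single summand survives.\<close>

lemma eigcoef_interpolation:
  assumes "l \<le> n"
  shows "(- q) ^ l * eigcoef n m l * (\<Prod>t\<in>{..n} - {l}. 1 - q ^ (2 * t + m) / q ^ (2 * l + m)) =
    (\<Prod>t=1..n. 1 / q ^ (2 * l + m) - q ^ (2 * t + m))"
proof -
  define x where "x t = - (q - inverse q) * q powi (int t - int l)" for t
  have x_nz: "x t \<noteq> 0" for t
    using q_minus_inverse q_nonzero by (simp add: x_def)
  have f1: "1 - q ^ (2 * t + m) / q ^ (2 * l + m) = x t * qnum q (int t - int l)" for t
  proof -
    have "q ^ (2 * t + m) / q ^ (2 * l + m) = q powi (2 * (int t - int l))"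
    proof -
      have "q ^ (2 * t + m) / q ^ (2 * l + m) = q powi (int (2 * t + m) - int (2 * l + m))"
        using q_nonzero power_int_diff[of q "int (2 * t + m)" "int (2 * l + m)"] by (metis power_int_of_nat)
      also have "int (2 * t + m) - int (2 * l + m) = 2 * (int t - int l)" by simp
      finally show ?thesis .
    qed
    then show ?thesis by (simp only: powi_diff_eq_qnum x_def)
  qed
  have f2: "1 / q ^ (2 * l + m) - q ^ (2 * t + m) = x t * qint q (t + (l + m))" for t
  proof -
    have "1 / q ^ (2 * l + m) - q ^ (2 * t + m) = (1 - q powi (2 * int (t + (l + m)))) / q ^ (2 * l + m)"
      using q_nonzero
      by (simp add: field_simps flip: power_int_of_nat power_int_add)
    also have "\<dots> = - (q - inverse q) * (q powi int (t + (l + m)) / q powi int (2 * l + m)) * qint q (t + (l + m))"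
      unfolding powi_diff_eq_qnum qnum_of_nat by (simp flip: power_int_of_nat)
    also have "q powi int (t + (l + m)) / q powi int (2 * l + m) = q powi (int t - int l)"
      using q_nonzero by (simp flip: power_int_diff)
    finally show ?thesis by (simp add: x_def)
  qed
  have "(\<Prod>t\<in>{..n}. x t) = x l * (\<Prod>t\<in>{..n} - {l}. x t)"
    using assms by (simp add: prod.remove)
  moreover have "(\<Prod>t\<in>{..n}. x t) = x 0 * (\<Prod>t=1..n. x t)"
    by (simp add: atMost_atLeast0 prod.atLeast_Suc_atMost)
  moreover have "x l = q ^ l * x 0"
    using q_nonzero by (simp add: x_def power_int_minus)
  ultimately have px: "(\<Prod>t=1..n. x t) = q ^ l * (\<Prod>t\<in>{..n} - {l}. x t)"
    using x_nz[of 0] by (simp add: mult_ac)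
  have split: "{..n} - {l} = {..<l} \<union> {l<..n}" using assms by auto
  have "(\<Prod>t\<in>{..n} - {l}. qnum q (int t - int l)) =
      (\<Prod>t\<in>{..<l}. qnum q (int t - int l)) * (\<Prod>t\<in>{l<..n}. qnum q (int t - int l))"
    unfolding split by (rule prod.union_disjoint) auto
  also have "(\<Prod>t\<in>{..<l}. qnum q (int t - int l)) = (\<Prod>t\<in>{1..l}. - qint q t)"
    by (rule prod.reindex_bij_witness[of _ "\<lambda>t. l - t" "\<lambda>t. l - t"])
      (auto simp: of_nat_diff simp flip: qnum_of_nat qnum_minus)
  also have "\<dots> = (- 1) ^ l * qfact q l"
    by (simp add: qfact_def prod_uminus)
  also have "(\<Prod>t\<in>{l<..n}. qnum q (int t - int l)) = qfact q (n - l)"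
    unfolding qfact_def using assms
    by (intro prod.reindex_bij_witness[of _ "\<lambda>t. t + l" "\<lambda>t. t - l"])
      (auto simp: of_nat_diff simp flip: qnum_of_nat)
  finally have pq: "(\<Prod>t\<in>{..n} - {l}. qnum q (int t - int l)) = (- 1) ^ l * qfact q l * qfact q (n - l)" .
  have "(- q) ^ l * eigcoef n m l * (\<Prod>t\<in>{..n} - {l}. 1 - q ^ (2 * t + m) / q ^ (2 * l + m)) =
      q ^ l * (\<Prod>t\<in>{..n} - {l}. x t) * (eigcoef n m l * qfact q l * qfact q (n - l))"
    unfolding f1 prod.distrib pq by (simp add: power_minus[of q l])
  also have "eigcoef n m l * qfact q l * qfact q (n - l) = (\<Prod>t=1..n. qint q (t + (l + m)))"
    using prod_qint_shift[where n = n and k = "l + m"] by (simp add: eigcoef_def add_ac field_simps)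
  also have "q ^ l * (\<Prod>t\<in>{..n} - {l}. x t) * (\<Prod>t=1..n. qint q (t + (l + m))) =
      (\<Prod>t=1..n. 1 / q ^ (2 * l + m) - q ^ (2 * t + m))"
    unfolding f2 prod.distrib px ..
  finally show ?thesis .
qed

text \<open>Both sides are polynomials in \<open>z\<close> of degree at most \<open>n\<close> that agree at \<open>n + 1\<close> points.\<close>

lemma eigcoef_sum_poly:
  "(\<Sum>l\<le>n. (- q) ^ l * eigcoef n m l * (\<Prod>t\<in>{..n} - {l}. 1 - q ^ (2 * t + m) * z)) =
    (\<Prod>t=1..n. z - q ^ (2 * t + m))"
proof -
  define L where "L = (\<Sum>l\<le>n. smult ((- q) ^ l * eigcoef n m l) (\<Prod>t\<in>{..n} - {l}. [:1, - (q ^ (2 * t + m)):]))"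
  define R where "R = (\<Prod>t=1..n. [:- (q ^ (2 * t + m)), 1:])"
  have polyL: "poly L z = (\<Sum>l\<le>n. (- q) ^ l * eigcoef n m l * (\<Prod>t\<in>{..n} - {l}. 1 - q ^ (2 * t + m) * z))" for z
    by (simp add: L_def poly_sum poly_prod mult.commute)
  have polyR: "poly R z = (\<Prod>t=1..n. z - q ^ (2 * t + m))" for z
    by (simp add: R_def poly_prod)
  have degL: "degree L \<le> n"
    unfolding L_def
  proof (intro degree_sum_le)
    fix l assume l: "l \<in> {..n}"
    have "degree (\<Prod>t\<in>{..n} - {l}. [:1, - (q ^ (2 * t + m)):]) \<le> (\<Sum>t\<in>{..n} - {l}. degree [:1, - (q ^ (2 * t + m)):])"
      by (rule order_trans[OF degree_prod_sum_le]) simp_all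
    also have "\<dots> \<le> (\<Sum>t\<in>{..n} - {l}. 1)" by (intro sum_mono) simp
    also have "\<dots> = n" using l by simp
    finally show "degree (smult ((- q) ^ l * eigcoef n m l) (\<Prod>t\<in>{..n} - {l}. [:1, - (q ^ (2 * t + m)):])) \<le> n"
      using degree_smult_le order_trans by blast
  qed simp
  have degR: "degree R \<le> n"
  proof -
    have "degree R \<le> (\<Sum>t=1..n. degree [:- (q ^ (2 * t + m)), 1:])"
      unfolding R_def by (rule order_trans[OF degree_prod_sum_le]) simp_all
    then show ?thesis by simp
  qed
  have "inj_on (\<lambda>l. 1 / q ^ (2 * l + m)) {..n}"
  proof (rule inj_onI)
    fix j k :: nat assume "1 / q ^ (2 * j + m) = 1 / q ^ (2 * k + m)"
    then have "q powi int (2 * j + m) = q powi int (2 * k + m)" by (simp only: power_int_of_nat) simp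
    then show "j = k" unfolding powi_inject by simp
  qed
  then have card: "card ((\<lambda>l. 1 / q ^ (2 * l + m)) ` {..n}) = Suc n"
    by (simp add: card_image)
  have "L = R"
  proof (rule ccontr)
    assume "L \<noteq> R"
    then have "card {x. poly (L - R) x = 0} \<le> degree (L - R)"
      by (intro card_poly_roots_bound) simp
    also have "\<dots> \<le> n" using degL degR by (rule degree_diff_le)
    finally have "card {x. poly (L - R) x = 0} \<le> n" .
    moreover have sub: "(\<lambda>l. 1 / q ^ (2 * l + m)) ` {..n} \<subseteq> {x. poly (L - R) x = 0}"
    proof safe
      fix l assume l: "l \<le> n"
      have "poly L (1 / q ^ (2 * l + m)) =
          (\<Sum>j\<in>{l}. (- q) ^ j * eigcoef n m j * (\<Prod>t\<in>{..n} - {j}. 1 - q ^ (2 * t + m) * (1 / q ^ (2 * l + m))))"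
        unfolding polyL using l q_nonzero
        by (intro sum.mono_neutral_right) (auto intro!: bexI[of _ l])
      also have "\<dots> = poly R (1 / q ^ (2 * l + m))"
        using eigcoef_interpolation[OF l, of m] by (simp add: polyR)
      finally show "poly (L - R) (1 / q ^ (2 * l + m)) = 0" by simp
    qed
    moreover have "finite {x. poly (L - R) x = 0}"
      using \<open>L \<noteq> R\<close> by (intro poly_roots_finite) simp
    from card_mono[OF this sub] have "Suc n \<le> card {x. poly (L - R) x = 0}"
      by (simp only: card)
    ultimately show False by simp
  qed
  then show ?thesis using polyL polyR by metis
qed

text \<open>The partial fraction expansion that identifies the series of \<open>A\<^sub>m(z)\<close> on an irreducible module.\<close>

lemma eigcoef_sum:
  assumes "\<And>l. l \<le> n \<Longrightarrow> 1 - q ^ (2 * l + m) * z \<noteq> 0"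
  shows "(\<Sum>l\<le>n. (- q) ^ l * eigcoef n m l * ((1 - q ^ m * z) / (1 - q ^ (2 * l + m) * z))) =
    (\<Prod>t=1..n. (z - q ^ (2 * t + m)) / (1 - q ^ (2 * t + m) * z))"
proof -
  define D where "D = (\<Prod>t\<le>n. 1 - q ^ (2 * t + m) * z)"
  have D: "D \<noteq> 0" using assms by (simp add: D_def)
  have rem: "D = (1 - q ^ (2 * l + m) * z) * (\<Prod>t\<in>{..n} - {l}. 1 - q ^ (2 * t + m) * z)" if "l \<le> n" for l
    using that by (simp add: D_def prod.remove)
  have D0: "D = (1 - q ^ m * z) * (\<Prod>t=1..n. 1 - q ^ (2 * t + m) * z)"
    by (simp add: D_def atMost_atLeast0 prod.atLeast_Suc_atMost)
  have "(\<Sum>l\<le>n. (- q) ^ l * eigcoef n m l * ((1 - q ^ m * z) / (1 - q ^ (2 * l + m) * z))) =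
      (\<Sum>l\<le>n. (1 - q ^ m * z) / D * ((- q) ^ l * eigcoef n m l * (\<Prod>t\<in>{..n} - {l}. 1 - q ^ (2 * t + m) * z)))"
  proof (intro sum.cong refl)
    fix l assume "l \<in> {..n}"
    then show "(- q) ^ l * eigcoef n m l * ((1 - q ^ m * z) / (1 - q ^ (2 * l + m) * z)) =
        (1 - q ^ m * z) / D * ((- q) ^ l * eigcoef n m l * (\<Prod>t\<in>{..n} - {l}. 1 - q ^ (2 * t + m) * z))"
      using assms[of l] D rem[of l] by (simp add: divide_simps)
  qed
  also have "\<dots> = (1 - q ^ m * z) / D * (\<Prod>t=1..n. z - q ^ (2 * t + m))"
    by (simp only: eigcoef_sum_poly flip: sum_distrib_left)
  also have "\<dots> = (\<Prod>t=1..n. (z - q ^ (2 * t + m)) / (1 - q ^ (2 * t + m) * z))"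
    using D unfolding D0 by (simp add: prod_dividef)
  finally show ?thesis .
qed

text \<open>This is \<open>eigcoef_sum\<close> at the zero \<open>z = q\<^bsup>2t+m\<^esup>\<close> of its right-hand side.\<close>

lemma eigcoef_sum_zero:
  assumes "1 \<le> t" "t \<le> n"
  shows "(\<Sum>l\<le>n. (- 1) ^ l * eigcoef n m l / qint q (l + m + t)) = 0"
proof -
  define z where "z = q ^ (2 * t + m)"
  have eq: "1 - q ^ (2 * l + m) * z = - (q - inverse q) * q ^ (l + m + t) * qint q (l + m + t)" for l
  proof -
    have "1 - q ^ (2 * l + m) * z = 1 - q powi (2 * int (l + m + t))"
    proof -
      have "q ^ (2 * l + m) * z = q powi int (2 * l + m + (2 * t + m))"
        by (simp only: z_def power_int_of_nat power_add)
      also have "int (2 * l + m + (2 * t + m)) = 2 * int (l + m + t)" by simp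
      finally show ?thesis by simp
    qed
    then show ?thesis by (simp only: powi_diff_eq_qnum qnum_of_nat power_int_of_nat)
  qed
  have nz: "1 - q ^ (2 * l + m) * z \<noteq> 0" for l
    unfolding eq using assms q_minus_inverse q_nonzero by (simp add: qint_eq_0_iff)
  have "(\<Sum>l\<le>n. (- q) ^ l * eigcoef n m l * ((1 - q ^ m * z) / (1 - q ^ (2 * l + m) * z))) = 0"
    using assms by (subst eigcoef_sum[OF nz]) (auto simp: z_def intro!: prod_zero)
  also have "(\<Sum>l\<le>n. (- q) ^ l * eigcoef n m l * ((1 - q ^ m * z) / (1 - q ^ (2 * l + m) * z))) =
      (\<Sum>l\<le>n. (1 - q ^ m * z) / (- (q - inverse q) * q ^ (m + t)) * ((- 1) ^ l * eigcoef n m l / qint q (l + m + t)))"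
    unfolding eq using q_nonzero by (intro sum.cong refl) (simp add: power_minus[of q] power_add mult.assoc)
  finally show ?thesis
    unfolding sum_distrib_left[symmetric] using nz[of 0] q_minus_inverse q_nonzero by simp
qed

end

section \<open>Divided powers\<close>

lemma divpow_0 [simp]: "divpow q T 0 x = x"
  by (simp add: divpow_def)

lemma clin_funpow:
  fixes T :: "('a \<Rightarrow>\<^sub>0 complex) \<Rightarrow> ('a \<Rightarrow>\<^sub>0 complex)"
  assumes "clin T"
  shows "clin (T ^^ n)"
proof (induction n)
  case 0
  show ?case by (intro clinI) simp_all
next
  case (Suc n)
  then show ?case using linear_comp'[OF _ assms, of cscale "T ^^ n"] by (simp add: comp_def)
qed

lemma linear_diff': "Vector_Spaces.linear s1 s2 f \<Longrightarrow> f (x - y) = f x - f y"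
  using linear_add'[of s1 s2 f "x - y" y] by (simp add: algebra_simps)

lemma cscale_cancel: "c \<cdot> x = c \<cdot> y \<Longrightarrow> c \<noteq> 0 \<Longrightarrow> x = y"
  by simp

lemma clin_scaled: "clin T \<Longrightarrow> clin (\<lambda>x. c \<cdot> T x)"
  using linear_comp'[OF _ cvec.linear_scale_self] by blast

lemma clin_sum: "(\<And>i. i \<in> I \<Longrightarrow> clin (f i)) \<Longrightarrow> clin (\<lambda>x. \<Sum>i\<in>I. f i x)"
  by (induction I rule: infinite_finite_induct) (simp_all add: clin_zero clin_add)

lemma clin_divpow: "clin T \<Longrightarrow> clin (divpow q T n)"
  unfolding divpow_def[abs_def] by (intro clin_scaled clin_funpow)

lemma divpow_map: "clin T \<Longrightarrow> divpow q T n (T x) = T (divpow q T n x)"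
  by (simp add: divpow_def linear_scale' funpow_swap1)

lemma divpow_commute:
  assumes "clin S" and "\<And>x. S (T x) = T' (S x)"
  shows "S (divpow q T n x) = divpow q T' n (S x)"
proof -
  have "S ((T ^^ n) x) = (T' ^^ n) (S x)"
    by (induction n) (simp_all add: assms(2))
  then show ?thesis using assms(1) by (simp add: divpow_def linear_scale')
qed

lemma cscale_sum: "c \<cdot> (\<Sum>i\<in>I. f i) = (\<Sum>i\<in>I. c \<cdot> f i)"
  by (rule cvec.scale_sum_right)

context generic_q begin

lemma divpow_Suc: "clin T \<Longrightarrow> T (divpow q T n x) = qint q (Suc n) \<cdot> divpow q T (Suc n) x"
  by (simp add: divpow_def linear_scale' qfact_Suc qint_eq_0_iff)

lemma divpow_Suc_0: "divpow q T (Suc 0) x = T x"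
  by (simp add: divpow_def)

lemma divpow_eq_0_mono:
  assumes "clin T" "divpow q T n x = 0" "n \<le> m"
  shows "divpow q T m x = 0"
  using assms(3)
proof (induction rule: dec_induct)
  case (step m)
  then show ?case using divpow_Suc[OF assms(1), of m x] assms(1) by (simp add: linear_0' qint_eq_0_iff)
qed (rule assms(2))

lemma qnum_step: "qint q (Suc n) * qnum q (k - int n) + qnum q (k - 2 * int (Suc n)) =
    qint q (Suc (Suc n)) * qnum q (k - int (Suc n))"
proof -
  define x where "x = qnum q (k - 2 * int (Suc n))"
  have 1: "qnum q (1 - (- int (Suc n)) - (k - int n)) = - x"
    unfolding x_def qnum_minus[symmetric] by (rule arg_cong[where f = "qnum q"]) simp
  have 2: "qnum q (1 - (k - int n)) = - qnum q (k - int (Suc n))"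
    unfolding qnum_minus[symmetric] by (rule arg_cong[where f = "qnum q"]) simp
  have 3: "qnum q (1 - (- int (Suc n))) = qint q (Suc (Suc n))"
    unfolding qnum_of_nat[symmetric] by (rule arg_cong[where f = "qnum q"]) simp
  have "- qint q (Suc n) * qnum q (k - int n) + (- x) * 1 = qint q (Suc (Suc n)) * (- qnum q (k - int (Suc n)))"
    using qnum_exchange[of "- int (Suc n)" "k - int n" 1] unfolding 1 2 3 qnum_minus qnum_1 qnum_of_nat .
  then show ?thesis unfolding x_def[symmetric] by algebra
qed

end

section \<open>Weight modules of quantum sl2\<close>

text \<open>The relations of quantum \<open>sl\<^sub>2\<close>, with \<open>W k\<close> the space of vectors of weight \<open>k\<close>.  The bound \<open>H\<close> on the weights makes
  \<open>E\<close> and \<open>F\<close> nilpotent.\<close>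

locale sl2 = generic_q q for q +
  fixes E F :: "('b \<Rightarrow>\<^sub>0 complex) \<Rightarrow> ('b \<Rightarrow>\<^sub>0 complex)"
    and W :: "int \<Rightarrow> ('b \<Rightarrow>\<^sub>0 complex) set" and H :: nat
  assumes clin_E: "clin E" and clin_F: "clin F"
    and subspace_W: "cvec.subspace (W k)"
    and E_W: "v \<in> W k \<Longrightarrow> E v \<in> W (k + 2)"
    and F_W: "v \<in> W k \<Longrightarrow> F v \<in> W (k - 2)"
    and EF: "v \<in> W k \<Longrightarrow> E (F v) = F (E v) + qnum q k \<cdot> v"
    and W_bound: "v \<in> W k \<Longrightarrow> v \<noteq> 0 \<Longrightarrow> \<bar>k\<bar> \<le> int H"
begin

lemmas E_simps = linear_add'[OF clin_E] linear_scale'[OF clin_E] linear_0'[OF clin_E]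
lemmas F_simps = linear_add'[OF clin_F] linear_scale'[OF clin_F] linear_0'[OF clin_F]

lemmas E_Ed = divpow_Suc[OF clin_E] and F_Fd = divpow_Suc[OF clin_F]

abbreviation "Ed \<equiv> divpow q E"
abbreviation "Fd \<equiv> divpow q F"

lemma F_funpow_W: "v \<in> W k \<Longrightarrow> (F ^^ n) v \<in> W (k - 2 * int n)"
proof (induction n)
  case (Suc n)
  then show ?case using F_W[of "(F ^^ n) v" "k - 2 * int n"] by (simp add: algebra_simps)
qed simp

lemma E_funpow_W: "v \<in> W k \<Longrightarrow> (E ^^ n) v \<in> W (k + 2 * int n)"
proof (induction n)
  case (Suc n)
  then show ?case using E_W[of "(E ^^ n) v" "k + 2 * int n"] by (simp add: algebra_simps)
qed simp

lemma Fd_W: "v \<in> W k \<Longrightarrow> Fd n v \<in> W (k - 2 * int n)"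
  by (simp add: divpow_def cvec.subspace_scale[OF subspace_W] F_funpow_W)

lemma E_Fd: "v \<in> W k \<Longrightarrow> E (Fd (Suc n) v) = Fd (Suc n) (E v) + qnum q (k - int n) \<cdot> Fd n v"
proof (induction n)
  case 0
  then show ?case by (simp add: divpow_Suc_0 EF)
next
  case (Suc n)
  have "qint q (Suc (Suc n)) \<cdot> E (Fd (Suc (Suc n)) v) = E (F (Fd (Suc n) v))"
    by (simp add: F_Fd E_simps)
  also have "\<dots> = F (E (Fd (Suc n) v)) + qnum q (k - 2 * int (Suc n)) \<cdot> Fd (Suc n) v"
    by (rule EF) (rule Fd_W[OF Suc.prems])
  also have "\<dots> = qint q (Suc (Suc n)) \<cdot> Fd (Suc (Suc n)) (E v) +
      (qint q (Suc n) * qnum q (k - int n) + qnum q (k - 2 * int (Suc n))) \<cdot> Fd (Suc n) v"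
    unfolding Suc.IH[OF Suc.prems] cvec.scale_left_distrib
    by (simp add: F_simps F_Fd mult.commute)
  also note qnum_step
  finally have "qint q (Suc (Suc n)) \<cdot> E (Fd (Suc (Suc n)) v) =
      qint q (Suc (Suc n)) \<cdot> (Fd (Suc (Suc n)) (E v) + qnum q (k - int (Suc n)) \<cdot> Fd (Suc n) v)"
    by (simp add: cvec.scale_right_distrib)
  then show ?case by (rule cscale_cancel) (simp add: qint_eq_0_iff)
qed

lemma Fd_vanishes: "v \<in> W k \<Longrightarrow> \<exists>n. Fd n v = 0"
proof -
  assume v: "v \<in> W k"
  define n where "n = nat (\<bar>k\<bar> + int H + 1)"
  have "\<bar>k - 2 * int n\<bar> > int H" by (simp add: n_def)
  then show ?thesis using W_bound[OF Fd_W[OF v, of n]] by (auto intro!: exI[of _ n])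
qed

text \<open>As \<open>F (E v) = 0\<close>, \<open>E_Fd\<close> says that \<open>E (Fd (Suc n) v)\<close> is \<open>Fd n v\<close> times the quantum integer of \<open>k - n\<close>, which is
  nonzero.  So with \<open>Fd (Suc n) v\<close> also \<open>Fd n v\<close> vanishes, and for large \<open>n\<close> the former does.\<close>

lemma eq_0_if_negative:
  assumes "v \<in> W k" "k < 0" "F (E v) = 0"
  shows "v = 0"
proof -
  have step: "Fd n v = 0" if "Fd (Suc n) v = 0" for n
  proof -
    have "Fd (Suc n) (E v) = 0"
      by (rule divpow_eq_0_mono[OF clin_F, of "Suc 0"]) (simp_all add: divpow_Suc_0 assms(3))
    then have "qnum q (k - int n) \<cdot> Fd n v = 0"
      using E_Fd[OF assms(1), of n] that by (simp add: E_simps)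
    then show ?thesis using assms(2) by (simp add: qnum_eq_0_iff)
  qed
  have "Fd n v = 0 \<Longrightarrow> v = 0" for n
    by (induction n) (use step in auto)
  then show ?thesis using Fd_vanishes[OF assms(1)] by blast
qed

text \<open>A basis \<open>f 0, \<dots>, f h\<close> of divided powers in an irreducible module, continued by zero.  The truncated difference
  \<open>h - s\<close> is right for \<open>s \<ge> h\<close>, too, where \<open>E (f (Suc s))\<close> vanishes.\<close>

definition string :: "nat \<Rightarrow> (nat \<Rightarrow> ('b \<Rightarrow>\<^sub>0 complex)) \<Rightarrow> bool" where
  "string h f \<longleftrightarrow> E (f 0) = 0 \<and> (\<forall>s. F (f s) = qint q (Suc s) \<cdot> f (Suc s)) \<and>
    (\<forall>s. E (f (Suc s)) = qint q (h - s) \<cdot> f s) \<and> (\<forall>s>h. f s = 0)"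

lemma stringD:
  assumes "string h f"
  shows "E (f 0) = 0" "F (f s) = qint q (Suc s) \<cdot> f (Suc s)"
    "E (f (Suc s)) = qint q (h - s) \<cdot> f s" "h < s \<Longrightarrow> f s = 0"
  using assms unfolding string_def by blast+

lemma string_of_singular:
  assumes "v \<in> W k" "E v = 0" "v \<noteq> 0"
  shows "string (nat k) (\<lambda>s. Fd s v)" "0 \<le> k"
proof -
  show k: "0 \<le> k"
    using eq_0_if_negative[OF assms(1)] assms(2,3) by (fastforce simp: F_simps)
  have E: "E (Fd (Suc s) v) = qnum q (k - int s) \<cdot> Fd s v" for s
    using E_Fd[OF assms(1), of s] assms(2) linear_0'[OF clin_divpow[OF clin_F]] by simp
  have "Fd (Suc (nat k)) v = 0"
    using Fd_W[OF assms(1), of "Suc (nat k)"] E[of "nat k"] k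
    by (elim eq_0_if_negative) (simp_all add: F_simps)
  then have z: "Fd s v = 0" if "s > nat k" for s
    using that divpow_eq_0_mono[OF clin_F] by (metis Suc_leI)
  have "qnum q (k - int s) \<cdot> Fd s v = qint q (nat k - s) \<cdot> Fd s v" for s
    using z[of s] k by (cases "s \<le> nat k") (auto simp: of_nat_diff simp flip: qnum_of_nat)
  then show "string (nat k) (\<lambda>s. Fd s v)"
    using z E assms(2) by (simp add: string_def F_Fd)
qed

lemma Fd_string:
  assumes "string h f"
  shows "Fd l (f s) = (qfact q (s + l) / (qfact q s * qfact q l)) \<cdot> f (s + l)"
proof (induction l)
  case (Suc l)
  have "qint q (Suc l) \<cdot> Fd (Suc l) (f s) = F (Fd l (f s))"
    by (simp add: F_Fd)
  also have "\<dots> = (qfact q (s + l) / (qfact q s * qfact q l) * qint q (Suc (s + l))) \<cdot> f (s + Suc l)"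
    using assms by (simp add: Suc F_simps string_def)
  finally have "qint q (Suc l) \<cdot> Fd (Suc l) (f s) =
      qint q (Suc l) \<cdot> ((qfact q (s + Suc l) / (qfact q s * qfact q (Suc l))) \<cdot> f (s + Suc l))"
    by (simp add: qfact_Suc qint_eq_0_iff mult_ac)
  then show ?case by (rule cscale_cancel) (simp add: qint_eq_0_iff)
qed simp

lemma Ed_string:
  assumes "string h f" "i \<le> s" "s \<le> h"
  shows "Ed i (f s) = (qfact q (h - s + i) / (qfact q (h - s) * qfact q i)) \<cdot> f (s - i)"
  using assms(2)
proof (induction i)
  case (Suc i)
  have "qint q (Suc i) \<cdot> Ed (Suc i) (f s) = E (Ed i (f s))"
    by (simp add: E_Ed)
  also have "\<dots> = (qfact q (h - s + i) / (qfact q (h - s) * qfact q i)) \<cdot> E (f (s - i))"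
    using Suc by (simp add: E_simps)
  also have "s - i = Suc (s - Suc i)" using Suc.prems by simp
  also have "E (f (Suc (s - Suc i))) = qint q (h - (s - Suc i)) \<cdot> f (s - Suc i)"
    using assms(1) by (simp add: string_def)
  also have "h - (s - Suc i) = Suc (h - s + i)" using Suc.prems assms(3) by simp
  finally have "qint q (Suc i) \<cdot> Ed (Suc i) (f s) =
      qint q (Suc i) \<cdot> ((qfact q (h - s + Suc i) / (qfact q (h - s) * qfact q (Suc i))) \<cdot> f (s - Suc i))"
    by (simp add: qfact_Suc qint_eq_0_iff mult_ac)
  then show ?case by (rule cscale_cancel) (simp add: qint_eq_0_iff)
qed simp

lemma Ed_string_0:
  assumes "string h f" "s < i" "s \<le> h"
  shows "Ed i (f s) = 0"
proof -
  have "qint q (Suc s) \<cdot> Ed (Suc s) (f s) = E (Ed s (f s))"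
    by (simp add: E_Ed)
  also have "\<dots> = 0"
    using assms Ed_string[OF assms(1), of s s] by (simp add: string_def E_simps)
  finally have "Ed (Suc s) (f s) = 0" by (simp add: qint_eq_0_iff)
  then show ?thesis using assms(2) divpow_eq_0_mono[OF clin_E] by (metis Suc_leI)
qed

definition string_vectors :: "int \<Rightarrow> ('b \<Rightarrow>\<^sub>0 complex) set" where
  "string_vectors k = {f s | h f s. string h f \<and> s \<le> h \<and> h \<le> H \<and> k = int h - 2 * int s \<and> f s \<in> W k}"

text \<open>Complete reducibility, by induction on the order of nilpotency of \<open>E\<close> on \<open>v\<close>.  The vector \<open>E v\<close> is a combination of
  members of strings, and all of them are in the image of \<open>E\<close> up to the last members of strings, which lie in the
  space \<open>R\<close> of the proof.  Subtracting from \<open>v\<close> a combination \<open>x\<close> of string members leaves a vector \<open>w\<close> with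
  \<open>E w \<in> R\<close>.  It generates a string if \<open>k \<ge> 0\<close>, and vanishes by \<open>eq_0_if_negative\<close> if \<open>k < 0\<close>.\<close>

lemma span_string_vectors: "v \<in> W k \<Longrightarrow> v \<in> cvec.span (string_vectors k)"
proof -
  have span_W: "cvec.span (string_vectors k) \<subseteq> W k" for k
    by (rule cvec.span_minimal[OF _ subspace_W]) (auto simp: string_vectors_def)
  have main: "v \<in> W k \<Longrightarrow> (E ^^ n) v = 0 \<Longrightarrow> v \<in> cvec.span (string_vectors k)" for n k v
  proof (induction n arbitrary: k v)
    case 0
    then show ?case by (simp add: cvec.span_zero)
  next
    case (Suc n)
    define R where "R = {r. F r = 0 \<and> (0 < k + 2 \<longrightarrow> r = 0)}"
    have R: "cvec.subspace R"
      unfolding R_def cvec.subspace_def by (auto simp: F_simps)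
    have "(E ^^ n) (E v) = 0" using Suc.prems(2) by (simp add: funpow_swap1)
    then have Ev: "E v \<in> cvec.span (string_vectors (k + 2))"
      using Suc.IH E_W[OF Suc.prems(1)] by blast
    have "\<exists>x\<in>cvec.span (string_vectors k). E v - E x \<in> R"
      using Ev
    proof (induction rule: cvec.span_induct_alt)
      case base
      show ?case using cvec.span_zero cvec.subspace_0[OF R] by (auto simp: E_simps intro!: bexI[of _ 0])
    next
      case (step c y u)
      then obtain x where x: "x \<in> cvec.span (string_vectors k)" "u - E x \<in> R" by blast
      from step(1) obtain h f s where y: "y = f s" "string h f" "s \<le> h" "h \<le> H" "k + 2 = int h - 2 * int s" "f s \<in> W (k + 2)"
        unfolding string_vectors_def by blast
      have "\<exists>x'\<in>cvec.span (string_vectors k). y - E x' \<in> R"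
      proof (cases "s < h")
        case True
        have "F (f s) \<in> W k" using F_W[OF y(6)] by simp
        then have "(1 / qint q (Suc s)) \<cdot> F (f s) \<in> W k"
          by (rule cvec.subspace_scale[OF subspace_W])
        then have "f (Suc s) \<in> W k"
          by (simp add: stringD(2)[OF y(2)] qint_eq_0_iff)
        then have "f (Suc s) \<in> string_vectors k"
          unfolding string_vectors_def mem_Collect_eq using y(2-5) True
          by (intro exI[of _ h] exI[of _ f] exI[of _ "Suc s"]) simp
        then have "f (Suc s) \<in> cvec.span (string_vectors k)"
          by (rule cvec.span_base)
        moreover have "y - E ((1 / qint q (h - s)) \<cdot> f (Suc s)) \<in> R"
          using y(1) True cvec.subspace_0[OF R] by (simp add: E_simps stringD(3)[OF y(2)] qint_eq_0_iff)
        ultimately show ?thesis using cvec.span_scale by fast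
      next
        case False
        with y(1,3,5) have "y \<in> R" by (auto simp: R_def stringD(2)[OF y(2)] stringD(4)[OF y(2)])
        then show ?thesis using cvec.span_zero by (auto simp: E_simps intro!: bexI[of _ 0])
      qed
      then obtain x' where x': "x' \<in> cvec.span (string_vectors k)" "y - E x' \<in> R" by blast
      have "(c \<cdot> y + u) - E (c \<cdot> x' + x) = c \<cdot> (y - E x') + (u - E x)"
        by (simp add: E_simps cvec.scale_right_diff_distrib)
      then show ?case
        using cvec.subspace_add[OF R cvec.subspace_scale[OF R x'(2)] x(2)]
          cvec.span_add[OF cvec.span_scale[OF x'(1)] x(1)] by metis
    qed
    then obtain x where x: "x \<in> cvec.span (string_vectors k)" "E v - E x \<in> R" by blast
    define w where "w = v - x"
    have w: "w \<in> W k"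
      unfolding w_def using cvec.subspace_diff[OF subspace_W] Suc.prems(1) x(1) span_W by blast
    have Ew: "E w \<in> R"
      using x(2) linear_diff'[OF clin_E] by (simp add: w_def)
    have "w \<in> cvec.span (string_vectors k)"
    proof (cases "w = 0 \<or> k < 0")
      case True
      then have "w = 0" using eq_0_if_negative[OF w] Ew by (auto simp: R_def)
      then show ?thesis by (simp add: cvec.span_zero)
    next
      case False
      then have "E w = 0" using Ew by (simp add: R_def)
      from string_of_singular[OF w this] False have "string (nat k) (\<lambda>s. Fd s w)" by blast
      then have "w \<in> string_vectors k"
        unfolding string_vectors_def mem_Collect_eq using w W_bound[OF w] False
        by (intro exI[of _ "nat k"] exI[of _ "\<lambda>s. Fd s w"] exI[of _ 0]) auto
      then show ?thesis by (rule cvec.span_base)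
    qed
    then show ?case
      using cvec.span_add[OF _ x(1), of w] by (simp add: w_def)
  qed
  assume v: "v \<in> W k"
  define n where "n = nat (\<bar>k\<bar> + int H + 1)"
  have "(E ^^ n) v \<in> W (k + 2 * int n)"
    using v by (rule E_funpow_W)
  moreover have "\<bar>k + 2 * int n\<bar> > int H" by (simp add: n_def)
  ultimately have "(E ^^ n) v = 0" using W_bound by (meson not_le)
  then show ?thesis using main v by blast
qed

lemma eq_0_on_strings:
  assumes "clin L" "v \<in> W k"
    and "\<And>h f s. string h f \<Longrightarrow> s \<le> h \<Longrightarrow> h \<le> H \<Longrightarrow> k = int h - 2 * int s \<Longrightarrow> L (f s) = 0"
  shows "L v = 0"
  using span_string_vectors[OF assms(2)]
proof (induction rule: cvec.span_induct_alt)
  case (step c x y)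
  then show ?case using assms(3)
    by (auto simp: string_vectors_def linear_add'[OF assms(1)] linear_scale'[OF assms(1)])
qed (simp add: linear_0'[OF assms(1)])

end

section \<open>The braiding matrix on a weight module\<close>

context generic_q begin

text \<open>For these \<open>z\<close> no coefficient of the braiding matrix has a pole and no eigenvalue vanishes.  They are stable under
  inversion and under multiplication by powers of \<open>q\<close>.\<close>

definition generic :: "complex \<Rightarrow> bool" where
  "generic z \<longleftrightarrow> z \<noteq> 0 \<and> (\<forall>n::int. z \<noteq> q powi n)"

lemma generic_nonzero: "generic z \<Longrightarrow> z \<noteq> 0"
  by (simp add: generic_def)

lemma generic_denom: "generic z \<Longrightarrow> 1 - q ^ n * z \<noteq> 0"
proof
  assume "generic z" "1 - q ^ n * z = 0"
  then have "z = q powi (- int n)"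
    using q_nonzero by (simp add: power_int_minus field_simps)
  with \<open>generic z\<close> show False unfolding generic_def by blast
qed

lemma generic_numer: "generic z \<Longrightarrow> z - q ^ n \<noteq> 0"
  unfolding generic_def by (metis power_int_of_nat right_minus_eq)

lemma generic_inverse: "generic z \<Longrightarrow> generic (1 / z)"
proof -
  assume z: "generic z"
  have "1 / z \<noteq> q powi n" for n
  proof
    assume "1 / z = q powi n"
    then have "z = q powi (- n)" using generic_nonzero[OF z] q_nonzero by (simp add: power_int_minus divide_simps mult.commute)
    with z show False unfolding generic_def by blast
  qed
  then show ?thesis using z by (simp add: generic_def)
qed

lemma generic_shift: "generic z \<Longrightarrow> generic (q powi k * z)"
proof -
  assume z: "generic z"
  have "q powi k * z \<noteq> q powi n" for n
  proof
    assume "q powi k * z = q powi n"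
    then have "z = q powi (n - k)" using q_nonzero by (simp add: power_int_diff field_simps)
    with z show False unfolding generic_def by blast
  qed
  then show ?thesis using z q_nonzero by (simp add: generic_def)
qed

definition bcoef :: "nat \<Rightarrow> nat \<Rightarrow> nat \<Rightarrow> complex \<Rightarrow> complex" where
  "bcoef a b l z = (- q) ^ min (b + l - a) l *
    ((1 - q ^ nat \<bar>int a - int b\<bar> * z) / (1 - q ^ (b + 2 * l - a) * z))"

text \<open>The operator \<open>A\<^sub>a\<^sub>-\<^sub>b(z)\<close> for two strands with \<open>a\<close> and \<open>b\<close> particles.  Summation over the exponent \<open>l\<close> of \<open>F\<close> treats
  both signs of \<open>a - b\<close> alike; the index of the series is \<open>l - (a - b)\<close> with truncated difference, which is the
  minimum of the two exponents.  Higher powers of \<open>F\<close> vanish, as only \<open>a\<close> particles can be moved.\<close>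

definition braid :: "(('b \<Rightarrow>\<^sub>0 complex) \<Rightarrow> ('b \<Rightarrow>\<^sub>0 complex)) \<Rightarrow> (('b \<Rightarrow>\<^sub>0 complex) \<Rightarrow> ('b \<Rightarrow>\<^sub>0 complex)) \<Rightarrow>
    nat \<Rightarrow> nat \<Rightarrow> complex \<Rightarrow> ('b \<Rightarrow>\<^sub>0 complex) \<Rightarrow> ('b \<Rightarrow>\<^sub>0 complex)" where
  "braid E F a b z v = (\<Sum>l = a - b..a. bcoef a b l z \<cdot> divpow q E (b + l - a) (divpow q F l v))"

lemma clin_braid: "clin E \<Longrightarrow> clin F \<Longrightarrow> clin (braid E F a b z)"
  unfolding braid_def[abs_def]
  by (intro clin_sum clin_scaled linear_comp'[OF clin_divpow clin_divpow])

lemma sum_from_diff: "(\<Sum>l = a - b..a. g l) = (\<Sum>j\<le>min a b. g (a - b + j))"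
  for a b :: nat and g :: "nat \<Rightarrow> 'c :: comm_monoid_add"
  by (rule sum.reindex_bij_witness[of _ "\<lambda>j. a - b + j" "\<lambda>l. l - (a - b)"]) auto

definition eigenvalue :: "nat \<Rightarrow> nat \<Rightarrow> complex \<Rightarrow> complex" where
  "eigenvalue n m z = (\<Prod>t=1..n. (z - q ^ (2 * t + m)) / (1 - q ^ (2 * t + m) * z))"

lemma eigenvalue_inverse:
  assumes "generic z"
  shows "eigenvalue n m (1 / z) * eigenvalue n m z = 1"
proof -
  have "(1 / z - q ^ k) / (1 - q ^ k * (1 / z)) * ((z - q ^ k) / (1 - q ^ k * z)) = 1" for k
  proof -
    have "1 - q ^ k * (1 / z) = (z - q ^ k) / z" "1 / z - q ^ k = (1 - q ^ k * z) / z"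
      using generic_nonzero[OF assms] by (simp_all add: field_simps)
    then show ?thesis
      using generic_nonzero[OF assms] generic_numer[OF assms, of k] generic_denom[OF assms, of k] by simp
  qed
  then show ?thesis by (simp add: eigenvalue_def flip: prod.distrib)
qed

end

context sl2 begin

text \<open>Every summand takes \<open>f s\<close> to a multiple of \<open>f (h - s)\<close> with coefficient \<^const>\<open>eigcoef\<close>, and \<open>eigcoef_sum\<close> adds
  them up.\<close>

lemma braid_string:
  assumes str: "string h f" and "s \<le> h" "h \<le> a + b" and wt: "int a - int b = int h - 2 * int s"
    and z: "generic z"
  shows "braid E F a b z (f s) = eigenvalue (min s (h - s)) (nat \<bar>int a - int b\<bar>) z \<cdot> f (h - s)"
proof -
  define n where "n = min s (h - s)"
  define m where "m = nat \<bar>int a - int b\<bar>"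
  have n_le: "n \<le> min a b" unfolding n_def using assms(2,3) wt by linarith
  have summand: "bcoef a b (a - b + j) z \<cdot> Ed (b + (a - b + j) - a) (Fd (a - b + j) (f s)) =
      (if j \<le> n then ((- q) ^ j * eigcoef n m j * ((1 - q ^ m * z) / (1 - q ^ (2 * j + m) * z))) \<cdot> f (h - s) else 0)" for j
  proof (cases "b \<le> a")
    case True
    then have m: "a = b + m" "h = 2 * s + m" and n: "n = s"
      using wt by (auto simp: m_def n_def)
    have co: "bcoef a b (a - b + j) z = (- q) ^ j * ((1 - q ^ m * z) / (1 - q ^ (2 * j + m) * z))"
      by (simp add: bcoef_def m algebra_simps)
    show ?thesis
    proof (cases "j \<le> n")
      case j: True
      have "Ed j (Fd (m + j) (f s)) = eigcoef n m j \<cdot> f (h - s)"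
        using j by (simp add: Fd_string[OF str] linear_scale'[OF clin_divpow[OF clin_E]] Ed_string[OF str]
            m n eigcoef_def add_ac)
      then show ?thesis using j co by (simp add: m mult_ac)
    next
      case False
      then have "Fd (m + j) (f s) = 0"
        using stringD(4)[OF str, of "s + (m + j)"] by (simp add: Fd_string[OF str] m n)
      then show ?thesis using False by (simp add: m linear_0'[OF clin_divpow[OF clin_E]])
    qed
  next
    case False
    then have m: "b = a + m" "s = n + m" "h = 2 * n + m" and n: "n = h - s" and ab: "a - b = 0"
      using wt assms(2) by (auto simp: m_def n_def)
    have co: "bcoef a b (a - b + j) z = (- q) ^ j * ((1 - q ^ m * z) / (1 - q ^ (2 * j + m) * z))"
      by (simp add: bcoef_def m algebra_simps)
    show ?thesis
    proof (cases "j \<le> n")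
      case j: True
      have "Ed (m + j) (Fd j (f s)) = eigcoef n m j \<cdot> f (h - s)"
        using j by (simp add: Fd_string[OF str] linear_scale'[OF clin_divpow[OF clin_E]] Ed_string[OF str]
            m eigcoef_def add_ac)
      then show ?thesis using j co by (simp add: m mult_ac)
    next
      case False
      then have "Fd j (f s) = 0"
        using stringD(4)[OF str, of "s + j"] by (simp add: Fd_string[OF str] m)
      then show ?thesis using False by (simp add: m linear_0'[OF clin_divpow[OF clin_E]])
    qed
  qed
  have "braid E F a b z (f s) = (\<Sum>j\<le>min a b. if j \<le> n then
      ((- q) ^ j * eigcoef n m j * ((1 - q ^ m * z) / (1 - q ^ (2 * j + m) * z))) \<cdot> f (h - s) else 0)"
    by (simp only: braid_def sum_from_diff summand)
  also have "\<dots> = (\<Sum>j\<le>n. ((- q) ^ j * eigcoef n m j * ((1 - q ^ m * z) / (1 - q ^ (2 * j + m) * z))) \<cdot> f (h - s))"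
    using n_le by (intro sum.mono_neutral_cong_right) auto
  also have "\<dots> = eigenvalue n m z \<cdot> f (h - s)"
    using eigcoef_sum[of n m z] generic_denom[OF z] by (simp add: eigenvalue_def flip: cvec.scale_sum_left)
  finally show ?thesis by (simp only: n_def m_def)
qed

lemma braid_inverse:
  assumes "v \<in> W (int a - int b)" "H = a + b" "generic z"
  shows "braid E F b a (1 / z) (braid E F a b z v) = v"
proof -
  have "braid E F b a (1 / z) (braid E F a b z v) - v = 0"
  proof (rule eq_0_on_strings[OF _ assms(1), of "\<lambda>v. braid E F b a (1 / z) (braid E F a b z v) - v"])
    show "clin (\<lambda>v. braid E F b a (1 / z) (braid E F a b z v) - v)"
      by (intro clinI) (simp_all add: linear_add'[OF clin_braid[OF clin_E clin_F]]
        linear_scale'[OF clin_braid[OF clin_E clin_F]] cvec.scale_right_diff_distrib)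
    fix h f s assume s: "string h f" "s \<le> h" "h \<le> H" "int a - int b = int h - 2 * int s"
    then have "braid E F a b z (f s) = eigenvalue (min s (h - s)) (nat \<bar>int a - int b\<bar>) z \<cdot> f (h - s)"
      using assms by (intro braid_string) auto
    moreover have "braid E F b a (1 / z) (f (h - s)) =
        eigenvalue (min (h - s) (h - (h - s))) (nat \<bar>int b - int a\<bar>) (1 / z) \<cdot> f (h - (h - s))"
      using assms s by (intro braid_string generic_inverse) auto
    moreover have "min (h - s) (h - (h - s)) = min s (h - s)" "nat \<bar>int b - int a\<bar> = nat \<bar>int a - int b\<bar>" "h - (h - s) = s"
      using s(2) by auto
    ultimately show "braid E F b a (1 / z) (braid E F a b z (f s)) - f s = 0"
      using eigenvalue_inverse[OF assms(3)]
      by (simp add: linear_scale'[OF clin_braid[OF clin_E clin_F]] mult.commute)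
  qed
  then show ?thesis by simp
qed

text \<open>On a string this is \<open>eigcoef_sum_zero\<close>.  It makes the unwanted terms in \<open>fusion\<close> cancel.\<close>

lemma alternating_sum_zero:
  assumes "v \<in> W (int a - int c)" "H = a + c"
  shows "(\<Sum>l = a - Suc c..a. (- 1) ^ l \<cdot> Ed (Suc c + l - a) (Fd l v)) = 0"
proof (rule eq_0_on_strings[OF _ assms(1)])
  show "clin (\<lambda>v. \<Sum>l = a - Suc c..a. (- 1) ^ l \<cdot> Ed (Suc c + l - a) (Fd l v))"
    by (intro clin_sum clin_scaled linear_comp'[OF clin_divpow clin_divpow] clin_E clin_F)
  fix h f s assume str: "string h f" and sh: "s \<le> h" "h \<le> H" and wt: "int a - int c = int h - 2 * int s"
  \<comment> \<open>\<open>n\<close>, \<open>m\<close> and \<open>t\<close> are the parameters in \<open>eigcoef_sum_zero\<close>, and \<open>f r\<close> spans the target weight space of the string\<close>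
  define n where "n = (if a \<le> c then h - s else Suc s)"
  define m where "m = (if a \<le> c then c - a else a - Suc c)"
  define t where "t = (if a \<le> c then 1 else n)"
  define r where "r = (if a \<le> c then s - m - 1 else s + m)"
  show "(\<Sum>l = a - Suc c..a. (- 1) ^ l \<cdot> Ed (Suc c + l - a) (Fd l (f s))) = 0"
  proof (cases "a \<le> c \<and> s \<le> m")
    case True
    then have "Ed (Suc c + l - a) (Fd l (f s)) = 0" for l
    proof (cases "s + l \<le> h")
      case h: True
      have "Ed (Suc c + l - a) (f (s + l)) = 0"
        using True h by (intro Ed_string_0[OF str]) (auto simp: m_def)
      then show ?thesis by (simp add: Fd_string[OF str] linear_scale'[OF clin_divpow[OF clin_E]])
    next
      case False
      then show ?thesis using stringD(4)[OF str, of "s + l"]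
        by (simp add: Fd_string[OF str] linear_0'[OF clin_divpow[OF clin_E]])
    qed
    then show ?thesis by simp
  next
    case False
    have n_le: "n \<le> min a (Suc c)" and t: "1 \<le> t" "t \<le> n"
      using False sh wt assms(2) by (auto simp: n_def t_def m_def split: if_splits)
    have summand: "(- 1) ^ (a - Suc c + j) \<cdot> Ed (Suc c + (a - Suc c + j) - a) (Fd (a - Suc c + j) (f s)) =
        (if j \<le> n then ((- 1) ^ (a - Suc c) * qint q (Suc s) * ((- 1) ^ j * eigcoef n m j / qint q (j + m + t))) \<cdot> f r else 0)" for j
    proof (cases "a \<le> c")
      case ac: True
      then have m: "c = a + m" "s = n + m" "h = 2 * n + m" "t = 1" "n \<ge> 1" "r = n - 1"
        using wt sh False by (auto simp: m_def n_def t_def r_def)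
      show ?thesis
      proof (cases "j \<le> n")
        case j: True
        have "Ed (Suc m + j) (Fd j (f s)) = (qint q (Suc s) * eigcoef n m j / qint q (j + m + 1)) \<cdot> f r"
          using j m(5) by (simp add: Fd_string[OF str] linear_scale'[OF clin_divpow[OF clin_E]] Ed_string[OF str]
              m eigcoef_def qfact_Suc add_ac mult_ac qint_eq_0_iff)
        then show ?thesis using j by (simp add: m mult_ac)
      next
        case False
        then have "Fd j (f s) = 0"
          using stringD(4)[OF str, of "s + j"] by (simp add: Fd_string[OF str] m)
        then show ?thesis using False by (simp add: m linear_0'[OF clin_divpow[OF clin_E]])
      qed
    next
      case ac: False
      then have m: "a = Suc c + m" "n = Suc s" "h = 2 * s + m + 1" "t = n" "r = s + m"
        using wt sh False by (auto simp: m_def n_def t_def r_def)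
      show ?thesis
      proof (cases "j \<le> n")
        case j: True
        have "Ed j (Fd (m + j) (f s)) = (qint q (Suc s) * eigcoef n m j / qint q (j + m + n)) \<cdot> f r"
          using j by (simp add: Fd_string[OF str] linear_scale'[OF clin_divpow[OF clin_E]] Ed_string[OF str]
              m eigcoef_def qfact_Suc add_ac mult_ac qint_eq_0_iff)
        then show ?thesis using j by (simp add: m mult_ac power_add)
      next
        case False
        then have "Fd (m + j) (f s) = 0"
          using stringD(4)[OF str, of "s + (m + j)"] by (simp add: Fd_string[OF str] m)
        then show ?thesis using False by (simp add: m linear_0'[OF clin_divpow[OF clin_E]])
      qed
    qed
    have "(\<Sum>l = a - Suc c..a. (- 1) ^ l \<cdot> Ed (Suc c + l - a) (Fd l (f s))) = (\<Sum>j\<le>min a (Suc c). if j \<le> n then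
        ((- 1) ^ (a - Suc c) * qint q (Suc s) * ((- 1) ^ j * eigcoef n m j / qint q (j + m + t))) \<cdot> f r else 0)"
      by (simp only: sum_from_diff summand)
    also have "\<dots> = (\<Sum>j\<le>n. ((- 1) ^ (a - Suc c) * qint q (Suc s) * ((- 1) ^ j * eigcoef n m j / qint q (j + m + t))) \<cdot> f r)"
      using n_le by (intro sum.mono_neutral_cong_right) auto
    also have "\<dots> = 0"
      unfolding cvec.scale_sum_left[symmetric] sum_distrib_left[symmetric] by (simp add: eigcoef_sum_zero[OF t])
    finally show ?thesis .
  qed
qed

lemma F_Ed: "v \<in> W k \<Longrightarrow> F (Ed (Suc n) v) = Ed (Suc n) (F v) - qnum q (k + int n) \<cdot> Ed n v"
proof -
  interpret swap: sl2 q F E "\<lambda>k. W (- k)" H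
  proof
    fix v k assume v: "v \<in> W (- k)"
    then show "E v \<in> W (- (k - 2))" "F v \<in> W (- (k + 2))"
      using E_W[OF v] F_W[OF v] by (simp_all add: algebra_simps)
    show "F (E v) = E (F v) + qnum q k \<cdot> v"
      using EF[OF v] by (simp add: cscale_uminus)
    show "v \<noteq> 0 \<Longrightarrow> \<bar>k\<bar> \<le> int H" using W_bound[OF v] by simp
  qed (simp_all add: clin_E clin_F subspace_W E_simps F_simps)
  assume "v \<in> W k"
  moreover have "qnum q (- k - int n) = - qnum q (k + int n)"
    unfolding qnum_minus[symmetric] by (rule arg_cong[where f = "qnum q"]) simp
  ultimately show ?thesis
    using swap.E_Fd[of v "- k" n] by (simp add: cscale_uminus)
qed

lemma Ed_Fd_singular:
  assumes "v \<in> W (int k)" "E v = 0"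
  shows "Ed k (Fd k v) = v"
proof (cases "v = 0")
  case True
  then show ?thesis by (simp add: linear_0'[OF clin_divpow] clin_E clin_F)
next
  case False
  show ?thesis
    using Ed_string[OF string_of_singular(1)[OF assms False], of k k] by simp
qed

end

section \<open>Particles on strands\<close>

context generic_q begin

lemma qint_two_step: "(q + inverse q) * qint q (Suc n) = qint q (Suc (Suc n)) + qint q n"
proof -
  have "qnum q (1 - (- 1)) = q + inverse q" using qnum_two by simp
  moreover have "qnum q (1 - - int n) = qint q (Suc n)" "qnum q (1 - - 1 - - int n) = qint q (Suc (Suc n))"
    "qnum q (- 1) = - 1" "qnum q (- int n) = - qint q n"
    unfolding qnum_minus by (simp_all flip: qnum_of_nat add: add.commute)
  ultimately show ?thesis
    using qnum_exchange[of "- 1" "- int n" 1] by (simp add: add.commute)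
qed

end

text \<open>The operator \<open>E i\<close> moves a particle from strand \<open>i + 1\<close> to strand \<open>i\<close>, the operator \<open>F i\<close> moves one back, and \<open>G i n\<close>
  consists of the vectors with \<open>n\<close> particles on strand \<open>i\<close>.  The relations are those of quantum \<open>gl\<close>.\<close>

locale strands = generic_q q for q +
  fixes E F :: "nat \<Rightarrow> ('b \<Rightarrow>\<^sub>0 complex) \<Rightarrow> ('b \<Rightarrow>\<^sub>0 complex)"
    and G :: "nat \<Rightarrow> nat \<Rightarrow> ('b \<Rightarrow>\<^sub>0 complex) set"
  assumes clin_E: "clin (E i)" and clin_F: "clin (F i)"
    and subspace_G: "cvec.subspace (G i n)"
    and E_up: "v \<in> G i n \<Longrightarrow> E i v \<in> G i (Suc n)"
    and E_down: "v \<in> G (Suc i) (Suc n) \<Longrightarrow> E i v \<in> G (Suc i) n"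
    and E_empty: "v \<in> G (Suc i) 0 \<Longrightarrow> E i v = 0"
    and E_far: "v \<in> G j n \<Longrightarrow> j \<noteq> i \<Longrightarrow> j \<noteq> Suc i \<Longrightarrow> E i v \<in> G j n"
    and F_up: "v \<in> G (Suc i) n \<Longrightarrow> F i v \<in> G (Suc i) (Suc n)"
    and F_down: "v \<in> G i (Suc n) \<Longrightarrow> F i v \<in> G i n"
    and F_empty: "v \<in> G i 0 \<Longrightarrow> F i v = 0"
    and F_far: "v \<in> G j n \<Longrightarrow> j \<noteq> i \<Longrightarrow> j \<noteq> Suc i \<Longrightarrow> F i v \<in> G j n"
    and EF: "v \<in> G i a \<Longrightarrow> v \<in> G (Suc i) b \<Longrightarrow> E i (F i v) = F i (E i v) + qnum q (int a - int b) \<cdot> v"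
    and EF_commute: "i \<noteq> j \<Longrightarrow> E i (F j v) = F j (E i v)"
    and EE_commute: "Suc i < j \<Longrightarrow> E i (E j v) = E j (E i v)"
    and FF_commute: "Suc i < j \<Longrightarrow> F i (F j v) = F j (F i v)"
    and serre: "j = Suc i \<or> i = Suc j \<Longrightarrow>
      E i (E i (E j v)) + E j (E i (E i v)) = (q + inverse q) \<cdot> E i (E j (E i v))"
begin

lemmas E_simps = linear_add'[OF clin_E] linear_scale'[OF clin_E] linear_0'[OF clin_E]
lemmas F_simps = linear_add'[OF clin_F] linear_scale'[OF clin_F] linear_0'[OF clin_F]

abbreviation "Ed i \<equiv> divpow q (E i)"
abbreviation "Fd i \<equiv> divpow q (F i)"
abbreviation "A i \<equiv> braid (E i) (F i)"

lemmas clin_Ed = clin_divpow[OF clin_E] and clin_Fd = clin_divpow[OF clin_F]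
lemmas clin_A = clin_braid[OF clin_E clin_F]
lemmas Ed_simps = linear_add'[OF clin_Ed] linear_scale'[OF clin_Ed] linear_0'[OF clin_Ed]
lemmas Fd_simps = linear_add'[OF clin_Fd] linear_scale'[OF clin_Fd] linear_0'[OF clin_Fd]
lemmas A_simps = linear_add'[OF clin_A] linear_scale'[OF clin_A] linear_0'[OF clin_A]
lemmas E_Ed = divpow_Suc[OF clin_E] and F_Fd = divpow_Suc[OF clin_F]

lemma zero_G: "0 \<in> G i n"
  by (rule cvec.subspace_0[OF subspace_G])

lemma E_G: "v \<in> G (Suc i) n \<Longrightarrow> E i v \<in> G (Suc i) (n - 1)"
  by (cases n) (simp_all add: E_down E_empty zero_G)

lemma F_G: "v \<in> G i n \<Longrightarrow> F i v \<in> G i (n - 1)"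
  by (cases n) (simp_all add: F_down F_empty zero_G)

lemma scaled_funpow_G: "(T ^^ n) v \<in> G j m \<Longrightarrow> divpow q T n v \<in> G j m"
  by (simp add: divpow_def cvec.subspace_scale[OF subspace_G])

lemma Ed_up: "v \<in> G i a \<Longrightarrow> Ed i n v \<in> G i (a + n)"
proof (rule scaled_funpow_G)
  show "v \<in> G i a \<Longrightarrow> (E i ^^ n) v \<in> G i (a + n)" by (induction n) (simp_all add: E_up)
qed

lemma Ed_down: "v \<in> G (Suc i) b \<Longrightarrow> Ed i n v \<in> G (Suc i) (b - n)"
proof (rule scaled_funpow_G, induction n)
  case (Suc n)
  then show ?case using E_G[of "(E i ^^ n) v" i "b - n"] by simp
qed simp

lemma Ed_far: "v \<in> G j n \<Longrightarrow> j \<noteq> i \<Longrightarrow> j \<noteq> Suc i \<Longrightarrow> Ed i m v \<in> G j n"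
proof (rule scaled_funpow_G)
  assume "v \<in> G j n" "j \<noteq> i" "j \<noteq> Suc i"
  then show "(E i ^^ m) v \<in> G j n" by (induction m) (simp_all add: E_far)
qed

lemma Fd_up: "v \<in> G (Suc i) a \<Longrightarrow> Fd i n v \<in> G (Suc i) (a + n)"
proof (rule scaled_funpow_G)
  show "v \<in> G (Suc i) a \<Longrightarrow> (F i ^^ n) v \<in> G (Suc i) (a + n)" by (induction n) (simp_all add: F_up)
qed

lemma Fd_down: "v \<in> G i b \<Longrightarrow> Fd i n v \<in> G i (b - n)"
proof (rule scaled_funpow_G, induction n)
  case (Suc n)
  then show ?case using F_G[of "(F i ^^ n) v" i "b - n"] by simp
qed simp

lemma Fd_far: "v \<in> G j n \<Longrightarrow> j \<noteq> i \<Longrightarrow> j \<noteq> Suc i \<Longrightarrow> Fd i m v \<in> G j n"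
proof (rule scaled_funpow_G)
  assume "v \<in> G j n" "j \<noteq> i" "j \<noteq> Suc i"
  then show "(F i ^^ m) v \<in> G j n" by (induction m) (simp_all add: F_far)
qed

lemma Ed_vanish:
  assumes "v \<in> G (Suc i) b" "b < n"
  shows "Ed i n v = 0"
proof -
  have "E i (Ed i b v) = 0" by (rule E_empty) (use Ed_down[OF assms(1), of b] in simp)
  then have "Ed i (Suc b) v = 0" by (simp add: E_Ed qint_eq_0_iff)
  then show ?thesis using assms(2) divpow_eq_0_mono[OF clin_E] by (metis Suc_leI)
qed

lemma Fd_vanish:
  assumes "v \<in> G i b" "b < n"
  shows "Fd i n v = 0"
proof -
  have "F i (Fd i b v) = 0" by (rule F_empty) (use Fd_down[OF assms(1), of b] in simp)
  then have "Fd i (Suc b) v = 0" by (simp add: F_Fd qint_eq_0_iff)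
  then show ?thesis using assms(2) divpow_eq_0_mono[OF clin_F] by (metis Suc_leI)
qed

lemma A_G:
  assumes "v \<in> G i a" "v \<in> G (Suc i) b"
  shows "A i a b z v \<in> G i b" "A i a b z v \<in> G (Suc i) a"
proof -
  have 1: "Ed i (b + l - a) (Fd i l v) \<in> G i b" "Ed i (b + l - a) (Fd i l v) \<in> G (Suc i) a"
    if "l \<in> {a - b..a}" for l
    using that Ed_up[OF Fd_down[OF assms(1), of l], of "b + l - a"]
      Ed_down[OF Fd_up[OF assms(2), of l], of "b + l - a"] by auto
  show "A i a b z v \<in> G i b" "A i a b z v \<in> G (Suc i) a"
    unfolding braid_def
    by (intro cvec.subspace_sum[OF subspace_G] cvec.subspace_scale[OF subspace_G] 1; assumption)+
qed

lemma A_far: "v \<in> G j n \<Longrightarrow> j \<noteq> i \<Longrightarrow> j \<noteq> Suc i \<Longrightarrow> A i a b z v \<in> G j n"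
  unfolding braid_def
  by (intro cvec.subspace_sum[OF subspace_G] cvec.subspace_scale[OF subspace_G] Ed_far Fd_far)

lemma map_A:
  assumes "clin S" "\<And>x. S (E i x) = E j (S x)" "\<And>x. S (F i x) = F j (S x)"
  shows "S (A i a b z v) = A j a b z (S v)"
  by (simp add: braid_def linear_sum'[OF assms(1)] linear_scale'[OF assms(1)]
      divpow_commute[OF assms(1), of "E i" "E j"] divpow_commute[OF assms(1), of "F i" "F j"] assms(2,3))

lemma EdF_commute: "i \<noteq> j \<Longrightarrow> Ed i n (F j v) = F j (Ed i n v)"
  by (rule divpow_commute[OF clin_F, symmetric]) (simp add: EF_commute)

lemma EFd_commute: "i \<noteq> j \<Longrightarrow> E i (Fd j n v) = Fd j n (E i v)"
  by (rule divpow_commute[OF clin_E]) (simp add: EF_commute)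

lemma EdFd_commute: "i \<noteq> j \<Longrightarrow> Ed i m (Fd j n v) = Fd j n (Ed i m v)"
  by (rule divpow_commute[OF clin_Fd, symmetric]) (simp add: EFd_commute)

lemma E_A_commute: "Suc i < j \<Longrightarrow> E i (A j a b z v) = A j a b z (E i v)"
  by (rule map_A[OF clin_E]) (auto intro: EE_commute EF_commute)

lemma E_A_commute': "Suc i < j \<Longrightarrow> E j (A i a b z v) = A i a b z (E j v)"
  by (rule map_A[OF clin_E]) (auto intro: EE_commute[symmetric] EF_commute)

lemma F_A_commute': "Suc i < j \<Longrightarrow> F j (A i a b z v) = A i a b z (F j v)"
  by (rule map_A[OF clin_F]) (auto intro: FF_commute[symmetric] EF_commute[symmetric])

lemma Fd_A_commute: "Suc i < j \<Longrightarrow> Fd j n (A i a b z v) = A i a b z (Fd j n v)"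
  by (rule divpow_commute[OF clin_A, symmetric]) (simp add: F_A_commute')

lemma A_A_commute: "Suc i < j \<Longrightarrow> A i a b z (A j a' b' z' v) = A j a' b' z' (A i a b z v)"
  by (rule map_A[OF clin_A]) (auto intro: E_A_commute'[symmetric] F_A_commute'[symmetric])

section \<open>The action on two adjacent strands\<close>

text \<open>Zero is included separately, since for some \<open>k\<close> there are no \<open>a\<close> and \<open>b\<close>.\<close>

definition W :: "nat \<Rightarrow> nat \<Rightarrow> int \<Rightarrow> ('b \<Rightarrow>\<^sub>0 complex) set" where
  "W i N k = {v. v = 0 \<or> (\<exists>a b. a + b = N \<and> int a - int b = k \<and> v \<in> G i a \<and> v \<in> G (Suc i) b)}"

lemma W_I: "v \<in> G i a \<Longrightarrow> v \<in> G (Suc i) b \<Longrightarrow> v \<in> W i (a + b) (int a - int b)"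
  by (auto simp: W_def)

lemma sl2_strands: "sl2 q (E i) (F i) (W i N) N"
proof
  fix k v
  show "cvec.subspace (W i N k)"
    unfolding cvec.subspace_def
  proof (intro conjI ballI allI)
    fix x y c assume x: "x \<in> W i N k"
    show "c \<cdot> x \<in> W i N k"
      using x by (auto simp: W_def intro: cvec.subspace_scale[OF subspace_G])
    assume y: "y \<in> W i N k"
    show "x + y \<in> W i N k"
    proof (cases "x = 0 \<or> y = 0")
      case False
      then obtain a b a' b' where "a + b = N" "int a - int b = k" "x \<in> G i a" "x \<in> G (Suc i) b"
        "a' + b' = N" "int a' - int b' = k" "y \<in> G i a'" "y \<in> G (Suc i) b'"
        using x y unfolding W_def by blast
      moreover from this have "a' = a" "b' = b" by linarith+
      ultimately show ?thesis
        unfolding W_def by (blast intro: cvec.subspace_add[OF subspace_G])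
    qed (use x y in auto)
  qed (simp add: W_def)
  assume v: "v \<in> W i N k"
  show "v \<noteq> 0 \<Longrightarrow> \<bar>k\<bar> \<le> int N" using v by (auto simp: W_def)
  show "E i v \<in> W i N (k + 2)"
  proof (cases "v = 0")
    case False
    then obtain a b where ab: "a + b = N" "int a - int b = k" "v \<in> G i a" "v \<in> G (Suc i) b"
      using v by (auto simp: W_def)
    show ?thesis
    proof (cases b)
      case 0
      then show ?thesis using ab E_empty by (simp add: W_def)
    next
      case (Suc b')
      then have "E i v \<in> G i (Suc a)" "E i v \<in> G (Suc i) b'"
        using ab E_up E_down by simp_all
      then show ?thesis
        unfolding W_def using ab Suc by (intro CollectI disjI2 exI[of _ "Suc a"] exI[of _ b']) simp
    qed
  qed (simp add: W_def E_simps)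
  show "F i v \<in> W i N (k - 2)"
  proof (cases "v = 0")
    case False
    then obtain a b where ab: "a + b = N" "int a - int b = k" "v \<in> G i a" "v \<in> G (Suc i) b"
      using v by (auto simp: W_def)
    show ?thesis
    proof (cases a)
      case 0
      then show ?thesis using ab F_empty by (simp add: W_def)
    next
      case (Suc a')
      then have "F i v \<in> G i a'" "F i v \<in> G (Suc i) (Suc b)"
        using ab F_up F_down by simp_all
      then show ?thesis
        unfolding W_def using ab Suc by (intro CollectI disjI2 exI[of _ a'] exI[of _ "Suc b"]) simp
    qed
  qed (simp add: W_def F_simps)
  show "E i (F i v) = F i (E i v) + qnum q k \<cdot> v"
    using v EF by (auto simp: W_def E_simps F_simps)
qed (simp_all add: clin_E clin_F E_simps F_simps)

lemma E_Fd: "v \<in> G i a \<Longrightarrow> v \<in> G (Suc i) b \<Longrightarrow>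
    E i (Fd i (Suc n) v) = Fd i (Suc n) (E i v) + qnum q (int a - int b - int n) \<cdot> Fd i n v"
  by (rule sl2.E_Fd[OF sl2_strands W_I])

lemma F_Ed: "v \<in> G i a \<Longrightarrow> v \<in> G (Suc i) b \<Longrightarrow>
    F i (Ed i (Suc n) v) = Ed i (Suc n) (F i v) - qnum q (int a - int b + int n) \<cdot> Ed i n v"
  by (rule sl2.F_Ed[OF sl2_strands W_I])

lemma A_inverse: "v \<in> G i a \<Longrightarrow> v \<in> G (Suc i) b \<Longrightarrow> generic z \<Longrightarrow> A i b a (1 / z) (A i a b z v) = v"
  by (rule sl2.braid_inverse[OF sl2_strands W_I _ ]) simp_all

lemma Ed_Fd_inverse: "v \<in> G i k \<Longrightarrow> v \<in> G (Suc i) 0 \<Longrightarrow> Ed i k (Fd i k v) = v"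
  using sl2.Ed_Fd_singular[OF sl2_strands, of v i "k + 0" k] W_I[of v i k 0] by (simp add: E_empty)

section \<open>Divided powers of the Serre relation\<close>

text \<open>For \<open>n = 1\<close> this is the Serre relation, and in general it follows by induction with the recursion \<open>qint_two_step\<close>
  of the coefficients.\<close>

lemma serre_divided:
  assumes "j = Suc i \<or> i = Suc j"
  shows "E i (E j (Ed i n v)) = Ed i (Suc n) (E j v) + qint q n \<cdot> E j (Ed i (Suc n) v)"
proof (induction n)
  case 0
  then show ?case by (simp add: divpow_Suc_0)
next
  case (Suc n)
  define P where "P = Ed i (Suc (Suc n)) (E j v)"
  define Q where "Q = E j (Ed i (Suc (Suc n)) v)"
  define X where "X = E i (E j (Ed i (Suc n) v))"
  have "qint q (Suc (Suc n)) \<cdot> P + qint q n \<cdot> X + (qint q (Suc n) * qint q (Suc (Suc n))) \<cdot> Q =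
      ((q + inverse q) * qint q (Suc n)) \<cdot> X"
    using serre[OF assms, of "Ed i n v"] by (simp add: Suc E_simps E_Ed P_def Q_def X_def)
  then have "qint q (Suc (Suc n)) \<cdot> X = qint q (Suc (Suc n)) \<cdot> (P + qint q (Suc n) \<cdot> Q)"
    unfolding qint_two_step by (simp add: cvec.scale_left_distrib cvec.scale_right_distrib mult.commute add_ac)
  then have "X = P + qint q (Suc n) \<cdot> Q" by (rule cscale_cancel) (simp add: qint_eq_0_iff)
  then show ?case by (simp only: P_def Q_def X_def)
qed

text \<open>The mirror image, with the divided power on the left.\<close>

lemma serre_divided':
  assumes "j = Suc i \<or> i = Suc j"
  shows "Ed j n (E i (E j v)) = E i (Ed j (Suc n) v) + qint q n \<cdot> Ed j (Suc n) (E i v)"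
proof (induction n arbitrary: v)
  case 0
  then show ?case by (simp add: divpow_Suc_0)
next
  case (Suc n)
  have map: "Ed j n (E j x) = qint q (Suc n) \<cdot> Ed j (Suc n) x" for n x
    by (simp add: divpow_map[OF clin_E] E_Ed)
  define P where "P = E i (Ed j (Suc (Suc n)) v)"
  define Q where "Q = Ed j (Suc (Suc n)) (E i v)"
  define X where "X = Ed j (Suc n) (E i (E j v))"
  have "E j (E j (E i v)) + E i (E j (E j v)) = (q + inverse q) \<cdot> E j (E i (E j v))"
    using assms by (intro serre) blast
  then have "Ed j n (E j (E j (E i v)) + E i (E j (E j v))) = (q + inverse q) \<cdot> Ed j n (E j (E i (E j v)))"
    by (simp only: Ed_simps)
  then have "qint q (Suc (Suc n)) \<cdot> P + qint q n \<cdot> X + (qint q (Suc n) * qint q (Suc (Suc n))) \<cdot> Q =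
      ((q + inverse q) * qint q (Suc n)) \<cdot> X"
    by (simp add: Suc.IH Ed_simps E_simps map P_def Q_def X_def add_ac)
  then have "qint q (Suc (Suc n)) \<cdot> X = qint q (Suc (Suc n)) \<cdot> (P + qint q (Suc n) \<cdot> Q)"
    unfolding qint_two_step by (simp add: cvec.scale_left_distrib cvec.scale_right_distrib mult.commute add_ac)
  then have "X = P + qint q (Suc n) \<cdot> Q" by (rule cscale_cancel) (simp add: qint_eq_0_iff)
  then show ?case by (simp only: P_def Q_def X_def)
qed

end

section \<open>Fusion\<close>

context strands begin

lemma A_one:
  assumes "1 \<le> a" "generic z"
  shows "A i a 1 z y = Fd i (a - 1) y + bcoef a 1 a z \<cdot> E i (Fd i a y)"
proof -
  obtain n where n: "a = Suc n" using assms(1) by (cases a) auto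
  have "bcoef a 1 n z = 1"
    using generic_denom[OF assms(2), of n] by (simp add: bcoef_def n)
  moreover have "{a - 1..a} = {n, a}" "n \<noteq> a" by (auto simp: n)
  ultimately show ?thesis by (simp add: braid_def divpow_Suc_0 n)
qed

lemma bcoef_one:
  "1 \<le> a \<Longrightarrow> bcoef a 1 a z = - q * ((1 - q ^ (a - 1) * z) / (1 - q ^ (a + 1) * z))"
  by (simp add: bcoef_def nat_diff_distrib')

text \<open>The two terms of \<open>A (Suc i) a 1\<close> (see \<open>A_one\<close>) applied to one term of \<open>A i a c\<close>: the operator \<open>E i\<close> raises the divided
  power of \<open>E i\<close>, directly in the first term and through the Serre relation in the second.  Here \<open>Z\<close> is a term of the
  right-hand side of \<open>fusion\<close>, and the \<open>X\<close> have to cancel.\<close>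

lemma fusion_summand:
  assumes v: "v \<in> G i a" "v \<in> G (Suc i) c" "v \<in> G (Suc (Suc i)) 1"
    and a: "1 \<le> a" and l: "l \<le> a" "a \<le> Suc c + l" and z: "generic w"
  defines "f \<equiv> Suc c + l - a"
  defines "X \<equiv> Fd (Suc i) (a - 1) (Ed i f (Fd i l v))"
    and "Z \<equiv> Fd (Suc i) a (Ed i f (Fd i l (E (Suc i) v)))"
  shows "(if f = 0 then 0 else E i (A (Suc i) a 1 w (Ed i (f - 1) (Fd i l v)))) =
    qint q f \<cdot> X + bcoef a 1 a w \<cdot> (Z + qnum q (int f - 1) \<cdot> X)"
proof -
  define u where "u = Fd i l v"
  have u: "u \<in> G (Suc i) (c + l)" "u \<in> G (Suc (Suc i)) 1"
    unfolding u_def using v by (auto intro: Fd_up Fd_far)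
  have Eu: "E (Suc i) u = Fd i l (E (Suc i) v)"
    by (simp add: u_def EFd_commute)
  have EF_u: "E (Suc i) (Fd (Suc i) a u) = Fd (Suc i) a (E (Suc i) u) + qnum q (int f - 1) \<cdot> Fd (Suc i) (a - 1) u"
  proof -
    obtain a' where a': "a = Suc a'" using a by (cases a) auto
    have eq: "int (c + l) - int 1 - int a' = int f - 1"
      using l by (simp add: f_def a' of_nat_diff)
    show ?thesis using E_Fd[OF u, of a'] unfolding eq by (simp add: a')
  qed
  show ?thesis
  proof (cases f)
    case 0
    then have "Fd (Suc i) a u = 0"
      using u l by (intro Fd_vanish[of _ _ "c + l"]) (auto simp: f_def)
    then have "Z = X"
      using EF_u 0 by (simp add: X_def Z_def E_simps eq_neg_iff_add_eq_0 add_eq_0_iff2 cscale_uminus flip: u_def Eu)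
    then show ?thesis using 0 by (simp add: cscale_uminus)
  next
    case (Suc e)
    define x where "x = Fd (Suc i) a u"
    have "c + l - a = e" using l Suc unfolding f_def by arith
    then have "x \<in> G (Suc i) e"
      using Fd_down[OF u(1), of a] by (simp add: x_def)
    then have "Ed i f x = 0"
      using Suc by (intro Ed_vanish) auto
    then have "E i (E (Suc i) (Ed i e x)) = Ed i f (E (Suc i) x)"
      using serre_divided[of "Suc i" i e x] Suc by (simp add: E_simps)
    also have "\<dots> = Z + qint q e \<cdot> X"
      using Suc by (simp add: x_def EF_u Ed_simps EdFd_commute Eu X_def Z_def flip: u_def qnum_of_nat)
    finally have T2: "E i (E (Suc i) (Fd (Suc i) a (Ed i e u))) = Z + qint q e \<cdot> X"
      by (simp add: x_def EdFd_commute)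
    have T1: "E i (Fd (Suc i) (a - 1) (Ed i e u)) = qint q f \<cdot> X"
      by (simp add: EFd_commute E_Ed Fd_simps Suc X_def flip: u_def)
    have "E i (A (Suc i) a 1 w (Ed i e u)) = qint q f \<cdot> X + bcoef a 1 a w \<cdot> (Z + qint q e \<cdot> X)"
      unfolding A_one[OF a z] by (simp only: E_simps T1 T2)
    then show ?thesis
      using Suc by (simp add: u_def qnum_of_nat)
  qed
qed

text \<open>The coefficient of the unwanted \<open>X\<close> depends on \<open>l\<close> only through the sign \<open>(- 1)\<^sup>l\<close>, so that \<open>alternating_sum_zero\<close>
  applies to their sum.\<close>

lemma bcoef_fusion_sum:
  assumes "1 \<le> a" "l \<le> a" "a \<le> Suc c + l" and z: "generic z"
  defines "f \<equiv> Suc c + l - a"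
  defines "w \<equiv> q powi (- int c) * z"
  shows "bcoef a (Suc c) l z * (qint q f + bcoef a 1 a w * qnum q (int f - 1)) =
    (- 1) ^ l * ((- 1) ^ (a - Suc c) * q powi (1 - int (Suc c - a)) * (1 - q ^ nat \<bar>int a - int (Suc c)\<bar> * z) / (1 - q ^ (a + 1) * w))"
proof -
  have w: "generic w" unfolding w_def by (rule generic_shift[OF z])
  have d: "1 - q ^ (a + 1) * w \<noteq> 0" by (rule generic_denom[OF w])
  have fl: "Suc c + 2 * l - a = f + l" using assms(3) by (simp add: f_def)
  have e1: "q ^ a * w * q powi int f = q powi (1 - int f) * (q ^ (f + l) * z)"
  proof -
    have "int a - int c + int f = 1 - int f + int (f + l)"
      using assms(3) by (simp add: f_def of_nat_diff)
    then have "q powi (int a - int c + int f) = q powi (1 - int f + int (f + l))" by simp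
    then show ?thesis
      using q_nonzero by (simp add: w_def power_int_add power_int_diff power_int_minus power_add field_simps)
  qed
  have "(qint q f + bcoef a 1 a w * qnum q (int f - 1)) * (1 - q ^ (a + 1) * w) =
      (qnum q (int f) - q * qnum q (int f - 1)) - q ^ a * w * (q * qnum q (int f) - qnum q (int f - 1))"
    using d assms(1) unfolding bcoef_one[OF assms(1)] qnum_of_nat[symmetric]
    by (cases a) (simp_all add: field_simps)
  also have "\<dots> = q powi (1 - int f) * (1 - q ^ (f + l) * z)"
    unfolding qnum_diff qnum_diff' e1 by (simp add: right_diff_distrib)
  finally have s: "qint q f + bcoef a 1 a w * qnum q (int f - 1) =
      q powi (1 - int f) * (1 - q ^ (f + l) * z) / (1 - q ^ (a + 1) * w)"
    using d by (simp add: field_simps)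
  have b: "bcoef a (Suc c) l z = (- q) ^ min f l * ((1 - q ^ nat \<bar>int a - int (Suc c)\<bar> * z) / (1 - q ^ (f + l) * z))"
    by (simp only: bcoef_def fl) (simp add: f_def)
  have p: "(- q) ^ min f l * q powi (1 - int f) = (- 1) ^ l * ((- 1) ^ (a - Suc c) * q powi (1 - int (Suc c - a)))"
  proof (cases "a \<le> Suc c")
    case True
    then have m: "min f l = l" "a - Suc c = 0" and e: "1 - int (Suc c - a) = (1 - int f) + int l"
      using assms(3) by (auto simp: f_def of_nat_diff)
    have "q powi (1 - int (Suc c - a)) = q powi (1 - int f) * q ^ l"
      unfolding e using q_nonzero by (simp add: power_int_add)
    then show ?thesis
      unfolding m by (simp add: power_minus[of q])
  next
    case False
    then have "min f l = f" "l = f + (a - Suc c)" "Suc c - a = 0"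
      using assms(3) by (auto simp: f_def)
    moreover have "(- 1 :: complex) ^ (f + (a - Suc c)) * (- 1) ^ (a - Suc c) = (- 1) ^ f"
      by (simp add: power_add flip: power_mult_distrib mult.assoc)
    ultimately show ?thesis
      using q_nonzero by (simp add: power_minus[of q] power_int_diff field_simps)
  qed
  have "bcoef a (Suc c) l z * (qint q f + bcoef a 1 a w * qnum q (int f - 1)) =
      ((- q) ^ min f l * q powi (1 - int f)) * (1 - q ^ nat \<bar>int a - int (Suc c)\<bar> * z) / (1 - q ^ (a + 1) * w)"
    unfolding s b using generic_denom[OF z, of "f + l"] by simp
  then show ?thesis unfolding p by (simp add: mult_ac)
qed

text \<open>The quotient of the coefficients for \<open>c + 1\<close> and for \<open>c\<close> particles, which does not depend on the summation index
  (\<open>bcoef_fusion_ratio\<close>).\<close>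

definition fusion_ratio :: "nat \<Rightarrow> nat \<Rightarrow> complex \<Rightarrow> complex" where
  "fusion_ratio a c z = (if a \<le> c then 1
     else - q * ((1 - q ^ (a - Suc c) * z) / (1 - q ^ (a - c + 1) * z)))"

lemma fusion_ratio_nonzero: "generic z \<Longrightarrow> fusion_ratio a c z \<noteq> 0"
  using q_nonzero generic_denom[of z "a - Suc c"] generic_denom[of z "a - c + 1"] by (simp add: fusion_ratio_def)

lemma bcoef_fusion_ratio:
  assumes "l \<le> a" "a \<le> c + l" "generic z"
  shows "bcoef a (Suc c) l z = fusion_ratio a c z * bcoef a c l (q * z)"
proof -
  have e: "Suc c + 2 * l - a = Suc (c + 2 * l - a)" using assms(2) by simp
  show ?thesis
  proof (cases "a \<le> c")
    case True
    then have "nat \<bar>int a - int (Suc c)\<bar> = Suc (nat \<bar>int a - int c\<bar>)" "min (Suc c + l - a) l = min (c + l - a) l"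
      by auto
    then show ?thesis
      unfolding bcoef_def fusion_ratio_def e using True by (simp add: mult_ac)
  next
    case False
    then have m: "nat \<bar>int a - int (Suc c)\<bar> = a - Suc c" "nat \<bar>int a - int c\<bar> = a - c"
      "min (Suc c + l - a) l = Suc (min (c + l - a) l)"
      using assms(1,2) by auto
    have "1 - q ^ (a - c + 1) * z \<noteq> 0" by (rule generic_denom[OF assms(3)])
    then show ?thesis
      unfolding bcoef_def fusion_ratio_def e m using False by (simp add: mult_ac)
  qed
qed

definition fusion_const :: "nat \<Rightarrow> nat \<Rightarrow> complex \<Rightarrow> complex" where
  "fusion_const a c z = bcoef a 1 a (q powi (- int c) * z) / fusion_ratio a c z"

lemma fusion_const_nonzero:
  assumes "1 \<le> a" "generic z"
  shows "fusion_const a c z \<noteq> 0"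
proof -
  have d: "1 - q ^ n * (q powi (- int c) * z) \<noteq> 0" for n
    by (rule generic_denom[OF generic_shift[OF assms(2)]])
  then show ?thesis
    unfolding fusion_const_def bcoef_one[OF assms(1)]
    using q_nonzero fusion_ratio_nonzero[OF assms(2)] d[of "a - 1"] d[of "a + 1"] by simp
qed

text \<open>Let three strands carry \<open>a\<close>, \<open>c\<close> and \<open>1\<close> particles.  Braiding the first strand with the other two in turn and then
  merging these amounts to merging them before, by \<open>E (Suc i)\<close>, and braiding with the merged strand.  The operator
  \<open>Fd (Suc i) a\<close> only moves the \<open>a\<close> particles on to the strand that was emptied by the merger.\<close>

lemma fusion:
  assumes v: "v \<in> G i a" "v \<in> G (Suc i) c" "v \<in> G (Suc (Suc i)) 1"
    and a: "1 \<le> a" and z: "generic z"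
  shows "E i (A (Suc i) a 1 (q powi (- int c) * z) (A i a c (q * z) v)) =
    fusion_const a c z \<cdot> Fd (Suc i) a (A i a (Suc c) z (E (Suc i) v))"
proof -
  define w where "w = q powi (- int c) * z"
  define g where "g = bcoef a 1 a w"
  define k where "k = fusion_ratio a c z"
  define f where "f l = Suc c + l - a" for l
  define X where "X l = Fd (Suc i) (a - 1) (Ed i (f l) (Fd i l v))" for l
  define Z where "Z l = Fd (Suc i) a (Ed i (f l) (Fd i l (E (Suc i) v)))" for l
  define T where "T l = (if f l = 0 then 0 else E i (A (Suc i) a 1 w (Ed i (f l - 1) (Fd i l v))))" for l
  have w: "generic w" unfolding w_def by (rule generic_shift[OF z])
  have k: "k \<noteq> 0" unfolding k_def by (rule fusion_ratio_nonzero[OF z])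
  have T: "T l = qint q (f l) \<cdot> X l + g \<cdot> (Z l + qnum q (int (f l) - 1) \<cdot> X l)" if "l \<in> {a - Suc c..a}" for l
    unfolding T_def X_def Z_def f_def g_def using that by (intro fusion_summand[OF v a _ _ w]) auto
  have alt: "(\<Sum>l = a - Suc c..a. (bcoef a (Suc c) l z * (qint q (f l) + g * qnum q (int (f l) - 1))) \<cdot> X l) = 0"
  proof -
    define C where "C = (- 1) ^ (a - Suc c) * q powi (1 - int (Suc c - a)) *
      (1 - q ^ nat \<bar>int a - int (Suc c)\<bar> * z) / (1 - q ^ (a + 1) * w)"
    have "(\<Sum>l = a - Suc c..a. (bcoef a (Suc c) l z * (qint q (f l) + g * qnum q (int (f l) - 1))) \<cdot> X l) =
        (\<Sum>l = a - Suc c..a. C \<cdot> Fd (Suc i) (a - 1) ((- 1) ^ l \<cdot> Ed i (Suc c + l - a) (Fd i l v)))"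
    proof (intro sum.cong refl)
      fix l assume l: "l \<in> {a - Suc c..a}"
      have "bcoef a (Suc c) l z * (qint q (f l) + g * qnum q (int (f l) - 1)) = (- 1) ^ l * C"
        unfolding f_def g_def w_def C_def using l by (intro bcoef_fusion_sum[OF a _ _ z]) auto
      then show "(bcoef a (Suc c) l z * (qint q (f l) + g * qnum q (int (f l) - 1))) \<cdot> X l =
          C \<cdot> Fd (Suc i) (a - 1) ((- 1) ^ l \<cdot> Ed i (Suc c + l - a) (Fd i l v))"
        by (simp add: X_def f_def Fd_simps mult.commute)
    qed
    also have "\<dots> = C \<cdot> Fd (Suc i) (a - 1) (\<Sum>l = a - Suc c..a. (- 1) ^ l \<cdot> Ed i (Suc c + l - a) (Fd i l v))"
      by (simp only: linear_sum'[OF clin_Fd] cscale_sum)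
    also have "\<dots> = 0"
      using sl2.alternating_sum_zero[OF sl2_strands W_I[OF v(1,2)]] by (simp add: Fd_simps)
    finally show ?thesis .
  qed
  have "k \<cdot> E i (A (Suc i) a 1 w (A i a c (q * z) v)) =
      (\<Sum>l = a - c..a. (k * bcoef a c l (q * z)) \<cdot> E i (A (Suc i) a 1 w (Ed i (c + l - a) (Fd i l v))))"
    unfolding braid_def[of "E i" "F i"] by (simp add: linear_sum'[OF clin_A] linear_sum'[OF clin_E] A_simps E_simps cscale_sum)
  also have "\<dots> = (\<Sum>l = a - Suc c..a. bcoef a (Suc c) l z \<cdot> T l)"
  proof (rule sum.mono_neutral_cong_left)
    show "\<forall>l\<in>{a - Suc c..a} - {a - c..a}. bcoef a (Suc c) l z \<cdot> T l = 0"
      by (auto simp: T_def f_def)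
    fix l assume l: "l \<in> {a - c..a}"
    then have "f l = Suc (c + l - a)" by (auto simp: f_def)
    moreover have "k * bcoef a c l (q * z) = bcoef a (Suc c) l z"
      unfolding k_def using l by (intro bcoef_fusion_ratio[symmetric] z) auto
    ultimately show "(k * bcoef a c l (q * z)) \<cdot> E i (A (Suc i) a 1 w (Ed i (c + l - a) (Fd i l v))) = bcoef a (Suc c) l z \<cdot> T l"
      by (simp add: T_def)
  qed auto
  also have "\<dots> = (\<Sum>l = a - Suc c..a. (bcoef a (Suc c) l z * (qint q (f l) + g * qnum q (int (f l) - 1))) \<cdot> X l +
      g \<cdot> (bcoef a (Suc c) l z \<cdot> Z l))"
    by (intro sum.cong refl) (simp add: T cvec.scale_right_distrib cvec.scale_left_distrib algebra_simps)
  also have "\<dots> = g \<cdot> Fd (Suc i) a (A i a (Suc c) z (E (Suc i) v))"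
    by (simp only: sum.distrib alt) (simp add: Z_def f_def braid_def linear_sum'[OF clin_Fd] Fd_simps cscale_sum)
  finally have "k \<cdot> E i (A (Suc i) a 1 w (A i a c (q * z) v)) =
      k \<cdot> (fusion_const a c z \<cdot> Fd (Suc i) a (A i a (Suc c) z (E (Suc i) v)))"
    using k by (simp add: fusion_const_def g_def k_def w_def)
  then show ?thesis unfolding w_def[symmetric] by (rule cscale_cancel) (rule k)
qed

end

section \<open>Moving an empty strand\<close>

context strands begin

text \<open>If strand \<open>i\<close> is empty, \<open>Ed (Suc i) b\<close> after \<open>Ed i a\<close> shifts the \<open>a\<close> and \<open>b\<close> particles of the next two strands by one
  strand.  This and the following lemmas show that the shift takes the operators of the strands \<open>i + 1\<close> and \<open>i + 2\<close>
  to those of the strands \<open>i\<close> and \<open>i + 1\<close>.\<close>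

lemma transport_E:
  assumes v: "v \<in> G i 0" "v \<in> G (Suc i) a" "v \<in> G (Suc (Suc i)) (Suc b)"
  shows "Ed (Suc i) b (Ed i (Suc a) (E (Suc i) v)) = E i (Ed (Suc i) (Suc b) (Ed i a v))"
proof -
  have "Ed i (Suc a) v = 0" using v(2) by (rule Ed_vanish) simp
  then have "Ed i (Suc a) (E (Suc i) v) = E i (E (Suc i) (Ed i a v))"
    using serre_divided[of "Suc i" i a v] by (simp add: E_simps)
  moreover have "E i (Ed i a v) = 0"
    by (rule E_empty) (use Ed_down[OF v(2), of a] in simp)
  ultimately show ?thesis
    using serre_divided'[of "Suc i" i b "Ed i a v"] by (simp add: Ed_simps)
qed

lemma transport_F:
  assumes v: "v \<in> G i 0" "v \<in> G (Suc i) (Suc a)" "v \<in> G (Suc (Suc i)) b"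
  shows "Ed (Suc i) (Suc b) (Ed i a (F (Suc i) v)) = F i (Ed (Suc i) b (Ed i (Suc a) v))"
proof -
  define y where "y = Ed i a v"
  have y: "y \<in> G (Suc i) 1" "y \<in> G (Suc (Suc i)) b"
    unfolding y_def using Ed_down[OF v(2), of a] v(3) by (auto intro: Ed_far)
  have "Ed (Suc i) (Suc b) y = 0" using y(2) by (rule Ed_vanish) simp
  then have 1: "Ed (Suc i) (Suc b) (F (Suc i) y) = Ed (Suc i) b y"
    using F_Ed[OF y, of b] by (simp add: F_simps)
  have "F i v = 0" using v(1) by (rule F_empty)
  then have "F i (Ed i (Suc a) v) = y"
    using F_Ed[OF v(1,2), of a] by (simp add: Ed_simps y_def cscale_uminus)
  then have "F i (Ed (Suc i) b (Ed i (Suc a) v)) = Ed (Suc i) b y"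
    using EdF_commute[of "Suc i" i b "Ed i (Suc a) v"] by simp
  then show ?thesis
    by (simp add: EdF_commute[of i "Suc i"] 1 flip: y_def)
qed

lemma transport_Ed:
  assumes "v \<in> G i 0" "v \<in> G (Suc i) a" "v \<in> G (Suc (Suc i)) b" "n \<le> b"
  shows "Ed (Suc i) (b - n) (Ed i (a + n) (Ed (Suc i) n v)) = Ed i n (Ed (Suc i) b (Ed i a v))"
  using assms(4)
proof (induction n)
  case (Suc n)
  have u: "Ed (Suc i) n v \<in> G i 0" "Ed (Suc i) n v \<in> G (Suc i) (a + n)" "Ed (Suc i) n v \<in> G (Suc (Suc i)) (Suc (b - Suc n))"
    using Ed_far[OF assms(1)] Ed_up[OF assms(2)] Ed_down[OF assms(3), of n] Suc.prems by (auto simp: Suc_diff_Suc)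
  have "qint q (Suc n) \<cdot> Ed (Suc i) (b - Suc n) (Ed i (a + Suc n) (Ed (Suc i) (Suc n) v)) =
      Ed (Suc i) (b - Suc n) (Ed i (Suc (a + n)) (E (Suc i) (Ed (Suc i) n v)))"
    by (simp add: E_Ed Ed_simps)
  also have "\<dots> = E i (Ed (Suc i) (Suc (b - Suc n)) (Ed i (a + n) (Ed (Suc i) n v)))"
    by (rule transport_E[OF u])
  also have "\<dots> = qint q (Suc n) \<cdot> Ed i (Suc n) (Ed (Suc i) b (Ed i a v))"
    using Suc by (simp add: Suc_diff_Suc E_Ed)
  finally show ?case by (rule cscale_cancel) (simp add: qint_eq_0_iff)
qed simp

lemma transport_Fd:
  assumes "v \<in> G i 0" "v \<in> G (Suc i) a" "v \<in> G (Suc (Suc i)) b" "n \<le> a"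
  shows "Ed (Suc i) (b + n) (Ed i (a - n) (Fd (Suc i) n v)) = Fd i n (Ed (Suc i) b (Ed i a v))"
  using assms(4)
proof (induction n)
  case (Suc n)
  have u: "Fd (Suc i) n v \<in> G i 0" "Fd (Suc i) n v \<in> G (Suc i) (Suc (a - Suc n))" "Fd (Suc i) n v \<in> G (Suc (Suc i)) (b + n)"
    using Fd_far[OF assms(1)] Fd_down[OF assms(2), of n] Fd_up[OF assms(3)] Suc.prems by (auto simp: Suc_diff_Suc)
  have "qint q (Suc n) \<cdot> Ed (Suc i) (b + Suc n) (Ed i (a - Suc n) (Fd (Suc i) (Suc n) v)) =
      Ed (Suc i) (Suc (b + n)) (Ed i (a - Suc n) (F (Suc i) (Fd (Suc i) n v)))"
    by (simp add: F_Fd Ed_simps)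
  also have "\<dots> = F i (Ed (Suc i) (b + n) (Ed i (Suc (a - Suc n)) (Fd (Suc i) n v)))"
    by (rule transport_F[OF u])
  also have "\<dots> = qint q (Suc n) \<cdot> Fd i (Suc n) (Ed (Suc i) b (Ed i a v))"
    using Suc by (simp add: Suc_diff_Suc F_Fd)
  finally show ?case by (rule cscale_cancel) (simp add: qint_eq_0_iff)
qed simp

lemma transport_A:
  assumes v: "v \<in> G i 0" "v \<in> G (Suc i) a" "v \<in> G (Suc (Suc i)) b"
  shows "A i a b z (Ed (Suc i) b (Ed i a v)) = Ed (Suc i) a (Ed i b (A (Suc i) a b z v))"
proof -
  have "Ed i (b + l - a) (Fd i l (Ed (Suc i) b (Ed i a v))) =
      Ed (Suc i) a (Ed i b (Ed (Suc i) (b + l - a) (Fd (Suc i) l v)))" if l: "l \<in> {a - b..a}" for l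
  proof -
    have u: "Fd (Suc i) l v \<in> G i 0" "Fd (Suc i) l v \<in> G (Suc i) (a - l)" "Fd (Suc i) l v \<in> G (Suc (Suc i)) (b + l)"
      using Fd_far[OF v(1)] Fd_down[OF v(2)] Fd_up[OF v(3)] by auto
    have "b + l - (b + l - a) = a" "a - l + (b + l - a) = b" using l by auto
    then show ?thesis
      using transport_Ed[OF u, of "b + l - a"] transport_Fd[OF v, of l] l by simp
  qed
  then show ?thesis
    by (simp add: braid_def linear_sum'[OF clin_Ed] Ed_simps)
qed

section \<open>The Yang-Baxter equation\<close>

definition yang_baxter :: "nat \<Rightarrow> nat \<Rightarrow> nat \<Rightarrow> nat \<Rightarrow> bool" where
  "yang_baxter i a b c \<longleftrightarrow> (\<forall>x y v. generic x \<longrightarrow> generic y \<longrightarrow> generic (x * y) \<longrightarrow>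
     v \<in> G i a \<longrightarrow> v \<in> G (Suc i) b \<longrightarrow> v \<in> G (Suc (Suc i)) c \<longrightarrow>
     A i b c y (A (Suc i) a c (x * y) (A i a b x v)) = A (Suc i) a b x (A i a c (x * y) (A (Suc i) b c y v)))"

lemma yang_baxterD:
  "yang_baxter i a b c \<Longrightarrow> generic x \<Longrightarrow> generic y \<Longrightarrow> generic (x * y) \<Longrightarrow>
     v \<in> G i a \<Longrightarrow> v \<in> G (Suc i) b \<Longrightarrow> v \<in> G (Suc (Suc i)) c \<Longrightarrow>
     A i b c y (A (Suc i) a c (x * y) (A i a b x v)) = A (Suc i) a b x (A i a c (x * y) (A (Suc i) b c y v))"
  unfolding yang_baxter_def by blast

text \<open>Put \<open>v = A i b a x w\<close> in the equation for \<open>(a, b, c)\<close> and cancel the outer braiding by the inversion relation.\<close>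

lemma yang_baxter_swap12:
  assumes "yang_baxter i a b c"
  shows "yang_baxter i b a c"
  unfolding yang_baxter_def
proof (intro allI impI)
  fix x y w
  assume x: "generic x" and y: "generic y" and xy: "generic (x * y)"
    and w: "w \<in> G i b" "w \<in> G (Suc i) a" "w \<in> G (Suc (Suc i)) c"
  define v where "v = A i b a x w"
  have v: "v \<in> G i a" "v \<in> G (Suc i) b" "v \<in> G (Suc (Suc i)) c"
    unfolding v_def using A_G[OF w(1,2)] A_far[OF w(3)] by auto
  have w_eq: "A i a b (1 / x) v = w"
    unfolding v_def by (rule A_inverse[OF w(1,2) x])
  have e: "1 / x * (x * y) = y" using generic_nonzero[OF x] by simp
  define u where "u = A i a c y (A (Suc i) b c (x * y) v)"
  have u: "u \<in> G (Suc i) a" "u \<in> G (Suc (Suc i)) b"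
  proof -
    have u': "A (Suc i) b c (x * y) v \<in> G (Suc i) c" "A (Suc i) b c (x * y) v \<in> G (Suc (Suc i)) b"
      "A (Suc i) b c (x * y) v \<in> G i a"
      using A_G[OF v(2,3)] A_far[OF v(1)] by auto
    show "u \<in> G (Suc i) a" "u \<in> G (Suc (Suc i)) b"
      unfolding u_def using A_G[OF u'(3,1)] A_far[OF u'(2)] by auto
  qed
  have "A i b c (x * y) (A (Suc i) a c y w) = A (Suc i) a b (1 / x) u"
    using yang_baxterD[OF assms generic_inverse[OF x] xy _ v] y unfolding e w_eq u_def by blast
  then have "A (Suc i) b a (1 / (1 / x)) (A i b c (x * y) (A (Suc i) a c y w)) = u"
    using A_inverse[OF u generic_inverse[OF x]] by simp
  then show "A i a c y (A (Suc i) b c (x * y) (A i b a x w)) =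
      A (Suc i) b a x (A i b c (x * y) (A (Suc i) a c y w))"
    by (simp add: u_def v_def)
qed

lemma yang_baxter_swap23:
  assumes "yang_baxter i a b c"
  shows "yang_baxter i a c b"
  unfolding yang_baxter_def
proof (intro allI impI)
  fix x y w
  assume x: "generic x" and y: "generic y" and xy: "generic (x * y)"
    and w: "w \<in> G i a" "w \<in> G (Suc i) c" "w \<in> G (Suc (Suc i)) b"
  define v where "v = A (Suc i) c b y w"
  have v: "v \<in> G i a" "v \<in> G (Suc i) b" "v \<in> G (Suc (Suc i)) c"
    unfolding v_def using A_G[OF w(2,3)] A_far[OF w(1)] by auto
  have w_eq: "A (Suc i) b c (1 / y) v = w"
    unfolding v_def by (rule A_inverse[OF w(2,3) y])
  have e: "x * y * (1 / y) = x" using generic_nonzero[OF y] by simp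
  define u where "u = A (Suc i) a c x (A i a b (x * y) v)"
  have u: "u \<in> G i b" "u \<in> G (Suc i) c"
  proof -
    have u': "A i a b (x * y) v \<in> G i b" "A i a b (x * y) v \<in> G (Suc i) a"
      "A i a b (x * y) v \<in> G (Suc (Suc i)) c"
      using A_G[OF v(1,2)] A_far[OF v(3)] by auto
    show "u \<in> G i b" "u \<in> G (Suc i) c"
      unfolding u_def using A_G[OF u'(2,3)] A_far[OF u'(1)] by auto
  qed
  have "A i b c (1 / y) u = A (Suc i) a b (x * y) (A i a c x w)"
    using yang_baxterD[OF assms xy generic_inverse[OF y] _ v] x unfolding e w_eq u_def by blast
  then have "A i c b (1 / (1 / y)) (A (Suc i) a b (x * y) (A i a c x w)) = u"
    using A_inverse[OF u generic_inverse[OF y]] by metis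
  then show "A i c b y (A (Suc i) a b (x * y) (A i a c x w)) =
      A (Suc i) a c x (A i a b (x * y) (A (Suc i) c b y w))"
    by (simp add: u_def v_def)
qed

text \<open>On strands with one particle each, \<open>E j F j\<close> is a generator of the Hecke algebra; \<open>hecke_square\<close> is its quadratic
  relation.\<close>

lemma hecke_relation:
  assumes v: "v \<in> G i 1" "v \<in> G (Suc i) 1" "v \<in> G (Suc (Suc i)) 1"
  defines "U \<equiv> \<lambda>j x. E j (F j x)"
  shows "U i (U (Suc i) (U i v)) - U i v = U (Suc i) (U i (U (Suc i) v)) - U (Suc i) v"
proof -
  define w where "w = F i v"
  have w: "w \<in> G i 0" "w \<in> G (Suc i) 2" "w \<in> G (Suc (Suc i)) 1"
    unfolding w_def using F_down[of v i 0] F_up[OF v(2)] F_far[OF v(3)] v by (auto simp: numeral_2_eq_2)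
  define x where "x = F (Suc i) v"
  have x: "x \<in> G i 1" "x \<in> G (Suc i) 0" "x \<in> G (Suc (Suc i)) 2"
    unfolding x_def using F_far[OF v(1)] F_down[of v "Suc i" 0] F_up[OF v(3)] v by (auto simp: numeral_2_eq_2)
  have Fw: "F (Suc i) w \<in> G i 0" "F (Suc i) w \<in> G (Suc i) 1"
    using F_far[OF w(1)] F_down[of w "Suc i" 1] w(2) by (auto simp: numeral_2_eq_2)
  have Fx: "F i x \<in> G i 0" "F i x \<in> G (Suc i) 1" "F i x \<in> G (Suc (Suc i)) 2"
    using F_down[of x i 0] F_up[OF x(2)] F_far[OF x(3)] x by auto
  have e1: "F i (E i (F (Suc i) w)) = F (Suc i) w"
    using EF[OF Fw] F_empty[OF Fw(1)] qnum_1 by (simp add: E_simps cscale_uminus eq_neg_iff_add_eq_0)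
  have "U i (U (Suc i) (U i v)) = E i (E (Suc i) (F i (E i (F (Suc i) w))))"
    by (simp add: U_def w_def EF_commute)
  also have "\<dots> = E i (F (Suc i) (E (Suc i) w)) + E i w"
    unfolding e1 using EF[OF w(2,3)] by (simp add: E_simps)
  finally have 1: "U i (U (Suc i) (U i v)) - U i v = E i (F (Suc i) (E (Suc i) w))"
    by (simp add: U_def w_def)
  have e2: "F (Suc i) (E (Suc i) (F i x)) = E (Suc i) (F (Suc i) (F i x)) + F i x"
    using EF[OF Fx(2,3)] by (simp add: cscale_uminus)
  have e3: "E i (F i x) = x"
    using EF[OF x(1,2)] E_empty[OF x(2)] by (simp add: F_simps)
  define y where "y = F (Suc i) (F i x)"
  have y: "y \<in> G (Suc i) 0" unfolding y_def using F_down[of "F i x" "Suc i" 0] Fx(2) by simp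
  have "U (Suc i) (U i (U (Suc i) v)) = E (Suc i) (E i (F (Suc i) (E (Suc i) (F i x))))"
    by (simp add: U_def x_def EF_commute)
  also have "\<dots> = E (Suc i) (E i (E (Suc i) y)) + E (Suc i) x"
    unfolding e2 by (simp add: E_simps e3 y_def)
  also have "E (Suc i) (E i (E (Suc i) y)) = E i (Ed (Suc i) 2 y)"
    using serre_divided'[of "Suc i" i 1 y] E_empty[OF y]
    by (simp add: divpow_Suc_0 Ed_simps numeral_2_eq_2)
  also have "Ed (Suc i) 2 y = F (Suc i) (Ed (Suc i) 2 (F i x))"
    using F_Ed[OF Fx(2,3), of 1] by (simp add: y_def numeral_2_eq_2)
  also have "Ed (Suc i) 2 (F i x) = F i (Ed (Suc i) 2 x)"
    by (simp add: EdF_commute)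
  also have "Ed (Suc i) 2 x = E (Suc i) v"
  proof -
    have "Ed (Suc i) 2 v = 0" using v(3) by (rule Ed_vanish) simp
    then show ?thesis
      using F_Ed[OF v(2,3), of 1] by (simp add: x_def numeral_2_eq_2 F_simps divpow_Suc_0)
  qed
  finally have 2: "U (Suc i) (U i (U (Suc i) v)) - U (Suc i) v = E i (F (Suc i) (F i (E (Suc i) v)))"
    by (simp add: U_def x_def)
  show ?thesis unfolding 1 2 by (simp add: w_def EF_commute)
qed

lemma hecke_square:
  assumes "v \<in> G i 1" "v \<in> G (Suc i) 1"
  shows "E i (F i (E i (F i v))) = (q + inverse q) \<cdot> E i (F i v)"
proof -
  define w where "w = F i v"
  have w: "w \<in> G i 0" "w \<in> G (Suc i) 2"
    unfolding w_def using F_down[of v i 0] F_up[OF assms(2)] assms(1) by (auto simp: numeral_2_eq_2)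
  have n: "qnum q (int 0 - int 2) = - (q + inverse q)"
    using qnum_minus[of q 2] qnum_two by simp
  have "F i (E i w) = (q + inverse q) \<cdot> w"
    using EF[OF w] F_empty[OF w(1)] unfolding n cscale_uminus by (simp add: E_simps)
  then show ?thesis by (simp add: w_def E_simps)
qed

text \<open>The functional equation to which the Hecke relations reduce the Yang-Baxter equation for operators
  \<open>1 + g z \<cdot> E j F j\<close>.\<close>

lemma hecke_coefficient:
  assumes "generic x" "generic y" "generic (x * y)"
  defines "g \<equiv> \<lambda>z. bcoef 1 1 1 z"
  shows "g y + g x + (q + inverse q) * (g y * g x) + g y * g (x * y) * g x = g (x * y)"
proof -
  have g: "g z = - q * ((1 - z) / (1 - q\<^sup>2 * z))" for z
    by (simp add: g_def bcoef_def power2_eq_square)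
  have "1 - q\<^sup>2 * x \<noteq> 0" "1 - q\<^sup>2 * y \<noteq> 0" "1 - q\<^sup>2 * (x * y) \<noteq> 0"
    using assms generic_denom by blast+
  then show ?thesis
    unfolding g using q_nonzero by (simp add: divide_simps) algebra
qed

lemma yang_baxter_111: "yang_baxter i 1 1 1"
  unfolding yang_baxter_def
proof (intro allI impI)
  fix x y v
  assume x: "generic x" and y: "generic y" and xy: "generic (x * y)"
    and v: "v \<in> G i 1" "v \<in> G (Suc i) 1" "v \<in> G (Suc (Suc i)) 1"
  define U where "U j u = E j (F j u)" for j u
  define g where "g z = bcoef 1 1 1 z" for z
  have A: "A j 1 1 z u = u + g z \<cdot> U j u" if "generic z" for j z u
    using A_one[of 1 z j u] that by (simp add: g_def U_def divpow_Suc_0)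
  have lin: "U j (u + u') = U j u + U j u'" "U j (c \<cdot> u) = c \<cdot> U j u" for j u u' c
    by (simp_all add: U_def E_simps F_simps)
  have sq: "U i (U i v) = (q + inverse q) \<cdot> U i v" "U (Suc i) (U (Suc i) v) = (q + inverse q) \<cdot> U (Suc i) v"
    unfolding U_def by (rule hecke_square; fact v)+
  have "U i (U (Suc i) (U i v)) = U (Suc i) (U i (U (Suc i) v)) - U (Suc i) v + U i v"
    using hecke_relation[OF v] unfolding U_def by (simp add: algebra_simps)
  then have h: "Poly_Mapping.lookup (U i (U (Suc i) (U i v))) b =
      Poly_Mapping.lookup (U (Suc i) (U i (U (Suc i) v))) b - Poly_Mapping.lookup (U (Suc i) v) b + Poly_Mapping.lookup (U i v) b" for b
    by (simp add: lookup_add lookup_minus)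
  define Q where "Q = q + inverse q"
  have co: "g y + g x + Q * (g y * g x) + g y * g (x * y) * g x = g (x * y)"
    unfolding Q_def g_def by (rule hecke_coefficient[OF x y xy])
  have expand: "u + g x * r + g (x * y) * (s + g x * sr) + g y * (r + g x * (Q * r) + g (x * y) * (rs + g x * (t - s + r))) =
      u + g y * s + g (x * y) * (r + g y * rs) + g x * (s + g y * (Q * s) + g (x * y) * (sr + g y * t))"
    for u r s rs sr t
  proof -
    have "(r - s) * (g y + g x + Q * (g y * g x) + g y * g (x * y) * g x) = (r - s) * g (x * y)"
      unfolding co ..
    then show ?thesis by (simp add: algebra_simps)
  qed
  show "A i 1 1 y (A (Suc i) 1 1 (x * y) (A i 1 1 x v)) = A (Suc i) 1 1 x (A i 1 1 (x * y) (A (Suc i) 1 1 y v))"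
    unfolding A[OF x] A[OF y] A[OF xy]
  proof (rule poly_mapping_eqI)
    fix b
    show "Poly_Mapping.lookup (v + g x \<cdot> U i v + g (x * y) \<cdot> U (Suc i) (v + g x \<cdot> U i v) +
          g y \<cdot> U i (v + g x \<cdot> U i v + g (x * y) \<cdot> U (Suc i) (v + g x \<cdot> U i v))) b =
        Poly_Mapping.lookup (v + g y \<cdot> U (Suc i) v + g (x * y) \<cdot> U i (v + g y \<cdot> U (Suc i) v) +
          g x \<cdot> U (Suc i) (v + g y \<cdot> U (Suc i) v + g (x * y) \<cdot> U i (v + g y \<cdot> U (Suc i) v))) b"
      unfolding lin sq lookup_add lookup_cscale h Q_def[symmetric] by (rule expand)
  qed
qed

text \<open>A vector \<open>w\<close> with \<open>c + 1\<close> particles on the third strand and none on the fourth is \<open>E (i + 2) v\<close>, where \<open>v\<close> has \<open>c\<close> and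
  \<open>1\<close> particles there.  For \<open>v\<close> the two sides \<open>L\<close> and \<open>R\<close> are equal by the equations for \<open>(a, b, c)\<close> and
  \<open>(a, b, 1)\<close>.  Two applications of \<open>fusion\<close> to each side turn this into the equation for \<open>w\<close>, up to divided powers of
  \<open>F\<close> that move the \<open>a\<close> and \<open>b\<close> particles to the third and fourth strand; \<open>transport_A\<close> moves them back.\<close>

lemma yang_baxter_fuse_empty:
  assumes ybc: "yang_baxter i a b c" and yb1: "yang_baxter (Suc i) a b 1"
    and ab: "1 \<le> a" "1 \<le> b" and x: "generic x" and y: "generic y" and xy: "generic (x * y)"
    and w: "w \<in> G i a" "w \<in> G (Suc i) b" "w \<in> G (Suc (Suc i)) (Suc c)" "w \<in> G (Suc (Suc (Suc i))) 0"
  shows "A i b (Suc c) y (A (Suc i) a (Suc c) (x * y) (A i a b x w)) =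
    A (Suc i) a b x (A i a (Suc c) (x * y) (A (Suc i) b (Suc c) y w))"
proof -
  define i1 where "i1 = Suc i"
  define i2 where "i2 = Suc i1"
  define i3 where "i3 = Suc i2"
  note w = w[folded i1_def, folded i2_def, folded i3_def]
  note idx = i1_def i2_def i3_def
  define v where "v = (1 / qint q (Suc c)) \<cdot> F i2 w"
  have v: "v \<in> G i a" "v \<in> G i1 b" "v \<in> G i2 c" "v \<in> G i3 1"
    unfolding v_def using F_far[OF w(1), of i2] F_far[OF w(2), of i2] F_down[of w i2 c] F_up[of w i2 0] w
    by (auto simp: idx intro!: cvec.subspace_scale[OF subspace_G])
  have Ev: "E i2 v = w"
    using EF[of w i2 "Suc c" 0] w E_empty[of w i2]
    by (simp add: v_def E_simps F_simps i3_def qint_eq_0_iff qnum_of_nat flip: of_nat_Suc)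
  \<comment> \<open>the spectral parameters at which \<open>fusion\<close> braids the single particle\<close>
  define y1 where "y1 = q powi (- int c) * y"
  define xy1 where "xy1 = q powi (- int c) * (x * y)"
  have gen: "generic (q * y)" "generic y1" "generic (q * (x * y))" "generic xy1"
    using generic_shift[OF y, of 1] generic_shift[OF y, of "- int c"] generic_shift[OF xy, of 1]
      generic_shift[OF xy, of "- int c"] by (simp_all add: y1_def xy1_def)
  have xe: "x * (q * y) = q * (x * y)" "x * y1 = xy1" by (simp_all add: y1_def xy1_def)
  define D where "D = fusion_const b c y * fusion_const a c (x * y)"
  have D: "D \<noteq> 0" using fusion_const_nonzero ab y xy by (simp add: D_def)
  define L where "L = A i1 b 1 y1 (A i b c (q * y) (A i2 a 1 xy1 (A i1 a c (q * (x * y)) (A i a b x v))))"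
  define R where "R = A i2 a b x (A i1 a 1 xy1 (A i a c (q * (x * y)) (A i2 b 1 y1 (A i1 b c (q * y) v))))"
  have LR: "L = R"
  proof -
    have "L = A i1 b 1 y1 (A i2 a 1 xy1 (A i b c (q * y) (A i1 a c (q * (x * y)) (A i a b x v))))"
      unfolding L_def by (subst A_A_commute[of i i2]) (simp_all add: idx)
    also have "A i b c (q * y) (A i1 a c (q * (x * y)) (A i a b x v)) = A i1 a b x (A i a c (q * (x * y)) (A i1 b c (q * y) v))"
      using yang_baxterD[OF ybc x gen(1) _ v(1,2)[unfolded i1_def] v(3)[unfolded idx]] gen(3) unfolding xe i1_def .
    also have "A i1 b 1 y1 (A i2 a 1 xy1 (A i1 a b x (A i a c (q * (x * y)) (A i1 b c (q * y) v)))) =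
        A i2 a b x (A i1 a 1 xy1 (A i2 b 1 y1 (A i a c (q * (x * y)) (A i1 b c (q * y) v))))"
    proof -
      define u where "u = A i1 b c (q * y) v"
      have u: "u \<in> G i a" "u \<in> G i1 c" "u \<in> G i2 b" "u \<in> G i3 1"
        unfolding u_def using A_G[of v i1 b c] A_far[OF v(1), of i1] A_far[OF v(4), of i1] v
        by (auto simp: idx)
      define u' where "u' = A i a c (q * (x * y)) u"
      have u': "u' \<in> G i1 a" "u' \<in> G i2 b" "u' \<in> G i3 1"
        unfolding u'_def using A_G(2)[of u i a c] A_far[OF u(3), of i] A_far[OF u(4), of i] u
        by (auto simp: idx)
      show ?thesis
        using yang_baxterD[OF yb1 x gen(2) _ u'[unfolded i3_def i2_def, unfolded i1_def]] gen(4)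
        unfolding xe i2_def unfolding i1_def u'_def u_def .
    qed
    also have "A i2 b 1 y1 (A i a c (q * (x * y)) (A i1 b c (q * y) v)) = A i a c (q * (x * y)) (A i2 b 1 y1 (A i1 b c (q * y) v))"
      by (subst A_A_commute[of i i2]) (simp_all add: idx)
    finally show ?thesis unfolding R_def .
  qed
  define lhs where "lhs = A i b (Suc c) y (A i1 a (Suc c) (x * y) (A i a b x w))"
  define s where "s = A i a (Suc c) (x * y) (A i1 b (Suc c) y w)"
  have comm: "A i p r z (Fd i2 n u) = Fd i2 n (A i p r z u)" for p r z n u
    by (rule Fd_A_commute[symmetric]) (simp add: idx)
  have EL: "E i L = D \<cdot> Fd i1 b (Fd i2 a lhs)"
  proof -
    define u0 where "u0 = A i a b x v"
    have u0: "u0 \<in> G i b" "u0 \<in> G i1 a" "u0 \<in> G i2 c" "u0 \<in> G i3 1"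
      unfolding u0_def using A_G[of v i a b] A_far[OF v(3), of i] A_far[OF v(4), of i] v by (auto simp: idx)
    define u1 where "u1 = A i1 a c (q * (x * y)) u0"
    have u1: "u1 \<in> G i b" "u1 \<in> G i1 c" "u1 \<in> G i2 a" "u1 \<in> G i3 1"
      unfolding u1_def using A_G[of u0 i1 a c] A_far[OF u0(1), of i1] A_far[OF u0(4), of i1] u0 by (auto simp: idx)
    define u where "u = A i2 a 1 xy1 u1"
    have u: "u \<in> G i b" "u \<in> G (Suc i) c" "u \<in> G (Suc (Suc i)) 1"
      unfolding u_def using A_G[of u1 i2 a 1] A_far[OF u1(1), of i2] A_far[OF u1(2), of i2] u1 by (auto simp: idx)
    have "E i L = fusion_const b c y \<cdot> Fd i1 b (A i b (Suc c) y (E i1 u))"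
      using fusion[OF u ab(2) y] by (simp add: L_def u_def u1_def u0_def y1_def i1_def)
    also have "E i1 u = fusion_const a c (x * y) \<cdot> Fd i2 a (A i1 a (Suc c) (x * y) (E i2 u0))"
      using fusion[of u0 i1 a c, OF _ _ _ ab(1) xy] u0 by (simp add: u_def u1_def xy1_def idx)
    also have "E i2 u0 = A i a b x w"
      using E_A_commute'[of i i2 a b x v] by (simp only: u0_def Ev) (simp add: idx)
    also have "fusion_const b c y \<cdot> Fd i1 b (A i b (Suc c) y (fusion_const a c (x * y) \<cdot>
        Fd i2 a (A i1 a (Suc c) (x * y) (A i a b x w)))) = D \<cdot> Fd i1 b (Fd i2 a lhs)"
      by (simp add: lhs_def D_def A_simps Fd_simps comm)
    finally show ?thesis .
  qed
  have ER: "E i R = D \<cdot> A i2 a b x (Fd i1 a (Fd i2 b s))"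
  proof -
    define u0 where "u0 = A i1 b c (q * y) v"
    have u0: "u0 \<in> G i a" "u0 \<in> G i1 c" "u0 \<in> G i2 b" "u0 \<in> G i3 1"
      unfolding u0_def using A_G[of v i1 b c] A_far[OF v(1), of i1] A_far[OF v(4), of i1] v by (auto simp: idx)
    define u where "u = A i2 b 1 y1 u0"
    have u: "u \<in> G i a" "u \<in> G (Suc i) c" "u \<in> G (Suc (Suc i)) 1"
      unfolding u_def using A_G[of u0 i2 b 1] A_far[OF u0(1), of i2] A_far[OF u0(2), of i2] u0 by (auto simp: idx)
    have "E i R = A i2 a b x (E i (A i1 a 1 xy1 (A i a c (q * (x * y)) u)))"
      unfolding R_def by (subst E_A_commute) (simp_all add: u_def u0_def idx)
    also have "E i (A i1 a 1 xy1 (A i a c (q * (x * y)) u)) = fusion_const a c (x * y) \<cdot> Fd i1 a (A i a (Suc c) (x * y) (E i1 u))"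
      using fusion[OF u ab(1) xy] by (simp add: xy1_def i1_def)
    also have "E i1 u = fusion_const b c y \<cdot> Fd i2 b (A i1 b (Suc c) y w)"
      using fusion[of v i1 b c, OF _ _ _ ab(2) y] v by (simp add: u_def u0_def y1_def Ev idx[symmetric] flip: Ev)
    also have "A i2 a b x (fusion_const a c (x * y) \<cdot> Fd i1 a (A i a (Suc c) (x * y)
        (fusion_const b c y \<cdot> Fd i2 b (A i1 b (Suc c) y w)))) = D \<cdot> A i2 a b x (Fd i1 a (Fd i2 b s))"
      by (simp add: s_def D_def A_simps Fd_simps comm mult.commute)
    finally show ?thesis .
  qed
  have main: "Fd i1 b (Fd i2 a lhs) = A i2 a b x (Fd i1 a (Fd i2 b s))"
    using EL ER D unfolding LR by (metis cscale_cancel)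
  have lhs: "lhs \<in> G i2 a" "lhs \<in> G i1 b" "lhs \<in> G i3 0"
  proof -
    define u0 where "u0 = A i a b x w"
    have u0: "u0 \<in> G i b" "u0 \<in> G i1 a" "u0 \<in> G i2 (Suc c)" "u0 \<in> G i3 0"
      unfolding u0_def using A_G[of w i a b] A_far[OF w(3), of i] A_far[OF w(4), of i] w by (auto simp: idx)
    define u1 where "u1 = A i1 a (Suc c) (x * y) u0"
    have u1: "u1 \<in> G i b" "u1 \<in> G i1 (Suc c)" "u1 \<in> G i2 a" "u1 \<in> G i3 0"
      unfolding u1_def using A_G[of u0 i1 a "Suc c"] A_far[OF u0(1), of i1] A_far[OF u0(4), of i1] u0 by (auto simp: idx)
    show "lhs \<in> G i2 a" "lhs \<in> G i1 b" "lhs \<in> G i3 0"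
      unfolding lhs_def u0_def[symmetric] u1_def[symmetric]
      using A_G[of u1 i b "Suc c"] A_far[OF u1(3), of i] A_far[OF u1(4), of i] u1 by (auto simp: idx)
  qed
  have s: "s \<in> G i1 a" "s \<in> G i2 b" "s \<in> G i3 0"
  proof -
    define u0 where "u0 = A i1 b (Suc c) y w"
    have u0: "u0 \<in> G i a" "u0 \<in> G i1 (Suc c)" "u0 \<in> G i2 b" "u0 \<in> G i3 0"
      unfolding u0_def using A_G[of w i1 b "Suc c"] A_far[OF w(1), of i1] A_far[OF w(4), of i1] w by (auto simp: idx)
    show "s \<in> G i1 a" "s \<in> G i2 b" "s \<in> G i3 0"
      unfolding s_def u0_def[symmetric]
      using A_G[of u0 i a "Suc c"] A_far[OF u0(3), of i] A_far[OF u0(4), of i] u0 by (auto simp: idx)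
  qed
  define v0 where "v0 = Fd i1 a (Fd i2 b s)"
  have inv: "Ed i2 n2 (Ed i1 n1 (Fd i1 n1 (Fd i2 n2 t))) = t"
    if t: "t \<in> G i1 n1" "t \<in> G i2 n2" "t \<in> G i3 0" for t n1 n2
  proof -
    have "Fd i2 n2 t \<in> G i1 n1" "Fd i2 n2 t \<in> G (Suc i1) 0"
      using Fd_far[OF t(1), of i2] Fd_down[OF t(2), of n2] by (auto simp: idx)
    then have "Ed i1 n1 (Fd i1 n1 (Fd i2 n2 t)) = Fd i2 n2 t" by (rule Ed_Fd_inverse)
    then show ?thesis using Ed_Fd_inverse[OF t(2)] t(3) by (simp add: i3_def)
  qed
  have v0: "v0 \<in> G i1 0" "v0 \<in> G (Suc i1) a" "v0 \<in> G (Suc (Suc i1)) b"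
  proof -
    have t: "Fd i2 b s \<in> G i1 a" "Fd i2 b s \<in> G (Suc i1) 0" "Fd i2 b s \<in> G (Suc (Suc i1)) b"
      using Fd_far[OF s(1), of i2] Fd_down[OF s(2), of b] Fd_up[of s i2 0 b] s(3) by (auto simp: idx)
    show "v0 \<in> G i1 0" "v0 \<in> G (Suc i1) a" "v0 \<in> G (Suc (Suc i1)) b"
      unfolding v0_def using Fd_down[OF t(1), of a] Fd_up[OF t(2), of a] Fd_far[OF t(3), of i1] by auto
  qed
  have "A i1 a b x s = A i1 a b x (Ed i2 b (Ed i1 a v0))"
    unfolding v0_def by (simp only: inv[OF s])
  also have "\<dots> = Ed i2 a (Ed i1 b (A i2 a b x v0))"
    using transport_A[OF v0] by (simp add: i2_def)
  also have "\<dots> = lhs"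
    unfolding v0_def main[symmetric] by (rule inv[OF lhs(2,1,3)])
  finally show ?thesis
    unfolding lhs_def s_def i1_def by simp
qed

text \<open>The map \<open>\<sigma>\<close> inserts an empty strand behind the three strands in question.\<close>

lemma yang_baxter_fuse:
  assumes shift: "\<And>p. \<exists>\<sigma>. clin \<sigma> \<and> inj \<sigma> \<and> (\<forall>v. \<sigma> v \<in> G p 0) \<and>
      (\<forall>i n v. i < p \<longrightarrow> v \<in> G i n \<longrightarrow> \<sigma> v \<in> G i n) \<and>
      (\<forall>i v. Suc i < p \<longrightarrow> \<sigma> (E i v) = E i (\<sigma> v) \<and> \<sigma> (F i v) = F i (\<sigma> v))"
    and "yang_baxter i a b c" "yang_baxter (Suc i) a b 1" "1 \<le> a" "1 \<le> b"
  shows "yang_baxter i a b (Suc c)"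
  unfolding yang_baxter_def
proof (intro allI impI)
  fix x y v
  assume x: "generic x" "generic y" "generic (x * y)"
    and v: "v \<in> G i a" "v \<in> G (Suc i) b" "v \<in> G (Suc (Suc i)) (Suc c)"
  obtain \<sigma> where s: "clin \<sigma>" "inj \<sigma>" "\<And>v. \<sigma> v \<in> G (Suc (Suc (Suc i))) 0"
    "\<And>j n v. j < Suc (Suc (Suc i)) \<Longrightarrow> v \<in> G j n \<Longrightarrow> \<sigma> v \<in> G j n"
    "\<And>j v. Suc j < Suc (Suc (Suc i)) \<Longrightarrow> \<sigma> (E j v) = E j (\<sigma> v) \<and> \<sigma> (F j v) = F j (\<sigma> v)"
    using shift[of "Suc (Suc (Suc i))"] by blast
  have A: "\<sigma> (A j k l z u) = A j k l z (\<sigma> u)" if "j = i \<or> j = Suc i" for j k l z u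
    using s(5)[of j] that by (intro map_A[OF s(1)]) auto
  have "\<sigma> (A i b (Suc c) y (A (Suc i) a (Suc c) (x * y) (A i a b x v))) =
      \<sigma> (A (Suc i) a b x (A i a (Suc c) (x * y) (A (Suc i) b (Suc c) y v)))"
    unfolding A[OF disjI1[OF refl]] A[OF disjI2[OF refl]]
    using assms(2-) x s(4)[OF _ v(1)] s(4)[OF _ v(2)] s(4)[OF _ v(3)] s(3)
    by (intro yang_baxter_fuse_empty) auto
  then show "A i b (Suc c) y (A (Suc i) a (Suc c) (x * y) (A i a b x v)) =
      A (Suc i) a b x (A i a (Suc c) (x * y) (A (Suc i) b (Suc c) y v))"
    using s(2) by (simp add: inj_def)
qed

text \<open>Fusion raises the third particle number only; the exchange lemmas bring each of the three into the last place.\<close>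

theorem yang_baxter_all:
  assumes shift: "\<And>p. \<exists>\<sigma>. clin \<sigma> \<and> inj \<sigma> \<and> (\<forall>v. \<sigma> v \<in> G p 0) \<and>
      (\<forall>i n v. i < p \<longrightarrow> v \<in> G i n \<longrightarrow> \<sigma> v \<in> G i n) \<and>
      (\<forall>i v. Suc i < p \<longrightarrow> \<sigma> (E i v) = E i (\<sigma> v) \<and> \<sigma> (F i v) = F i (\<sigma> v))"
    and "1 \<le> a" "1 \<le> b" "1 \<le> c"
  shows "yang_baxter i a b c"
proof -
  have grow: "yang_baxter i a b c" if "\<And>i. yang_baxter i a b 1" "1 \<le> a" "1 \<le> b" "1 \<le> c" for i a b c
    using that(4)
  proof (induction c arbitrary: i rule: dec_induct)
    case base
    show ?case by (rule that(1))
  next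
    case (step n)
    show ?case using shift step.IH that(1-3) by (rule yang_baxter_fuse)
  qed
  have "yang_baxter i 1 1 c" if "1 \<le> c" for i c
    using grow[of 1 1 c] yang_baxter_111 that by simp
  then have "yang_baxter i 1 c 1" if "1 \<le> c" for i c
    using that yang_baxter_swap23 by blast
  then have "yang_baxter i 1 b c" if "1 \<le> b" "1 \<le> c" for i b c
    using grow[of 1 b c] that by simp
  then have "yang_baxter i a b 1" if "1 \<le> a" "1 \<le> b" for i a b
    using that yang_baxter_swap12 yang_baxter_swap23 by blast
  then show ?thesis using grow assms(2-) by blast
qed

end

section \<open>Configurations of particles\<close>

text \<open>A configuration assigns to each mode the set of strands on which it is occupied.\<close>

type_synonym config = "int \<Rightarrow> nat set"

text \<open>A hop without fermionic sign; \<open>gauge\<close> below removes the signs of the Fock space.\<close>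

definition move :: "int \<Rightarrow> nat \<Rightarrow> nat \<Rightarrow> (config \<Rightarrow>\<^sub>0 complex) \<Rightarrow> (config \<Rightarrow>\<^sub>0 complex)" where
  "move m i j = linext (\<lambda>c. if j \<in> c m \<and> i \<notin> c m then ket (c(m := insert i (c m - {j}))) else 0)"

definition imbalance :: "int set \<Rightarrow> nat \<Rightarrow> config \<Rightarrow> int" where
  "imbalance J i c = (\<Sum>m\<in>J. of_bool (i \<in> c m) - of_bool (Suc i \<in> c m))"

definition kop :: "complex \<Rightarrow> int set \<Rightarrow> nat \<Rightarrow> (config \<Rightarrow>\<^sub>0 complex) \<Rightarrow> (config \<Rightarrow>\<^sub>0 complex)" where
  "kop q J i = diagop q (imbalance J i)"

definition kinv :: "complex \<Rightarrow> int set \<Rightarrow> nat \<Rightarrow> (config \<Rightarrow>\<^sub>0 complex) \<Rightarrow> (config \<Rightarrow>\<^sub>0 complex)" where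
  "kinv q J i = diagop q (\<lambda>c. - imbalance J i c)"

text \<open>The action of the Chevalley generators on a tensor product over the modes in \<open>M\<close>, by iterated coproducts (see
  \<open>raise_insert\<close>).  One mode contributes the exterior algebra over the strands.\<close>

definition raise :: "complex \<Rightarrow> int set \<Rightarrow> nat \<Rightarrow> (config \<Rightarrow>\<^sub>0 complex) \<Rightarrow> (config \<Rightarrow>\<^sub>0 complex)" where
  "raise q M i v = (\<Sum>m\<in>M. move m i (Suc i) (kop q {j \<in> M. m < j} i v))"

definition lower :: "complex \<Rightarrow> int set \<Rightarrow> nat \<Rightarrow> (config \<Rightarrow>\<^sub>0 complex) \<Rightarrow> (config \<Rightarrow>\<^sub>0 complex)" where
  "lower q M i v = (\<Sum>m\<in>M. kinv q {j \<in> M. j < m} i (move m (Suc i) i v))"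

definition strand_grade :: "int set \<Rightarrow> nat \<Rightarrow> nat \<Rightarrow> (config \<Rightarrow>\<^sub>0 complex) set" where
  "strand_grade M i n = {v. \<forall>c\<in>Poly_Mapping.keys v. card {m \<in> M. i \<in> c m} = n}"

lemma clin_move [simp]: "clin (move m i j)" and clin_kop [simp]: "clin (kop q J i)" and clin_kinv [simp]: "clin (kinv q J i)"
  by (simp_all add: move_def kop_def kinv_def)

lemma clin_raise [simp]: "clin (raise q M i)"
  unfolding raise_def[abs_def] by (rule clin_sum) (rule linear_comp'[OF clin_kop clin_move])

lemma clin_lower [simp]: "clin (lower q M i)"
  unfolding lower_def[abs_def] by (rule clin_sum) (rule linear_comp'[OF clin_move clin_kinv])

lemma move_ket: "move m i j (ket c) = (if j \<in> c m \<and> i \<notin> c m then ket (c(m := insert i (c m - {j}))) else 0)"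
  by (simp add: move_def)

lemma kop_ket: "kop q J i (ket c) = (q powi imbalance J i c) \<cdot> ket c"
  and kinv_ket: "kinv q J i (ket c) = (q powi (- imbalance J i c)) \<cdot> ket c"
  by (simp_all add: kop_def kinv_def)

lemmas lin_simps = linear_add'[OF clin_move] linear_scale'[OF clin_move] linear_0'[OF clin_move]
  linear_add'[OF clin_kop] linear_scale'[OF clin_kop] linear_0'[OF clin_kop]
  linear_add'[OF clin_kinv] linear_scale'[OF clin_kinv] linear_0'[OF clin_kinv]
  linear_add'[OF clin_raise] linear_scale'[OF clin_raise] linear_0'[OF clin_raise]
  linear_add'[OF clin_lower] linear_scale'[OF clin_lower] linear_0'[OF clin_lower]

lemma ket_eqI2:
  assumes "clin f" "clin g" "clin f'" "clin g'" "\<And>c. f (g (ket c)) = a \<cdot> f' (g' (ket c))"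
  shows "f (g v) = a \<cdot> f' (g' v)"
  by (rule lin_eqI[OF linear_comp'[OF assms(2,1)] clin_scaled[OF linear_comp'[OF assms(4,3)]] assms(5)])

lemma ket_eqI2':
  assumes "clin f" "clin g" "clin f'" "clin g'" "\<And>c. f (g (ket c)) = f' (g' (ket c))"
  shows "f (g v) = f' (g' v)"
  by (rule lin_eqI[OF linear_comp'[OF assms(2,1)] linear_comp'[OF assms(4,3)] assms(5)])

lemma imbalance_empty [simp]: "imbalance {} i c = 0"
  by (simp add: imbalance_def)

lemma imbalance_insert: "finite M \<Longrightarrow> m \<notin> M \<Longrightarrow>
    imbalance (insert m M) i c = imbalance {m} i c + imbalance M i c"
  by (simp add: imbalance_def)

lemma imbalance_upd: "m \<notin> J \<Longrightarrow> imbalance J i (c(m := S)) = imbalance J i c"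
  unfolding imbalance_def by (intro sum.cong refl) auto

lemma kop_kop: "kop q J i (kop q J' j v) = kop q J' j (kop q J i v)"
  and kop_kinv: "kop q J i (kinv q J' j v) = kinv q J' j (kop q J i v)"
  and kinv_kinv: "kinv q J i (kinv q J' j v) = kinv q J' j (kinv q J i v)"
  by (simp_all add: kop_def kinv_def diagop_commute)

lemma kop_insert:
  assumes "q \<noteq> 0" "finite M" "m \<notin> M"
  shows "kop q (insert m M) i v = kop q M i (kop q {m} i v)"
    and "kinv q (insert m M) i v = kinv q M i (kinv q {m} i v)"
  unfolding kop_def kinv_def diagop_diagop[OF assms(1)] imbalance_insert[OF assms(2,3), abs_def]
  by (simp_all add: add.commute)

lemma kop_empty [simp]: "kop q {} i v = v" and kinv_empty [simp]: "kinv q {} i v = v"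
  by (rule poly_mapping_eqI, simp add: kop_def kinv_def)+

lemma move_move: "m \<noteq> m' \<Longrightarrow> move m i j (move m' i' j' v) = move m' i' j' (move m i j v)"
  by (rule ket_eqI2'[OF clin_move clin_move clin_move clin_move]) (auto simp: move_ket lin_simps fun_upd_twist)

lemma kop_move: "m \<notin> J \<Longrightarrow> kop q J l (move m i j v) = move m i j (kop q J l v)"
  by (rule ket_eqI2'[OF clin_kop clin_move clin_move clin_kop]) (auto simp: move_ket kop_ket lin_simps imbalance_upd)

lemma kinv_move: "m \<notin> J \<Longrightarrow> kinv q J l (move m i j v) = move m i j (kinv q J l v)"
  by (rule ket_eqI2'[OF clin_kinv clin_move clin_move clin_kinv]) (auto simp: move_ket kinv_ket lin_simps imbalance_upd)

lemma move_raise: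
  assumes "m \<notin> M"
  shows "move m i j (raise q M l v) = raise q M l (move m i j v)"
  unfolding raise_def linear_sum'[OF clin_move]
proof (intro sum.cong refl)
  fix x assume "x \<in> M"
  with assms have "m \<noteq> x" by blast
  then show "move m i j (move x l (Suc l) (kop q {j \<in> M. x < j} l v)) = move x l (Suc l) (kop q {j \<in> M. x < j} l (move m i j v))"
    using assms by (subst move_move) (simp_all add: kop_move)
qed

lemma move_lower:
  assumes "m \<notin> M"
  shows "move m i j (lower q M l v) = lower q M l (move m i j v)"
  unfolding lower_def linear_sum'[OF clin_move]
proof (intro sum.cong refl)
  fix x assume "x \<in> M"
  with assms have "m \<noteq> x" by blast
  then have "move m i j (move x (Suc l) l v) = move x (Suc l) l (move m i j v)" by (rule move_move)
  then show "move m i j (kinv q {j \<in> M. j < x} l (move x (Suc l) l v)) = kinv q {j \<in> M. j < x} l (move x (Suc l) l (move m i j v))"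
    using assms by (subst kinv_move[symmetric]) simp_all
qed

lemma kop_raise:
  assumes "m \<notin> M"
  shows "kop q {m} i (raise q M l v) = raise q M l (kop q {m} i v)"
  unfolding raise_def linear_sum'[OF clin_kop]
proof (intro sum.cong refl)
  fix x assume "x \<in> M"
  with assms show "kop q {m} i (move x l (Suc l) (kop q {j \<in> M. x < j} l v)) = move x l (Suc l) (kop q {j \<in> M. x < j} l (kop q {m} i v))"
    by (subst kop_move) (auto simp: kop_kop[of q "{m}"])
qed

lemma kop_lower:
  assumes "m \<notin> M"
  shows "kop q {m} i (lower q M l v) = lower q M l (kop q {m} i v)"
  unfolding lower_def linear_sum'[OF clin_kop]
proof (intro sum.cong refl)
  fix x assume "x \<in> M"
  with assms show "kop q {m} i (kinv q {j \<in> M. j < x} l (move x (Suc l) l v)) = kinv q {j \<in> M. j < x} l (move x (Suc l) l (kop q {m} i v))"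
    by (subst kop_kinv, subst kop_move) auto
qed

definition cartan :: "nat \<Rightarrow> nat \<Rightarrow> int" where
  "cartan i j = (if i = j then 2 else if i = Suc j \<or> j = Suc i then - 1 else 0)"

lemma cartan_commute: "cartan i j = cartan j i"
  by (auto simp: cartan_def)

lemma imbalance_move:
  assumes "finite J" "m \<in> J"
  shows "Suc j \<in> c m \<Longrightarrow> j \<notin> c m \<Longrightarrow> imbalance J i (c(m := insert j (c m - {Suc j}))) = imbalance J i c + cartan i j"
    and "j \<in> c m \<Longrightarrow> Suc j \<notin> c m \<Longrightarrow> imbalance J i (c(m := insert (Suc j) (c m - {j}))) = imbalance J i c - cartan i j"
proof -
  have split: "imbalance J i c = imbalance {m} i c + imbalance (J - {m}) i c" for c
    using assms imbalance_insert[of "J - {m}" m i c] by (simp add: insert_absorb)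
  show "Suc j \<in> c m \<Longrightarrow> j \<notin> c m \<Longrightarrow> imbalance J i (c(m := insert j (c m - {Suc j}))) = imbalance J i c + cartan i j"
    unfolding split by (auto simp: imbalance_upd) (auto simp: imbalance_def cartan_def)
  show "j \<in> c m \<Longrightarrow> Suc j \<notin> c m \<Longrightarrow> imbalance J i (c(m := insert (Suc j) (c m - {j}))) = imbalance J i c - cartan i j"
    unfolding split by (auto simp: imbalance_upd) (auto simp: imbalance_def cartan_def)
qed

lemma kop_move_up:
  assumes "q \<noteq> 0" "finite J" "m \<in> J"
  shows "kop q J i (move m j (Suc j) v) = (q powi cartan i j) \<cdot> move m j (Suc j) (kop q J i v)"
  by (rule ket_eqI2[OF clin_kop clin_move clin_move clin_kop])
    (simp add: move_ket kop_ket lin_simps imbalance_move assms power_int_add mult.commute)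

lemma kop_move_down:
  assumes "q \<noteq> 0" "finite J" "m \<in> J"
  shows "kop q J i (move m (Suc j) j v) = (q powi (- cartan i j)) \<cdot> move m (Suc j) j (kop q J i v)"
  by (rule ket_eqI2[OF clin_kop clin_move clin_move clin_kop])
    (simp add: move_ket kop_ket lin_simps imbalance_move assms power_int_diff power_int_minus divide_inverse mult.commute)

lemma kinv_move_up:
  assumes "q \<noteq> 0" "finite J" "m \<in> J"
  shows "kinv q J i (move m j (Suc j) v) = (q powi (- cartan i j)) \<cdot> move m j (Suc j) (kinv q J i v)"
  by (rule ket_eqI2[OF clin_kinv clin_move clin_move clin_kinv])
    (simp add: move_ket kinv_ket lin_simps imbalance_move assms power_int_diff power_int_minus divide_inverse mult.commute)

lemma kinv_raise:
  assumes "q \<noteq> 0" "finite M"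
  shows "kinv q M i (raise q M j v) = (q powi (- cartan i j)) \<cdot> raise q M j (kinv q M i v)"
  unfolding raise_def linear_sum'[OF clin_kinv] cscale_sum
  by (intro sum.cong refl) (simp add: kinv_move_up[OF assms] flip: kop_kinv)

text \<open>The coproduct \<open>\<Delta> E = E \<otimes> K + 1 \<otimes> E\<close>, with the largest mode as second factor.  It reduces the relations for
  \<open>raise\<close> and \<open>lower\<close> to those for a single mode.\<close>

lemma raise_insert:
  assumes "q \<noteq> 0" "finite M" "\<forall>j\<in>M. j < m"
  shows "raise q (insert m M) i v = raise q M i (kop q {m} i v) + move m i (Suc i) v"
proof -
  have m: "m \<notin> M" using assms(3) by auto
  have "raise q (insert m M) i v = move m i (Suc i) (kop q {j \<in> insert m M. m < j} i v) +
      (\<Sum>m'\<in>M. move m' i (Suc i) (kop q {j \<in> insert m M. m' < j} i v))"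
    unfolding raise_def by (rule sum.insert[OF assms(2) m])
  also have "{j \<in> insert m M. m < j} = {}" using assms(3) by auto
  also have "(\<Sum>m'\<in>M. move m' i (Suc i) (kop q {j \<in> insert m M. m' < j} i v)) = raise q M i (kop q {m} i v)"
    unfolding raise_def
  proof (intro sum.cong refl)
    fix m' assume "m' \<in> M"
    then have "{j \<in> insert m M. m' < j} = insert m {j \<in> M. m' < j}" using assms(3) by auto
    then show "move m' i (Suc i) (kop q {j \<in> insert m M. m' < j} i v) = move m' i (Suc i) (kop q {j \<in> M. m' < j} i (kop q {m} i v))"
      using kop_insert(1)[OF assms(1), of "{j \<in> M. m' < j}" m i v] assms(2) m by simp
  qed
  finally show ?thesis by (simp add: add.commute)
qed

lemma lower_insert:
  assumes "finite M" "\<forall>j\<in>M. j < m"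
  shows "lower q (insert m M) i v = lower q M i v + kinv q M i (move m (Suc i) i v)"
proof -
  have m: "m \<notin> M" using assms(2) by auto
  have "{j \<in> insert m M. j < m} = M" using assms(2) by auto
  moreover have "{j \<in> insert m M. j < m'} = {j \<in> M. j < m'}" if "m' \<in> M" for m'
    using that assms(2) by force
  ultimately show ?thesis
    unfolding lower_def sum.insert[OF assms(1) m] by (simp add: add.commute)
qed

section \<open>The relations of quantum gl\<close>

lemma move_up_down:
  assumes "i \<noteq> j"
  shows "move m i (Suc i) (move m (Suc j) j v) = move m (Suc j) j (move m i (Suc i) v)"
proof (rule ket_eqI2'[OF clin_move clin_move clin_move clin_move])
  fix c :: config
  have "insert i (insert (Suc j) (c m - {j}) - {Suc i}) = insert (Suc j) (insert i (c m - {Suc i}) - {j})"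
    if "j \<noteq> Suc i" "i \<noteq> Suc j"
    using that assms by auto
  then show "move m i (Suc i) (move m (Suc j) j (ket c)) = move m (Suc j) j (move m i (Suc i) (ket c))"
    using assms by (auto simp: move_ket lin_simps)
qed

lemma move_far_commute:
  assumes "Suc i < j"
  shows "move m i (Suc i) (move m j (Suc j) v) = move m j (Suc j) (move m i (Suc i) v)"
    and "move m (Suc i) i (move m (Suc j) j v) = move m (Suc j) j (move m (Suc i) i v)"
proof -
  have 1: "insert i (insert j (S - {Suc j}) - {Suc i}) = insert j (insert i (S - {Suc i}) - {Suc j})"
    "insert (Suc i) (insert (Suc j) (S - {j}) - {i}) = insert (Suc j) (insert (Suc i) (S - {i}) - {j})" for S
    using assms by auto
  show "move m i (Suc i) (move m j (Suc j) v) = move m j (Suc j) (move m i (Suc i) v)"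
    by (rule ket_eqI2'[OF clin_move clin_move clin_move clin_move]) (use assms in \<open>auto simp: move_ket lin_simps 1\<close>)
  show "move m (Suc i) i (move m (Suc j) j v) = move m (Suc j) j (move m (Suc i) i v)"
    by (rule ket_eqI2'[OF clin_move clin_move clin_move clin_move]) (use assms in \<open>auto simp: move_ket lin_simps 1\<close>)
qed

lemma move_twice: "move m i (Suc i) (move m i (Suc i) v) = 0"
  by (rule ket_eqI2'[OF clin_move clin_move clin_zero clin_zero]) (simp add: move_ket lin_simps)

lemma move_sandwich:
  assumes "j = Suc i \<or> i = Suc j"
  shows "move m i (Suc i) (move m j (Suc j) (move m i (Suc i) v)) = 0"
  by (rule ket_eqI2'[OF clin_move linear_comp'[OF clin_move clin_move] clin_zero clin_zero])
    (use assms in \<open>auto simp: move_ket lin_simps\<close>)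

context generic_q begin

text \<open>For a single mode the difference of the two products is \<open>1\<close>, \<open>- 1\<close> or \<open>0\<close>, and so is the quantum integer of the
  imbalance.\<close>

lemma move_up_down_same:
  "move m i (Suc i) (move m (Suc i) i v) =
    move m (Suc i) i (move m i (Suc i) v) + (1 / (q - inverse q)) \<cdot> (kop q {m} i v - kinv q {m} i v)"
proof (rule lin_eqI[of cscale "\<lambda>v. move m i (Suc i) (move m (Suc i) i v)"
      "\<lambda>v. move m (Suc i) i (move m i (Suc i) v) + (1 / (q - inverse q)) \<cdot> (kop q {m} i v - kinv q {m} i v)"])
  show "clin (\<lambda>v. move m (Suc i) i (move m i (Suc i) v) + (1 / (q - inverse q)) \<cdot> (kop q {m} i v - kinv q {m} i v))"
    by (intro clinI) (simp_all add: lin_simps cvec.scale_right_diff_distrib cvec.scale_right_distrib mult.commute)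
  fix c :: config
  have 1: "insert i (insert (Suc i) (c m - {i}) - {Suc i}) = c m" if "i \<in> c m" "Suc i \<notin> c m"
    using that by auto
  have 2: "insert (Suc i) (insert i (c m - {Suc i}) - {i}) = c m" if "i \<notin> c m" "Suc i \<in> c m"
    using that by auto
  have 3: "(1 / (q - inverse q)) \<cdot> (q \<cdot> v - inverse q \<cdot> v) = v" "(1 / (q - inverse q)) \<cdot> (inverse q \<cdot> v - q \<cdot> v) = - v"
    for v :: "config \<Rightarrow>\<^sub>0 complex"
  proof -
    have "(inverse q - q) / (q - inverse q) = - 1" using q_minus_inverse by (simp add: field_simps)
    then show "(1 / (q - inverse q)) \<cdot> (q \<cdot> v - inverse q \<cdot> v) = v" "(1 / (q - inverse q)) \<cdot> (inverse q \<cdot> v - q \<cdot> v) = - v"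
      using q_minus_inverse unfolding cvec.scale_left_diff_distrib[symmetric] cvec.scale_scale
      by (simp_all add: cscale_uminus)
  qed
  show "move m i (Suc i) (move m (Suc i) i (ket c)) = move m (Suc i) i (move m i (Suc i) (ket c)) +
      (1 / (q - inverse q)) \<cdot> (kop q {m} i (ket c) - kinv q {m} i (ket c))"
    by (cases "i \<in> c m"; cases "Suc i \<in> c m")
      (simp_all add: move_ket lin_simps kop_ket kinv_ket imbalance_def power_int_minus insert_absorb 1 2 3)
qed (rule linear_comp'[OF clin_move clin_move])

lemma raise_kinv:
  assumes "finite M"
  shows "raise q M j (kinv q M i v) = (q powi cartan i j) \<cdot> kinv q M i (raise q M j v)"
  using kinv_raise[OF q_nonzero assms, of i j v] q_nonzero by (simp add: power_int_minus)

lemma raise_lower: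
  assumes "finite M"
  shows "raise q M i (lower q M j v) = lower q M j (raise q M i v) +
    (if i = j then (1 / (q - inverse q)) \<cdot> (kop q M i v - kinv q M i v) else 0)"
  using assms
proof (induction M arbitrary: v rule: finite_linorder_max_induct)
  case empty
  then show ?case by (simp add: raise_def lower_def)
next
  case (insert m M)
  have m: "m \<notin> M" using insert.hyps by auto
  note ins = raise_insert[OF q_nonzero insert.hyps] lower_insert[OF insert.hyps]
  define x where "x = move m i (Suc i) (move m (Suc j) j v) - move m (Suc j) j (move m i (Suc i) v)"
  have x: "x = (if i = j then (1 / (q - inverse q)) \<cdot> (kop q {m} i v - kinv q {m} i v) else 0)"
    using move_up_down_same[of m i v] move_up_down[of i j m v] by (auto simp: x_def)
  have "raise q (insert m M) i (lower q (insert m M) j v) =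
      raise q M i (lower q M j (kop q {m} i v)) + kinv q M j (move m (Suc j) j (raise q M i (kop q {m} i v))) +
      lower q M j (move m i (Suc i) v) + kinv q M j (move m i (Suc i) (move m (Suc j) j v))"
    using m q_nonzero
    by (simp add: ins lin_simps kop_lower kop_kinv kop_move_down raise_kinv[OF insert.hyps(1)] cartan_commute[of i j]
        move_lower kinv_move[OF m, symmetric] move_raise[symmetric] power_int_minus)
  also have "\<dots> = lower q (insert m M) j (raise q (insert m M) i v) +
      (if i = j then (1 / (q - inverse q)) \<cdot> (kop q M i (kop q {m} i v) - kinv q M i (kop q {m} i v)) else 0) + kinv q M j x"
    using m by (simp add: ins lin_simps insert.IH move_raise x_def linear_diff'[OF clin_kinv])
  also have "\<dots> = lower q (insert m M) j (raise q (insert m M) i v) +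
    (if i = j then (1 / (q - inverse q)) \<cdot> (kop q (insert m M) i v - kinv q (insert m M) i v) else 0)"
    using kop_insert[OF q_nonzero insert.hyps(1) m]
    by (simp add: x lin_simps linear_diff'[OF clin_kinv] cvec.scale_right_diff_distrib)
  finally show ?case .
qed

lemma raise_far_commute:
  assumes "finite M" "Suc i < j"
  shows "raise q M i (raise q M j v) = raise q M j (raise q M i v)"
  using assms(1)
proof (induction M arbitrary: v rule: finite_linorder_max_induct)
  case empty
  then show ?case by (simp add: raise_def)
next
  case (insert m M)
  have m: "m \<notin> M" using insert.hyps by auto
  have c: "cartan i j = 0" "cartan j i = 0" using assms(2) by (auto simp: cartan_def)
  show ?case
    using m q_nonzero
    by (simp add: raise_insert[OF q_nonzero insert.hyps] lin_simps kop_raise kop_move_up c move_raise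
        insert.IH kop_kop[of q "{m}" i "{m}" j] move_far_commute[OF assms(2)] add_ac)
qed

lemma lower_kinv_far:
  assumes "finite M" "cartan i j = 0"
  shows "lower q M j (kinv q M i v) = kinv q M i (lower q M j v)"
  unfolding lower_def linear_sum'[OF clin_kinv]
proof (intro sum.cong refl)
  fix m assume m: "m \<in> M"
  have "kinv q M i (move m (Suc j) j v) = 1 \<cdot> move m (Suc j) j (kinv q M i v)"
    by (rule ket_eqI2[OF clin_kinv clin_move clin_move clin_kinv])
      (simp add: move_ket kinv_ket lin_simps imbalance_move[OF assms(1) m] assms(2))
  then have "move m (Suc j) j (kinv q M i v) = kinv q M i (move m (Suc j) j v)" by simp
  then show "kinv q {j \<in> M. j < m} j (move m (Suc j) j (kinv q M i v)) = kinv q M i (kinv q {j \<in> M. j < m} j (move m (Suc j) j v))"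
    by (simp only:) (rule kinv_kinv)
qed

lemma lower_far_commute:
  assumes "finite M" "Suc i < j"
  shows "lower q M i (lower q M j v) = lower q M j (lower q M i v)"
  using assms(1)
proof (induction M arbitrary: v rule: finite_linorder_max_induct)
  case empty
  then show ?case by (simp add: lower_def)
next
  case (insert m M)
  have m: "m \<notin> M" using insert.hyps by auto
  have c: "cartan i j = 0" "cartan j i = 0" using assms(2) by (auto simp: cartan_def)
  show ?case
    using m by (simp add: lower_insert[OF insert.hyps] lin_simps lower_kinv_far[OF insert.hyps(1)] c move_lower kinv_move[symmetric]
        insert.IH kinv_kinv[of q M i M j] move_far_commute(2)[OF assms(2)] add_ac)
qed

text \<open>After inserting the largest mode \<open>m\<close>, the terms with two equal hops of \<open>m\<close> vanish by \<open>move_twice\<close> and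
  \<open>move_sandwich\<close>, the terms without hops of \<open>m\<close> satisfy the induction hypothesis, and the others cancel after moving
  the powers of \<open>q\<close> to the front.\<close>

lemma raise_serre:
  assumes "finite M" and ij: "j = Suc i \<or> i = Suc j"
  shows "raise q M i (raise q M i (raise q M j v)) + raise q M j (raise q M i (raise q M i v)) =
    (q + inverse q) \<cdot> raise q M i (raise q M j (raise q M i v))"
  using assms(1)
proof (induction M arbitrary: v rule: finite_linorder_max_induct)
  case empty
  then show ?case by (simp add: raise_def)
next
  case (insert m M)
  have m: "m \<notin> M" using insert.hyps by auto
  have c: "cartan i j = - 1" "cartan j i = - 1" "cartan i i = 2" using ij by (auto simp: cartan_def)
  define w where "w = kop q {m} i (kop q {m} i (kop q {m} j v))"
  have IH: "Poly_Mapping.lookup (raise q M i (raise q M i (raise q M j w))) b =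
      (q + inverse q) * Poly_Mapping.lookup (raise q M i (raise q M j (raise q M i w))) b -
      Poly_Mapping.lookup (raise q M j (raise q M i (raise q M i w))) b" for b
    using arg_cong[OF insert.IH[of w], of "\<lambda>x. Poly_Mapping.lookup x b"] by (simp add: lookup_add eq_diff_eq)
  have ij': "kop q {m} j (kop q {m} i x) = kop q {m} i (kop q {m} j x)" for x
    by (rule kop_kop)
  show ?case
    apply (rule poly_mapping_eqI)
    using m q_nonzero
    apply (simp add: raise_insert[OF q_nonzero insert.hyps] lin_simps kop_raise kop_move_up c move_raise
        ij' move_twice move_sandwich[OF ij] lookup_add IH[unfolded w_def] power_int_minus)
    apply (simp add: field_simps power2_eq_square)
    done
qed

end

section \<open>Particle numbers\<close>

lemma subspace_strand_grade: "cvec.subspace (strand_grade M i n)"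
  unfolding cvec.subspace_def strand_grade_def by (auto simp: in_keys_iff lookup_add)

lemma ket_strand_grade: "ket c \<in> strand_grade M i n \<longleftrightarrow> card {m \<in> M. i \<in> c m} = n"
  by (simp add: strand_grade_def ket_def)

lemma clin_strand_grade:
  assumes "clin f" "v \<in> strand_grade M i n" "cvec.subspace S"
    and "\<And>c. card {m \<in> M. i \<in> c m} = n \<Longrightarrow> f (ket c) \<in> S"
  shows "f v \<in> S"
  unfolding lin_expand[OF assms(1), of v]
  using assms(2) by (intro cvec.subspace_sum[OF assms(3)] cvec.subspace_scale[OF assms(3)] assms(4))
    (simp add: strand_grade_def)

lemma kop_strand_grade: "v \<in> strand_grade M i n \<Longrightarrow> kop q J j v \<in> strand_grade M i n"
  and kinv_strand_grade: "v \<in> strand_grade M i n \<Longrightarrow> kinv q J j v \<in> strand_grade M i n"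
  by (auto simp: strand_grade_def kop_def kinv_def in_keys_iff)

lemma card_move:
  assumes "finite M" "m \<in> M" "b \<in> c m" "a \<notin> c m"
  defines "c' \<equiv> c(m := insert a (c m - {b}))"
  shows "card {x \<in> M. a \<in> c' x} = Suc (card {x \<in> M. a \<in> c x})"
    and "Suc (card {x \<in> M. b \<in> c' x}) = card {x \<in> M. b \<in> c x}"
    and "j \<noteq> a \<Longrightarrow> j \<noteq> b \<Longrightarrow> card {x \<in> M. j \<in> c' x} = card {x \<in> M. j \<in> c x}"
proof -
  have ab: "a \<noteq> b" using assms by auto
  have "{x \<in> M. a \<in> c' x} = insert m {x \<in> M. a \<in> c x}" "m \<notin> {x \<in> M. a \<in> c x}"
    using assms by auto
  then show "card {x \<in> M. a \<in> c' x} = Suc (card {x \<in> M. a \<in> c x})"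
    using assms(1) by simp
  have "{x \<in> M. b \<in> c x} = insert m {x \<in> M. b \<in> c' x}" "m \<notin> {x \<in> M. b \<in> c' x}"
    using assms ab by (auto split: if_splits)
  then show "Suc (card {x \<in> M. b \<in> c' x}) = card {x \<in> M. b \<in> c x}"
    using assms(1) by simp
  show "card {x \<in> M. j \<in> c' x} = card {x \<in> M. j \<in> c x}" if "j \<noteq> a" "j \<noteq> b"
    by (rule arg_cong[where f = card]) (use that in \<open>auto simp: c'_def split: if_splits\<close>)
qed

lemma move_strand_grade:
  assumes "finite M" "m \<in> M"
  shows "v \<in> strand_grade M a n \<Longrightarrow> move m a b v \<in> strand_grade M a (Suc n)"
    and "v \<in> strand_grade M b (Suc n) \<Longrightarrow> move m a b v \<in> strand_grade M b n"
    and "v \<in> strand_grade M b 0 \<Longrightarrow> move m a b v = 0"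
    and "v \<in> strand_grade M j n \<Longrightarrow> j \<noteq> a \<Longrightarrow> j \<noteq> b \<Longrightarrow> move m a b v \<in> strand_grade M j n"
proof -
  note sub = subspace_strand_grade cvec.subspace_0[OF subspace_strand_grade]
  show "v \<in> strand_grade M a n \<Longrightarrow> move m a b v \<in> strand_grade M a (Suc n)"
    by (erule clin_strand_grade[OF clin_move _ sub(1)])
      (simp add: move_ket sub ket_strand_grade card_move(1)[OF assms] del: fun_upd_apply)
  have down: "move m a b (ket c) \<in> strand_grade M b n" if c: "card {m \<in> M. b \<in> c m} = Suc n" for c
  proof (cases "b \<in> c m \<and> a \<notin> c m")
    case True
    then have "Suc (card {x \<in> M. b \<in> (c(m := insert a (c m - {b}))) x}) = Suc n"
      using card_move(2)[OF assms, of b c a] c by (simp del: fun_upd_apply)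
    with True show ?thesis by (simp add: move_ket ket_strand_grade del: fun_upd_apply)
  next
    case False
    then show ?thesis unfolding move_ket if_not_P[OF False] by (intro sub(2))
  qed
  show "v \<in> strand_grade M b (Suc n) \<Longrightarrow> move m a b v \<in> strand_grade M b n"
    by (erule clin_strand_grade[OF clin_move _ sub(1)]) (rule down)
  have "move m a b v \<in> {0}" if "v \<in> strand_grade M b 0"
    using that
  proof (rule clin_strand_grade[OF clin_move])
    show "cvec.subspace {0}" by (rule cvec.subspace_single_0)
    fix c :: config assume "card {m \<in> M. b \<in> c m} = 0"
    then have "b \<notin> c m" using assms by (auto simp: card_eq_0_iff)
    then show "move m a b (ket c) \<in> {0}" by (simp add: move_ket)
  qed
  then show "v \<in> strand_grade M b 0 \<Longrightarrow> move m a b v = 0" by simp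
  show "v \<in> strand_grade M j n \<Longrightarrow> j \<noteq> a \<Longrightarrow> j \<noteq> b \<Longrightarrow> move m a b v \<in> strand_grade M j n"
    by (erule clin_strand_grade[OF clin_move _ sub(1)])
      (simp add: move_ket sub ket_strand_grade card_move(3)[OF assms] del: fun_upd_apply)
qed

lemma imbalance_card: "finite M \<Longrightarrow>
    imbalance M i c = int (card {m \<in> M. i \<in> c m}) - int (card {m \<in> M. Suc i \<in> c m})"
  by (simp add: imbalance_def sum_subtractf Int_def)

lemma kop_eigenvector:
  assumes "finite M" "v \<in> strand_grade M i a" "v \<in> strand_grade M (Suc i) b"
  shows "kop q M i v = (q powi (int a - int b)) \<cdot> v" "kinv q M i v = (q powi (- (int a - int b))) \<cdot> v"
proof -
  have "imbalance M i c = int a - int b" if "Poly_Mapping.lookup v c \<noteq> 0" for c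
    using assms that by (auto simp: imbalance_card strand_grade_def in_keys_iff)
  then have e: "q powi imbalance M i c * Poly_Mapping.lookup v c = q powi (int a - int b) * Poly_Mapping.lookup v c"
    "q powi (- imbalance M i c) * Poly_Mapping.lookup v c = q powi (- (int a - int b)) * Poly_Mapping.lookup v c" for c
    by (metis mult_zero_right)+
  show "kop q M i v = (q powi (int a - int b)) \<cdot> v"
    by (rule poly_mapping_eqI) (simp only: kop_def lookup_diagop lookup_cscale e)
  show "kinv q M i v = (q powi (- (int a - int b))) \<cdot> v"
    by (rule poly_mapping_eqI) (simp only: kinv_def lookup_diagop lookup_cscale e)
qed

definition relabel :: "(nat \<Rightarrow> nat) \<Rightarrow> (config \<Rightarrow>\<^sub>0 complex) \<Rightarrow> (config \<Rightarrow>\<^sub>0 complex)" where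
  "relabel r = linext (\<lambda>c. ket (\<lambda>m. r ` c m))"

lemma clin_relabel [simp]: "clin (relabel r)"
  by (simp add: relabel_def)

lemma relabel_ket: "relabel r (ket c) = ket (\<lambda>m. r ` c m)"
  by (simp add: relabel_def)

lemma inj_relabel:
  assumes "inj r"
  shows "inj (relabel r)"
proof (rule inj_on_inverseI)
  fix v
  have "relabel (inv r) (relabel r v) = v"
    by (rule lin_eqI[OF linear_comp'[OF clin_relabel clin_relabel], where g = "\<lambda>v. v", simplified])
      (auto intro!: clinI simp: relabel_ket image_image inv_f_f[OF assms])
  then show "relabel (inv r) (relabel r v) = v" .
qed

lemma relabel_move:
  assumes "inj r" "r i = i" "r j = j"
  shows "relabel r (move m i j v) = move m i j (relabel r v)"
proof (rule ket_eqI2'[OF clin_relabel clin_move clin_move clin_relabel])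
  fix c :: config
  have mem: "i \<in> r ` S \<longleftrightarrow> i \<in> S" "j \<in> r ` S \<longleftrightarrow> j \<in> S" for S
    using assms inj_image_mem_iff by metis+
  have "r ` insert i (c m - {j}) = insert i (r ` c m - {j})"
    using assms by (simp add: image_set_diff)
  then have "r ` (c(m := insert i (c m - {j}))) x = ((\<lambda>x. r ` c x)(m := insert i (r ` c m - {j}))) x" for x
    by (cases "x = m") simp_all
  then have "(\<lambda>x. r ` (c(m := insert i (c m - {j}))) x) = (\<lambda>x. r ` c x)(m := insert i (r ` c m - {j}))"
    by (rule ext)
  then show "relabel r (move m i j (ket c)) = move m i j (relabel r (ket c))"
    by (simp add: move_ket relabel_ket mem linear_0'[OF clin_relabel] del: fun_upd_apply)
qed

lemma relabel_kop:
  assumes "inj r" "r i = i" "r (Suc i) = Suc i"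
  shows "relabel r (kop q J i v) = kop q J i (relabel r v)"
    and "relabel r (kinv q J i v) = kinv q J i (relabel r v)"
proof -
  have "i \<in> r ` S \<longleftrightarrow> i \<in> S" "Suc i \<in> r ` S \<longleftrightarrow> Suc i \<in> S" for S
    using assms inj_image_mem_iff by metis+
  then have "imbalance J i (\<lambda>m. r ` c m) = imbalance J i c" for c
    by (simp add: imbalance_def)
  note imb = this
  show "relabel r (kop q J i v) = kop q J i (relabel r v)"
    by (rule ket_eqI2'[OF clin_relabel clin_kop clin_kop clin_relabel])
      (simp add: kop_ket relabel_ket imb linear_scale'[OF clin_relabel])
  show "relabel r (kinv q J i v) = kinv q J i (relabel r v)"
    by (rule ket_eqI2'[OF clin_relabel clin_kinv clin_kinv clin_relabel])
      (simp add: kinv_ket relabel_ket imb linear_scale'[OF clin_relabel])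
qed

lemma relabel_raise:
  assumes "inj r" "r i = i" "r (Suc i) = Suc i"
  shows "relabel r (raise q M i v) = raise q M i (relabel r v)"
    and "relabel r (lower q M i v) = lower q M i (relabel r v)"
  by (simp_all add: raise_def lower_def linear_sum'[OF clin_relabel] relabel_kop[OF assms]
      relabel_move[OF assms(1,2,3)] relabel_move[OF assms(1,3,2)])

context generic_q begin

lemma strands_config:
  assumes M: "finite M"
  shows "strands q (raise q M) (lower q M) (strand_grade M)"
proof
  note sum = cvec.subspace_sum[OF subspace_strand_grade]
  fix v i j n
  show "v \<in> strand_grade M i n \<Longrightarrow> raise q M i v \<in> strand_grade M i (Suc n)"
    "v \<in> strand_grade M (Suc i) (Suc n) \<Longrightarrow> raise q M i v \<in> strand_grade M (Suc i) n"
    "v \<in> strand_grade M j n \<Longrightarrow> j \<noteq> i \<Longrightarrow> j \<noteq> Suc i \<Longrightarrow> raise q M i v \<in> strand_grade M j n"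
    unfolding raise_def by (intro sum move_strand_grade[OF M] kop_strand_grade; assumption)+
  show "v \<in> strand_grade M (Suc i) 0 \<Longrightarrow> raise q M i v = 0"
    unfolding raise_def by (intro sum.neutral ballI move_strand_grade(3)[OF M] kop_strand_grade)
  show "v \<in> strand_grade M (Suc i) n \<Longrightarrow> lower q M i v \<in> strand_grade M (Suc i) (Suc n)"
    "v \<in> strand_grade M i (Suc n) \<Longrightarrow> lower q M i v \<in> strand_grade M i n"
    "v \<in> strand_grade M j n \<Longrightarrow> j \<noteq> i \<Longrightarrow> j \<noteq> Suc i \<Longrightarrow> lower q M i v \<in> strand_grade M j n"
    unfolding lower_def by (intro sum move_strand_grade[OF M] kinv_strand_grade; assumption)+
  show "v \<in> strand_grade M i 0 \<Longrightarrow> lower q M i v = 0"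
    unfolding lower_def by (intro sum.neutral ballI) (simp add: move_strand_grade(3)[OF M] lin_simps)
  show "raise q M i (lower q M i v) = lower q M i (raise q M i v) + qnum q (int a - int b) \<cdot> v"
    if "v \<in> strand_grade M i a" "v \<in> strand_grade M (Suc i) b" for a b
  proof -
    have "(1 / (q - inverse q)) \<cdot> (kop q M i v - kinv q M i v) = qnum q (int a - int b) \<cdot> v"
      unfolding kop_eigenvector[OF M that] cvec.scale_left_diff_distrib[symmetric] cvec.scale_scale
      by (simp add: qnum_def)
    then show ?thesis using raise_lower[OF M, of i i v] by simp
  qed
  show "i \<noteq> j \<Longrightarrow> raise q M i (lower q M j v) = lower q M j (raise q M i v)"
    using raise_lower[OF M, of i j v] by simp
  show "Suc i < j \<Longrightarrow> raise q M i (raise q M j v) = raise q M j (raise q M i v)"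
    by (rule raise_far_commute[OF M])
  show "Suc i < j \<Longrightarrow> lower q M i (lower q M j v) = lower q M j (lower q M i v)"
    by (rule lower_far_commute[OF M])
  show "j = Suc i \<or> i = Suc j \<Longrightarrow> raise q M i (raise q M i (raise q M j v)) +
      raise q M j (raise q M i (raise q M i v)) = (q + inverse q) \<cdot> raise q M i (raise q M j (raise q M i v))"
    by (rule raise_serre[OF M])
qed (simp_all add: subspace_strand_grade lin_simps)

text \<open>The strands from \<open>p\<close> on are renumbered.\<close>

lemma empty_strand_insertion:
  "\<exists>\<sigma>. clin \<sigma> \<and> inj \<sigma> \<and> (\<forall>v. \<sigma> v \<in> strand_grade M p 0) \<and>
      (\<forall>i n v. i < p \<longrightarrow> v \<in> strand_grade M i n \<longrightarrow> \<sigma> v \<in> strand_grade M i n) \<and>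
      (\<forall>i v. Suc i < p \<longrightarrow> \<sigma> (raise q M i v) = raise q M i (\<sigma> v) \<and> \<sigma> (lower q M i v) = lower q M i (\<sigma> v))"
proof -
  define r where "r j = (if j < p then j else Suc j)" for j
  have r: "inj r" by (rule injI) (auto simp: r_def split: if_splits)
  have "relabel r v \<in> strand_grade M p 0" for v
  proof -
    have "p \<notin> r ` S" for S by (auto simp: r_def split: if_splits)
    then show ?thesis
      unfolding lin_expand[OF clin_relabel, of r v] relabel_ket
      by (intro cvec.subspace_sum[OF subspace_strand_grade] cvec.subspace_scale[OF subspace_strand_grade])
        (simp add: ket_strand_grade)
  qed
  moreover have "relabel r v \<in> strand_grade M i n" if "i < p" "v \<in> strand_grade M i n" for i n v
    using clin_relabel that(2) subspace_strand_grade
  proof (rule clin_strand_grade)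
    fix c :: config assume "card {m \<in> M. i \<in> c m} = n"
    moreover have "i \<in> r ` S \<longleftrightarrow> i \<in> S" for S using that(1) by (auto simp: r_def split: if_splits)
    ultimately show "relabel r (ket c) \<in> strand_grade M i n"
      by (simp add: relabel_ket ket_strand_grade)
  qed
  moreover have "relabel r (raise q M i v) = raise q M i (relabel r v)"
    "relabel r (lower q M i v) = lower q M i (relabel r v)" if "Suc i < p" for i v
    by (rule relabel_raise[OF r]; use that in \<open>simp add: r_def\<close>)+
  ultimately show ?thesis
    using clin_relabel[of r] inj_relabel[OF r] by blast
qed

end

section \<open>The operators on the Fock space in the Dirac sea picture\<close>

text \<open>In the vacuum the modes \<open>i \<ge> 0\<close> are occupied, so that an excitation of such a mode is a hole.  Then \<open>b\<^sub>i\<close> fills mode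
  \<open>i\<close> and \<open>c\<^sub>-\<^sub>i\<close> empties it, for every \<open>i\<close>.\<close>

definition occ :: "state \<Rightarrow> int set" where
  "occ s = {i. (i \<in> excited s) = (i < 0)}"

definition toggle :: "int \<Rightarrow> state \<Rightarrow> state" where
  "toggle i s = State (if i \<in> excited s then excited s - {i} else insert i (excited s))"

lemma excited_toggle: "excited (toggle i s) = (if i \<in> excited s then excited s - {i} else insert i (excited s))"
  by (simp add: toggle_def)

lemma occ_toggle: "j \<in> occ (toggle i s) \<longleftrightarrow> (j \<in> occ s) \<noteq> (j = i)"
  by (auto simp: occ_def excited_toggle)

lemma bop_ket: "bop i (ket s) = (if i \<in> occ s then 0 else jw i s \<cdot> ket (toggle i s))"
  by (simp add: bop_def occ_def create_def annihilate_def toggle_def)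

lemma cop_ket: "cop (hneg i) (ket s) = (if i \<in> occ s then jw i s \<cdot> ket (toggle i s) else 0)"
  by (simp add: cop_def hneg_def occ_def create_def annihilate_def toggle_def)

lemma jw_nonzero [simp]: "jw i s \<noteq> 0"
  by (simp add: jw_def)

lemma scaled_ket_grade: "c \<cdot> ket a \<in> grade k \<Longrightarrow> c \<noteq> 0 \<Longrightarrow> deg a = k"
proof -
  assume "c \<cdot> ket a \<in> grade k" "c \<noteq> 0"
  moreover have "c \<noteq> 0 \<Longrightarrow> a \<in> Poly_Mapping.keys (c \<cdot> ket a)"
    by (simp add: in_keys_iff ket_def)
  ultimately show "deg a = k" by (simp add: grade_def)
qed

lemma deg_toggle: "deg (toggle i s) = (if i \<in> occ s then deg s - 1 else deg s + 1)"
proof (cases "i \<in> occ s")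
  case True
  have "jw i s \<cdot> ket (toggle i s) \<in> grade (deg s - 1)"
    using cop_grade[OF ket_grade[OF refl, of s], where n = "hneg i"] True by (simp add: cop_ket)
  from scaled_ket_grade[OF this] True show ?thesis by simp
next
  case False
  have "jw i s \<cdot> ket (toggle i s) \<in> grade (deg s + 1)"
    using bop_grade[OF ket_grade[OF refl, of s], where n = i] False by (simp add: bop_ket)
  from scaled_ket_grade[OF this] False show ?thesis by simp
qed

text \<open>The Jordan-Wigner signs in both factors, and the sign from moving an odd operator past the first factor.\<close>

definition hop_sign :: "int \<Rightarrow> state \<Rightarrow> state \<Rightarrow> complex" where
  "hop_sign i s t = (- 1) powi deg s * jw i s * jw i t"

lemma minus_one_powi_minus: "(- 1 :: complex) powi (- k) = (- 1) powi k"
  by (simp add: power_int_minus flip: power_int_inverse)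

lemma stensor_bc_ket: "stensor (bop i) (cop (hneg i)) (ket (s, t)) =
    (if i \<in> occ t \<and> i \<notin> occ s then hop_sign i s t \<cdot> ket (toggle i s, toggle i t) else 0)"
  by (simp add: stensor_def bop_ket cop_ket deg_toggle hop_sign_def tens_simps linear_scale'[OF clin_linext]
      linear_0'[OF clin_linext] linear_0'[OF clin_tens_left] linear_0'[OF clin_tens_right] minus_one_powi_minus mult_ac)

lemma stensor_cb_ket: "stensor (cop (hneg i)) (bop i) (ket (s, t)) =
    (if i \<in> occ s \<and> i \<notin> occ t then hop_sign i s t \<cdot> ket (toggle i s, toggle i t) else 0)"
  by (simp add: stensor_def bop_ket cop_ket deg_toggle hop_sign_def tens_simps linear_scale'[OF clin_linext]
      linear_0'[OF clin_linext] linear_0'[OF clin_tens_left] linear_0'[OF clin_tens_right] mult_ac)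

text \<open>The exponent of \<open>q\<close> in \<open>\<Prod>\<^sub>j K\<^sub>j\<close> over \<open>j \<in> J\<close>.  The sum is restricted to the finitely many modes that differ, as
  \<open>J\<close> may be infinite.\<close>

definition occ_diff :: "int set \<Rightarrow> state \<times> state \<Rightarrow> int" where
  "occ_diff J p = (\<Sum>j\<in>{j \<in> J. j \<in> occ (fst p) \<longleftrightarrow> j \<notin> occ (snd p)}. of_bool (j \<in> occ (fst p)) - of_bool (j \<in> occ (snd p)))"

lemma finite_occ_differ: "finite {j. (j \<in> occ s) \<longleftrightarrow> j \<notin> occ t}"
  by (rule finite_subset[of _ "excited s \<union> excited t"]) (auto simp: occ_def)

lemma occ_diff_superset:
  assumes "finite A" "A \<subseteq> J" "\<And>j. j \<in> J - A \<Longrightarrow> j \<in> occ s \<longleftrightarrow> j \<in> occ t"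
  shows "occ_diff J (s, t) = (\<Sum>j\<in>A. of_bool (j \<in> occ s) - of_bool (j \<in> occ t))"
  unfolding occ_diff_def fst_conv snd_conv
  using assms by (intro sum.mono_neutral_left) auto

lemma nval_diff: "nval j s - nval j t = of_bool (j \<in> occ s) - of_bool (j \<in> occ t)"
  by (simp add: nval_def occ_def)

context generic_q begin

lemma fold_diagop:
  assumes "finite S"
  shows "Finite_Set.fold (\<lambda>j. diagop q (e j)) x S = diagop q (\<lambda>a. \<Sum>j\<in>S. e j a) x"
proof -
  interpret comp_fun_commute "\<lambda>j. diagop q (e j)"
    by unfold_locales (simp add: fun_eq_iff diagop_commute)
  show ?thesis
    using assms by induction (simp_all add: diagop_zero diagop_diagop[OF q_nonzero])
qed

text \<open>The factors omitted from \<^const>\<open>opprod\<close> depend on \<open>x\<close>, but they act as the identity on all basis vectors that occur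
  in \<open>x\<close>, as \<open>q\<close> is not a root of unity.\<close>

lemma opprod_diagop:
  assumes "finite {j \<in> J. diagop q (e j) x \<noteq> x}"
    and "\<And>a. finite {j \<in> J. e j a \<noteq> 0}"
  shows "opprod (\<lambda>j. diagop q (e j)) J x = diagop q (\<lambda>a. \<Sum>j\<in>{j \<in> J. e j a \<noteq> 0}. e j a) x"
proof (rule poly_mapping_eqI)
  fix a
  let ?D = "{j \<in> J. diagop q (e j) x \<noteq> x}"
  have "(\<Sum>j\<in>?D. e j a) = (\<Sum>j\<in>{j \<in> J. e j a \<noteq> 0}. e j a)" if a: "Poly_Mapping.lookup x a \<noteq> 0"
  proof (rule sum.mono_neutral_cong)
    fix j assume "j \<in> {j \<in> J. e j a \<noteq> 0} - ?D"
    then have "q powi e j a * Poly_Mapping.lookup x a = Poly_Mapping.lookup x a" "e j a \<noteq> 0"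
      using lookup_diagop[of q "e j" x a] by auto
    then show "e j a = 0" using a powi_neq_1 by simp
  qed (use assms in auto)
  then show "Poly_Mapping.lookup (opprod (\<lambda>j. diagop q (e j)) J x) a =
      Poly_Mapping.lookup (diagop q (\<lambda>a. \<Sum>j\<in>{j \<in> J. e j a \<noteq> 0}. e j a) x) a"
    unfolding opprod_def fold_diagop[OF assms(1)] by (cases "Poly_Mapping.lookup x a = 0") simp_all
qed

lemma opprod_Ktil: "opprod (Ktil q) J x = diagop q (occ_diff J) x"
proof -
  define e where "e j = (\<lambda>(s, t). nval j s - nval j t)" for j
  have K: "Ktil q = (\<lambda>j. diagop q (e j))"
    by (rule ext) (simp add: Ktil_eq[OF q_nonzero] e_def)
  have e: "e j p = of_bool (j \<in> occ (fst p)) - of_bool (j \<in> occ (snd p))" for j p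
    by (cases p) (simp add: e_def nval_diff)
  have "finite {j \<in> J. e j p \<noteq> 0}" for p
    by (rule finite_subset[OF _ finite_occ_differ[of "fst p" "snd p"]]) (auto simp: e)
  moreover have "finite {j \<in> J. diagop q (e j) x \<noteq> x}"
    using finite_Ktil(1)[OF q_nonzero, of x] unfolding K by (rule rev_finite_subset) auto
  ultimately have "opprod (Ktil q) J x = diagop q (\<lambda>p. \<Sum>j\<in>{j \<in> J. e j p \<noteq> 0}. e j p) x"
    unfolding K by (intro opprod_diagop)
  moreover have "(\<Sum>j\<in>{j \<in> J. e j p \<noteq> 0}. e j p) = occ_diff J p" for p
    unfolding occ_diff_def by (rule sum.cong) (auto simp: e)
  ultimately show ?thesis by simp
qed

lemma opprod_Ktil_inv: "opprod (\<lambda>j. inv (Ktil q j)) J x = diagop q (\<lambda>p. - occ_diff J p) x"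
proof -
  define e where "e j = (\<lambda>p. - (case p of (s, t) \<Rightarrow> nval j s - nval j t))" for j
  have K: "(\<lambda>j. inv (Ktil q j)) = (\<lambda>j. diagop q (e j))"
    by (rule ext) (simp add: Ktil_eq[OF q_nonzero] bij_diagop[OF q_nonzero] e_def)
  have e: "e j p = - (of_bool (j \<in> occ (fst p)) - of_bool (j \<in> occ (snd p)))" for j p
    by (cases p) (simp add: e_def nval_diff)
  have "finite {j \<in> J. e j p \<noteq> 0}" for p
    by (rule finite_subset[OF _ finite_occ_differ[of "fst p" "snd p"]]) (auto simp: e)
  moreover have "finite {j \<in> J. diagop q (e j) x \<noteq> x}"
    using finite_Ktil(2)[OF q_nonzero, of x] unfolding fun_cong[OF K] by (rule rev_finite_subset) auto
  ultimately have "opprod (\<lambda>j. inv (Ktil q j)) J x = diagop q (\<lambda>p. \<Sum>j\<in>{j \<in> J. e j p \<noteq> 0}. e j p) x"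
    unfolding K by (intro opprod_diagop)
  moreover have "(\<Sum>j\<in>{j \<in> J. e j p \<noteq> 0}. e j p) = - occ_diff J p" for p
    unfolding occ_diff_def sum_negf[symmetric] by (rule sum.cong) (auto simp: e)
  ultimately show ?thesis by simp
qed

lemma Eterm_eq: "Eterm q i x = stensor (bop i) (cop (hneg i)) (diagop q (occ_diff {j. i < j}) x)"
  by (simp add: Eterm_def opprod_Ktil)

lemma Fterm_eq: "Fterm q i x = diagop q (\<lambda>p. - occ_diff {j. j < i} p) (stensor (cop (hneg i)) (bop i) x)"
  by (simp add: Fterm_def opprod_Ktil_inv)

lemma clin_Eterm: "clin (Eterm q i)" and clin_Fterm: "clin (Fterm q i)"
  using linear_comp'[OF clin_diagop clin_stensor] linear_comp'[OF clin_stensor clin_diagop]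
  by (simp_all add: Eterm_eq[abs_def] Fterm_eq[abs_def])

lemma clin_Sum_any:
  assumes "\<And>i. clin (T i)" "\<And>x. finite {i. T i x \<noteq> 0}"
  shows "clin (\<lambda>x. Sum_any (\<lambda>i. T i x))"
proof (rule clinI)
  fix x y c
  show "Sum_any (\<lambda>i. T i (x + y)) = Sum_any (\<lambda>i. T i x) + Sum_any (\<lambda>i. T i y)"
    using Sum_any.distrib[OF assms(2) assms(2), of x y] by (simp add: linear_add'[OF assms(1)])
  have "Sum_any (\<lambda>i. T i (c \<cdot> x)) = (\<Sum>i\<in>{i. T i x \<noteq> 0}. T i (c \<cdot> x))"
    using assms(2)[of x] by (intro Sum_any.expand_superset) (auto simp: linear_scale'[OF assms(1)])
  then show "Sum_any (\<lambda>i. T i (c \<cdot> x)) = c \<cdot> Sum_any (\<lambda>i. T i x)"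
    by (simp add: Sum_any.expand_set linear_scale'[OF assms(1)] cscale_sum)
qed

lemma clin_Eop: "clin (Eop q)"
  using clin_Sum_any[OF clin_Eterm finite_Eterm[OF q_nonzero]] by (simp add: Eop_def[abs_def])

lemma clin_Fop: "clin (Fop q)"
  using linear_comp'[OF clin_Sum_any[OF clin_Fterm finite_Fterm[OF q_nonzero]] cvec.linear_uminus]
  by (simp add: Fop_def[abs_def])

text \<open>Any finite set \<open>A\<close> of modes that contains the possible hops will do, so that one \<open>A\<close> serves for all vectors in a
  window.\<close>

lemma Eop_ket:
  assumes "finite A" "occ t - occ s \<subseteq> A"
  shows "Eop q (ket (s, t)) = (\<Sum>i\<in>A. if i \<in> occ t \<and> i \<notin> occ s
    then (q powi occ_diff {j. i < j} (s, t) * hop_sign i s t) \<cdot> ket (toggle i s, toggle i t) else 0)"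
proof -
  have *: "Eterm q i (ket (s, t)) = (if i \<in> occ t \<and> i \<notin> occ s
    then (q powi occ_diff {j. i < j} (s, t) * hop_sign i s t) \<cdot> ket (toggle i s, toggle i t) else 0)" for i
    by (simp add: Eterm_eq stensor_bc_ket linear_scale'[OF clin_stensor])
  show ?thesis
    unfolding Eop_def * using assms by (intro Sum_any.expand_superset) (auto split: if_splits)
qed

lemma Fop_ket:
  assumes "finite A" "occ s - occ t \<subseteq> A"
  shows "Fop q (ket (s, t)) = (\<Sum>i\<in>A. if i \<in> occ s \<and> i \<notin> occ t
    then (q powi (- occ_diff {j. j < i} (s, t)) * - hop_sign i s t) \<cdot> ket (toggle i s, toggle i t) else 0)"
proof -
  have d: "occ_diff {j. j < i} (toggle i s, toggle i t) = occ_diff {j. j < i} (s, t)" for i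
    unfolding occ_diff_def by (rule sum.cong) (auto simp: occ_toggle)
  have *: "Fterm q i (ket (s, t)) = (if i \<in> occ s \<and> i \<notin> occ t
    then (q powi (- occ_diff {j. j < i} (s, t)) * hop_sign i s t) \<cdot> ket (toggle i s, toggle i t) else 0)" for i
    by (simp add: Fterm_eq stensor_cb_ket linear_scale'[OF clin_diagop] linear_0'[OF clin_diagop] d mult.commute)
  have "Sum_any (\<lambda>i. Fterm q i (ket (s, t))) = (\<Sum>i\<in>A. if i \<in> occ s \<and> i \<notin> occ t
    then (q powi (- occ_diff {j. j < i} (s, t)) * hop_sign i s t) \<cdot> ket (toggle i s, toggle i t) else 0)"
    unfolding * using assms by (intro Sum_any.expand_superset) (auto split: if_splits)
  then show ?thesis
    by (simp add: Fop_def cscale_uminus flip: sum_negf cong: if_cong) (rule sum.cong, simp_all)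
qed

end

section \<open>Removal of the fermionic signs\<close>

lemma jw_toggle: "jw j (toggle i t) = (if i < j then - jw j t else jw j t)"
  using jw_insert[of "excited t" i j] jw_remove[of "excited t" i j] by (simp add: toggle_def)

lemma jw_sq': "jw i s * (jw i s * x) = x"
  by (simp flip: mult.assoc)

text \<open>The parity of the number of pairs \<open>j \<in> excited s\<close>, \<open>k \<in> excited t\<close> with \<open>k < j\<close>.\<close>

definition cross_sign :: "state \<Rightarrow> state \<Rightarrow> complex" where
  "cross_sign s t = (\<Prod>j\<in>excited s. jw j t)"

definition hole_sign :: "state \<Rightarrow> complex" where
  "hole_sign s = (- 1) ^ card {j \<in> excited s. 0 \<le> j}"

definition above_sign :: "int \<Rightarrow> state \<Rightarrow> complex" where
  "above_sign i s = (- 1) ^ card {j \<in> excited s. i < j}"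

lemma prod_toggle:
  fixes f :: "int \<Rightarrow> complex"
  assumes "f i * f i = 1"
  shows "(\<Prod>j\<in>excited (toggle i s). f j) = f i * (\<Prod>j\<in>excited s. f j)"
proof (cases "i \<in> excited s")
  case True
  then have "(\<Prod>j\<in>excited s. f j) = f i * (\<Prod>j\<in>excited s - {i}. f j)" by (intro prod.remove) auto
  then have "f i * (\<Prod>j\<in>excited s. f j) = (f i * f i) * (\<Prod>j\<in>excited s - {i}. f j)" by (simp only: mult.assoc)
  with True assms show ?thesis by (simp add: excited_toggle)
qed (simp add: excited_toggle)

lemma minus_one_card: "finite A \<Longrightarrow> (- 1 :: complex) ^ card {j \<in> A. P j} = (\<Prod>j\<in>A. if P j then - 1 else 1)"
  by (simp add: prod.If_cases Int_def)

lemma cross_sign_toggle_left: "cross_sign (toggle i s) t = jw i t * cross_sign s t"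
  unfolding cross_sign_def by (rule prod_toggle) simp

lemma cross_sign_toggle_right: "cross_sign s (toggle i t) = above_sign i s * cross_sign s t"
  by (simp add: cross_sign_def above_sign_def minus_one_card jw_toggle flip: prod.distrib) (rule prod.cong, simp_all)

lemma hole_sign_toggle: "hole_sign (toggle i s) = (if 0 \<le> i then - hole_sign s else hole_sign s)"
  unfolding hole_sign_def minus_one_card[OF finite_excited] by (subst prod_toggle) simp_all

lemma above_sign_sq: "above_sign i s * above_sign i s = 1"
  by (simp add: above_sign_def flip: power_mult_distrib)

lemma minus_one_powi_deg: "(- 1 :: complex) powi deg s = (- 1) ^ card (excited s)"
proof -
  have "card (excited s) = card {i \<in> excited s. i < 0} + card {i \<in> excited s. 0 \<le> i}"
    by (subst card_Un_disjoint[symmetric]) (auto intro: arg_cong[where f = card])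
  then show ?thesis
    by (simp add: deg_state_def power_int_diff power_add minus_one_power_iff)
qed

lemma above_sign_eq: "above_sign i s = (if i \<in> excited s then - 1 else 1) * ((- 1) powi deg s * jw i s)"
proof -
  have "(\<Prod>j\<in>excited s. if j = i then - 1 else 1 :: complex) = (if i \<in> excited s then - 1 else 1)"
    by (simp add: prod.delta)
  moreover have "(\<Prod>j\<in>excited s. - 1 :: complex) = (- 1) ^ card (excited s)" by simp
  moreover have "(\<Prod>j\<in>excited s. if i < j then - 1 else 1 :: complex) = (\<Prod>j\<in>excited s. if j = i then - 1 else 1) *
      ((\<Prod>j\<in>excited s. - 1) * (\<Prod>j\<in>excited s. if j < i then - 1 else 1))"
    unfolding prod.distrib[symmetric] by (rule prod.cong) auto
  ultimately show ?thesis
    unfolding above_sign_def jw_def minus_one_powi_deg minus_one_card[OF finite_excited] by (simp only:)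
qed

lemma above_sign_toggle: "above_sign i (toggle i s) = above_sign i s"
  unfolding above_sign_def
  by (rule arg_cong[where f = "\<lambda>A. (- 1) ^ card A"]) (auto simp: excited_toggle)

lemma hop_sign_eq: "hop_sign i s t = (if i \<in> excited s then - 1 else 1) * (above_sign i s * jw i t)"
  by (simp add: hop_sign_def above_sign_eq)

lemma hop_sign_sq: "hop_sign i s t * hop_sign i s t = 1"
proof -
  have "hop_sign i s t * hop_sign i s t = (above_sign i s * above_sign i s) * (jw i t * jw i t)"
    by (simp add: hop_sign_eq mult_ac)
  then show ?thesis by (simp add: above_sign_sq)
qed

text \<open>Rescaling the basis vectors by this sign turns the hops of \<open>E\<close> and \<open>F\<close>, together with the sign in front of the sum
  that defines \<open>F\<close>, into hops without sign (\<open>gauge_toggle\<close>).  The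
  cross signs compensate the Jordan-Wigner signs.  For \<open>i \<ge> 0\<close>, where filling a mode removes an excitation, a sign
  remains, which \<open>hole_sign\<close> corrects; it is taken in the first and the third factor, so that a hop between
  neighbours changes just one of the two.\<close>

fun gauge :: "state \<times> state \<times> state \<Rightarrow> complex" where
  "gauge (s, t, u) = cross_sign s t * cross_sign t u * cross_sign s u * (hole_sign s * hole_sign u)"

lemma gauge_toggle:
  assumes "(i \<in> occ s) \<noteq> (i \<in> occ t)"
  shows "gauge (toggle i s, toggle i t, u) = (if i \<in> occ s then - 1 else 1) * (hop_sign i s t * gauge (s, t, u))"
    and "gauge (u, toggle i s, toggle i t) = (if i \<in> occ s then - 1 else 1) * (hop_sign i s t * gauge (u, s, t))"
proof -
  have a: "above_sign i x * (above_sign i x * y) = y" for x y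
    by (simp add: above_sign_sq flip: mult.assoc)
  have o: "i \<in> occ s \<longleftrightarrow> (i \<in> excited s \<longleftrightarrow> i < 0)"
    by (simp add: occ_def)
  have jt: "jw i (toggle i t) = jw i t" by (simp add: jw_toggle)
  show "gauge (toggle i s, toggle i t, u) = (if i \<in> occ s then - 1 else 1) * (hop_sign i s t * gauge (s, t, u))"
    by (cases "i < 0"; cases "i \<in> excited s")
      (simp_all add: cross_sign_toggle_left cross_sign_toggle_right hole_sign_toggle above_sign_toggle hop_sign_eq o jt jw_sq' mult_ac)
  show "gauge (u, toggle i s, toggle i t) = (if i \<in> occ s then - 1 else 1) * (hop_sign i s t * gauge (u, s, t))"
    by (cases "i < 0"; cases "i \<in> excited s")
      (simp_all add: cross_sign_toggle_left cross_sign_toggle_right hole_sign_toggle above_sign_toggle hop_sign_eq o jt a mult_ac)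
qed

lemma gauge_sq: "gauge p * gauge p = 1"
proof (cases p)
  case (fields s t u)
  have c: "cross_sign s t * cross_sign s t = 1" for s t
    by (simp add: cross_sign_def flip: prod.distrib)
  have h: "hole_sign s * hole_sign s = 1" for s
    by (simp add: hole_sign_def flip: power_mult_distrib)
  have "gauge p * gauge p = (cross_sign s t * cross_sign s t) * (cross_sign t u * cross_sign t u) *
      (cross_sign s u * cross_sign s u) * ((hole_sign s * hole_sign s) * (hole_sign u * hole_sign u))"
    by (simp add: fields mult_ac)
  then show ?thesis by (simp only: c h) simp
qed

section \<open>The embedding into configurations\<close>

definition config_of :: "state \<times> state \<times> state \<Rightarrow> config" where
  "config_of = (\<lambda>(s, t, u) m. {j. j = 0 \<and> m \<in> occ s \<or> j = 1 \<and> m \<in> occ t \<or> j = 2 \<and> m \<in> occ u})"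

lemma config_of_mem: "0 \<in> config_of (s, t, u) m \<longleftrightarrow> m \<in> occ s" "Suc 0 \<in> config_of (s, t, u) m \<longleftrightarrow> m \<in> occ t"
    "Suc (Suc 0) \<in> config_of (s, t, u) m \<longleftrightarrow> m \<in> occ u"
  by (simp_all add: config_of_def)

lemma occ_inject: "occ s = occ t \<longleftrightarrow> s = t"
proof
  assume "occ s = occ t"
  then have "j \<in> occ s \<longleftrightarrow> j \<in> occ t" for j by simp
  then have "j \<in> excited s \<longleftrightarrow> j \<in> excited t" for j unfolding occ_def by blast
  then have "excited s = excited t" by blast
  then show "s = t" by (simp only: excited_inject)
qed simp

lemma inj_config_of: "inj config_of"
proof (rule injI)
  fix p p' assume eq: "config_of p = config_of p'"
  obtain s t u where p: "p = (s, t, u)" by (cases p)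
  obtain s' t' u' where p': "p' = (s', t', u')" by (cases p')
  have *: "j \<in> config_of p m \<longleftrightarrow> j \<in> config_of p' m" for j m by (simp only: eq)
  have "occ s = occ s'" using *[of 0] by (intro set_eqI) (simp only: p p' config_of_mem)
  moreover have "occ t = occ t'" using *[of "Suc 0"] by (intro set_eqI) (simp only: p p' config_of_mem)
  moreover have "occ u = occ u'" using *[of "Suc (Suc 0)"] by (intro set_eqI) (simp only: p p' config_of_mem)
  ultimately show "p = p'" by (simp only: p p' occ_inject)
qed

definition to_config :: "(state \<times> state \<times> state \<Rightarrow>\<^sub>0 complex) \<Rightarrow> (config \<Rightarrow>\<^sub>0 complex)" where
  "to_config = linext (\<lambda>p. gauge p \<cdot> ket (config_of p))"

lemma clin_to_config [simp]: "clin to_config"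
  by (simp add: to_config_def)

lemma inj_to_config: "inj to_config"
proof (rule inj_on_inverseI)
  fix v
  define g where "g = linext (\<lambda>c. gauge (inv config_of c) \<cdot> ket (inv config_of c))"
  have g: "g (to_config (ket p)) = ket p" for p
    by (simp add: g_def to_config_def linear_scale'[OF clin_linext] inv_f_f[OF inj_config_of] gauge_sq)
  have "clin g" by (simp add: g_def)
  then have "clin (\<lambda>v. g (to_config v))" by (rule linear_comp'[OF clin_to_config])
  moreover have "clin (\<lambda>v. v :: state \<times> state \<times> state \<Rightarrow>\<^sub>0 complex)" by (rule clinI) simp_all
  ultimately show "g (to_config v) = v" by (rule lin_eqI) (rule g)
qed

definition window :: "nat \<Rightarrow> int set" where
  "window N = {- int N..<int N}"

lemma finite_window [simp]: "finite (window N)"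
  by (simp add: window_def)

definition in_window :: "nat \<Rightarrow> state \<Rightarrow> bool" where
  "in_window N s \<longleftrightarrow> excited s \<subseteq> window N"

lemma in_window_toggle: "in_window N s \<Longrightarrow> i \<in> window N \<Longrightarrow> in_window N (toggle i s)"
  by (auto simp: in_window_def excited_toggle)

lemma occ_outside: "in_window N s \<Longrightarrow> j \<notin> window N \<Longrightarrow> j \<in> occ s \<longleftrightarrow> 0 \<le> j"
  by (auto simp: in_window_def occ_def)

text \<open>In the vacuum \<open>N\<close> modes of the window are occupied, and the degree counts the particles in excess of these.\<close>

lemma card_occ:
  assumes "in_window N s"
  shows "int (card {m \<in> window N. m \<in> occ s}) = deg s + int N"
proof -
  have eq: "{m \<in> window N. m \<in> occ s} = {i \<in> excited s. i < 0} \<union> ({0..<int N} - {i \<in> excited s. 0 \<le> i})"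
    using assms by (auto simp: in_window_def occ_def window_def)
  have sub: "{i \<in> excited s. 0 \<le> i} \<subseteq> {0..<int N}"
    using assms by (auto simp: in_window_def window_def)
  then have le: "card {i \<in> excited s. 0 \<le> i} \<le> N"
    using card_mono[OF _ sub] by simp
  have "card {m \<in> window N. m \<in> occ s} = card {i \<in> excited s. i < 0} + card ({0..<int N} - {i \<in> excited s. 0 \<le> i})"
    unfolding eq by (rule card_Un_disjoint) auto
  also have "card ({0..<int N} - {i \<in> excited s. 0 \<le> i}) = N - card {i \<in> excited s. 0 \<le> i}"
    using sub by (subst card_Diff_subset) auto
  finally show ?thesis using le by (simp add: deg_state_def)
qed

lemma occ_diff_imbalance:
  assumes "in_window N s" "in_window N t"
  shows "occ_diff {j. P j} (s, t) = imbalance {j \<in> window N. P j} 0 (config_of (s, t, u))"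
    and "occ_diff {j. P j} (s, t) = imbalance {j \<in> window N. P j} 1 (config_of (u, s, t))"
proof -
  have "occ_diff {j. P j} (s, t) = (\<Sum>j\<in>{j \<in> window N. P j}. of_bool (j \<in> occ s) - of_bool (j \<in> occ t))"
  proof (rule occ_diff_superset)
    fix j assume "j \<in> {j. P j} - {j \<in> window N. P j}"
    then have "j \<notin> window N" by blast
    then show "j \<in> occ s \<longleftrightarrow> j \<in> occ t" using occ_outside assms by blast
  qed auto
  then show "occ_diff {j. P j} (s, t) = imbalance {j \<in> window N. P j} 0 (config_of (s, t, u))"
    "occ_diff {j. P j} (s, t) = imbalance {j \<in> window N. P j} 1 (config_of (u, s, t))"
    by (simp_all add: imbalance_def config_of_mem)
qed

definition left_of :: "state \<Rightarrow> (state \<times> state \<Rightarrow>\<^sub>0 complex) \<Rightarrow> (state \<times> state \<times> state \<Rightarrow>\<^sub>0 complex)" where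
  "left_of u v = assoc (tens v (ket u))"

definition right_of :: "state \<Rightarrow> (state \<times> state \<Rightarrow>\<^sub>0 complex) \<Rightarrow> (state \<times> state \<times> state \<Rightarrow>\<^sub>0 complex)" where
  "right_of u v = tens (ket u) v"

lemma clin_left_of [simp]: "clin (left_of u)"
  unfolding left_of_def[abs_def] assoc_def by (rule linear_comp'[OF clin_tens_left clin_linext])

lemma clin_right_of [simp]: "clin (right_of u)"
  unfolding right_of_def[abs_def] by (rule clin_tens_right)

lemma left_of_ket: "left_of u (ket (s, t)) = ket (s, t, u)"
  by (simp add: left_of_def assoc_def)

lemma right_of_ket: "right_of u (ket (s, t)) = ket (u, s, t)"
  by (simp add: right_of_def)

lemma to_config_ket: "to_config (ket p) = gauge p \<cdot> ket (config_of p)"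
  by (simp add: to_config_def)

lemma lin_eq_on_keys:
  assumes "clin f" "clin g" "\<And>a. a \<in> Poly_Mapping.keys v \<Longrightarrow> f (ket a) = g (ket a)"
  shows "f v = g v"
  unfolding lin_expand[OF assms(1), of v] lin_expand[OF assms(2), of v]
  using assms(3) by (intro sum.cong) simp_all

lemma config_of_hop:
  assumes "(i \<in> occ s) \<noteq> (i \<in> occ t)"
  shows "config_of (toggle i s, toggle i t, u) = (config_of (s, t, u))(i := (if i \<in> occ s
      then insert 1 (config_of (s, t, u) i - {0}) else insert 0 (config_of (s, t, u) i - {1})))"
    and "config_of (u, toggle i s, toggle i t) = (config_of (u, s, t))(i := (if i \<in> occ s
      then insert 2 (config_of (u, s, t) i - {1}) else insert 1 (config_of (u, s, t) i - {2})))"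
  by (rule ext; use assms in \<open>auto simp: config_of_def occ_toggle\<close>)+

context generic_q begin

text \<open>Modes outside the window are occupied in both factors or in neither, so that no hops occur there.\<close>

lemma intertwine_E_ket:
  assumes w: "in_window N s" "in_window N t"
  shows "to_config (left_of u (Eop q (ket (s, t)))) = raise q (window N) 0 (to_config (left_of u (ket (s, t))))"
    and "to_config (right_of u (Eop q (ket (s, t)))) = raise q (window N) 1 (to_config (right_of u (ket (s, t))))"
proof -
  have sub: "occ t - occ s \<subseteq> window N"
    using occ_outside[OF w(1)] occ_outside[OF w(2)] by auto
  note E = Eop_ket[OF finite_window sub]
  show "to_config (left_of u (Eop q (ket (s, t)))) = raise q (window N) 0 (to_config (left_of u (ket (s, t))))"
    unfolding E raise_def left_of_ket linear_sum'[OF clin_left_of] linear_sum'[OF clin_to_config]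
  proof (intro sum.cong refl)
    fix i
    show "to_config (left_of u (if i \<in> occ t \<and> i \<notin> occ s
        then (q powi occ_diff {j. i < j} (s, t) * hop_sign i s t) \<cdot> ket (toggle i s, toggle i t) else 0)) =
      move i 0 (Suc 0) (kop q {j \<in> window N. i < j} 0 (to_config (ket (s, t, u))))"
    proof (cases "i \<in> occ t \<and> i \<notin> occ s")
      case True
      then have h: "hop_sign i s t * gauge (toggle i s, toggle i t, u) = gauge (s, t, u)"
        using gauge_toggle(1)[of i s t u] hop_sign_sq[of i s t] by (simp del: gauge.simps flip: mult.assoc)
      show ?thesis
        using True h config_of_hop(1)[of i s t u] occ_diff_imbalance(1)[OF w, of "\<lambda>j. i < j" u]
        by (simp add: left_of_ket to_config_ket kop_ket move_ket lin_simps config_of_mem mult.commute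
            linear_scale'[OF clin_left_of] linear_scale'[OF clin_to_config] del: fun_upd_apply gauge.simps)
    next
      case False
      then show ?thesis
        by (auto simp: to_config_ket kop_ket move_ket lin_simps config_of_mem
            linear_0'[OF clin_left_of] linear_0'[OF clin_to_config])
    qed
  qed
  show "to_config (right_of u (Eop q (ket (s, t)))) = raise q (window N) 1 (to_config (right_of u (ket (s, t))))"
    unfolding E raise_def right_of_ket linear_sum'[OF clin_right_of] linear_sum'[OF clin_to_config]
  proof (intro sum.cong refl)
    fix i
    show "to_config (right_of u (if i \<in> occ t \<and> i \<notin> occ s
        then (q powi occ_diff {j. i < j} (s, t) * hop_sign i s t) \<cdot> ket (toggle i s, toggle i t) else 0)) =
      move i 1 (Suc 1) (kop q {j \<in> window N. i < j} 1 (to_config (ket (u, s, t))))"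
    proof (cases "i \<in> occ t \<and> i \<notin> occ s")
      case True
      then have h: "hop_sign i s t * gauge (u, toggle i s, toggle i t) = gauge (u, s, t)"
        using gauge_toggle(2)[of i s t u] hop_sign_sq[of i s t] by (simp del: gauge.simps flip: mult.assoc)
      show ?thesis
        using True h config_of_hop(2)[of i s t u] occ_diff_imbalance(2)[OF w, of "\<lambda>j. i < j" u]
        by (simp add: right_of_ket to_config_ket kop_ket move_ket lin_simps config_of_mem mult.commute numeral_2_eq_2
            linear_scale'[OF clin_right_of] linear_scale'[OF clin_to_config] del: fun_upd_apply gauge.simps)
    next
      case False
      then show ?thesis
        by (auto simp: to_config_ket kop_ket move_ket lin_simps config_of_mem
            linear_0'[OF clin_right_of] linear_0'[OF clin_to_config])
    qed
  qed
qed

lemma intertwine_F_ket: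
  assumes w: "in_window N s" "in_window N t"
  shows "to_config (left_of u (Fop q (ket (s, t)))) = lower q (window N) 0 (to_config (left_of u (ket (s, t))))"
    and "to_config (right_of u (Fop q (ket (s, t)))) = lower q (window N) 1 (to_config (right_of u (ket (s, t))))"
proof -
  have sub: "occ s - occ t \<subseteq> window N"
    using occ_outside[OF w(1)] occ_outside[OF w(2)] by auto
  note F = Fop_ket[OF finite_window sub]
  show "to_config (left_of u (Fop q (ket (s, t)))) = lower q (window N) 0 (to_config (left_of u (ket (s, t))))"
    unfolding F lower_def left_of_ket linear_sum'[OF clin_left_of] linear_sum'[OF clin_to_config]
  proof (intro sum.cong refl)
    fix i
    show "to_config (left_of u (if i \<in> occ s \<and> i \<notin> occ t
        then (q powi (- occ_diff {j. j < i} (s, t)) * - hop_sign i s t) \<cdot> ket (toggle i s, toggle i t) else 0)) =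
      kinv q {j \<in> window N. j < i} 0 (move i (Suc 0) 0 (to_config (ket (s, t, u))))"
    proof (cases "i \<in> occ s \<and> i \<notin> occ t")
      case True
      then have h: "gauge (s, t, u) = - (hop_sign i s t * gauge (toggle i s, toggle i t, u))"
        using gauge_toggle(1)[of i s t u] hop_sign_sq[of i s t] by (simp del: gauge.simps flip: mult.assoc)
      show ?thesis
        using True h config_of_hop(1)[of i s t u] occ_diff_imbalance(1)[OF w, of "\<lambda>j. j < i" u]
        by (simp add: left_of_ket to_config_ket kinv_ket move_ket lin_simps config_of_mem mult_ac imbalance_upd cscale_uminus
            linear_neg'[OF clin_left_of] linear_neg'[OF clin_to_config] linear_neg'[OF clin_move] linear_neg'[OF clin_kinv] linear_scale'[OF clin_left_of] linear_scale'[OF clin_to_config] del: fun_upd_apply gauge.simps)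
    next
      case False
      then show ?thesis
        by (auto simp: to_config_ket kinv_ket move_ket lin_simps config_of_mem
            linear_0'[OF clin_left_of] linear_0'[OF clin_to_config])
    qed
  qed
  show "to_config (right_of u (Fop q (ket (s, t)))) = lower q (window N) 1 (to_config (right_of u (ket (s, t))))"
    unfolding F lower_def right_of_ket linear_sum'[OF clin_right_of] linear_sum'[OF clin_to_config]
  proof (intro sum.cong refl)
    fix i
    show "to_config (right_of u (if i \<in> occ s \<and> i \<notin> occ t
        then (q powi (- occ_diff {j. j < i} (s, t)) * - hop_sign i s t) \<cdot> ket (toggle i s, toggle i t) else 0)) =
      kinv q {j \<in> window N. j < i} 1 (move i (Suc 1) 1 (to_config (ket (u, s, t))))"
    proof (cases "i \<in> occ s \<and> i \<notin> occ t")
      case True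
      then have h: "gauge (u, s, t) = - (hop_sign i s t * gauge (u, toggle i s, toggle i t))"
        using gauge_toggle(2)[of i s t u] hop_sign_sq[of i s t] by (simp del: gauge.simps flip: mult.assoc)
      show ?thesis
        using True h config_of_hop(2)[of i s t u] occ_diff_imbalance(2)[OF w, of "\<lambda>j. j < i" u]
        by (simp add: right_of_ket to_config_ket kinv_ket move_ket lin_simps config_of_mem mult_ac imbalance_upd numeral_2_eq_2 cscale_uminus
            linear_neg'[OF clin_right_of] linear_neg'[OF clin_to_config] linear_neg'[OF clin_move] linear_neg'[OF clin_kinv] linear_scale'[OF clin_right_of] linear_scale'[OF clin_to_config] del: fun_upd_apply gauge.simps)
    next
      case False
      then show ?thesis
        by (auto simp: to_config_ket kinv_ket move_ket lin_simps config_of_mem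
            linear_0'[OF clin_right_of] linear_0'[OF clin_to_config])
    qed
  qed
qed

end

section \<open>Homogeneous vectors\<close>

definition supported :: "('a \<Rightarrow> bool) \<Rightarrow> ('a \<Rightarrow>\<^sub>0 complex) set" where
  "supported P = {v. \<forall>a\<in>Poly_Mapping.keys v. P a}"

lemma subspace_supported: "cvec.subspace (supported P)"
  unfolding cvec.subspace_def supported_def
  by (auto simp: in_keys_iff lookup_add)

lemma ket_supported: "P a \<Longrightarrow> ket a \<in> supported P"
  by (simp add: supported_def ket_def)

lemma clin_supported:
  assumes "clin f" "\<And>a. P a \<Longrightarrow> f (ket a) \<in> supported Q" "v \<in> supported P"
  shows "f v \<in> supported Q"
  unfolding lin_expand[OF assms(1), of v]
proof (intro cvec.subspace_sum[OF subspace_supported] cvec.subspace_scale[OF subspace_supported] assms(2))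
  show "P a" if "a \<in> Poly_Mapping.keys v" for a
    using assms(3) that by (simp add: supported_def)
qed

lemma supported_mono: "v \<in> supported P \<Longrightarrow> (\<And>a. P a \<Longrightarrow> Q a) \<Longrightarrow> v \<in> supported Q"
  by (simp add: supported_def)

lemma grade_supported: "grade k = supported (\<lambda>a. deg a = k)"
  by (simp add: grade_def supported_def)

lemma tens_supported:
  assumes "v \<in> supported P" "w \<in> supported Q"
  shows "tens v w \<in> supported (\<lambda>(a, b). P a \<and> Q b)"
  using clin_tens_left _ assms(1)
proof (rule clin_supported)
  fix a assume a: "P a"
  show "tens (ket a) w \<in> supported (\<lambda>(a, b). P a \<and> Q b)"
    using clin_tens_right _ assms(2)
    by (rule clin_supported) (use a in \<open>simp add: ket_supported\<close>)
qed

lemma tens_sub_supported: "tens_sub (supported P) (supported Q) = supported (\<lambda>(a, b). P a \<and> Q b)"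
proof
  show "tens_sub (supported P) (supported Q) \<subseteq> supported (\<lambda>(a, b). P a \<and> Q b)"
    unfolding tens_sub_def
    by (rule cvec.span_minimal[OF _ subspace_supported]) (auto intro: tens_supported)
  show "supported (\<lambda>(a, b). P a \<and> Q b) \<subseteq> tens_sub (supported P) (supported Q)"
  proof
    fix x assume x: "x \<in> supported (\<lambda>(a, b). P a \<and> Q b)"
    have "ket p \<in> tens_sub (supported P) (supported Q)" if "p \<in> Poly_Mapping.keys x" for p
    proof -
      obtain a b where p: "p = (a, b)" by (cases p)
      have "P a \<and> Q b" using x that by (auto simp: supported_def p)
      then have "tens (ket a) (ket b) \<in> tens_sub (supported P) (supported Q)"
        unfolding tens_sub_def by (intro cvec.span_base CollectI exI[of _ "ket a"] exI[of _ "ket b"] conjI refl ket_supported) simp_all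
      then show ?thesis by (simp add: p)
    qed
    then have "(\<Sum>p\<in>Poly_Mapping.keys x. Poly_Mapping.lookup x p \<cdot> ket p) \<in> tens_sub (supported P) (supported Q)"
      unfolding tens_sub_def by (intro cvec.span_sum cvec.span_scale)
    then show "x \<in> tens_sub (supported P) (supported Q)" by (simp only: ket_expand)
  qed
qed

text \<open>The homogeneous vectors with all excitations in the window.\<close>

definition block :: "nat \<Rightarrow> int \<Rightarrow> int \<Rightarrow> (state \<times> state \<Rightarrow>\<^sub>0 complex) set" where
  "block N k k' = supported (\<lambda>(s, t). in_window N s \<and> in_window N t \<and> deg s = k \<and> deg t = k')"

lemma subspace_block: "cvec.subspace (block N k k')"
  by (simp add: block_def subspace_supported)

lemma ket_block: "in_window N s \<Longrightarrow> in_window N t \<Longrightarrow> ket (s, t) \<in> block N (deg s) (deg t)"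
  by (simp add: block_def ket_supported)

lemma clin_block:
  assumes "clin f" "v \<in> block N k k'"
    and "\<And>s t. in_window N s \<Longrightarrow> in_window N t \<Longrightarrow> deg s = k \<Longrightarrow> deg t = k' \<Longrightarrow> f (ket (s, t)) \<in> block N l l'"
  shows "f v \<in> block N l l'"
  using assms(1) _ assms(2) unfolding block_def
  by (rule clin_supported) (use assms(3) in \<open>auto simp: block_def\<close>)

lemma lin_eq_on_block:
  assumes "clin f" "clin g" "v \<in> block N k k'"
    and "\<And>s t. in_window N s \<Longrightarrow> in_window N t \<Longrightarrow> deg s = k \<Longrightarrow> deg t = k' \<Longrightarrow> f (ket (s, t)) = g (ket (s, t))"
  shows "f v = g v"
  using assms(1,2)
proof (rule lin_eq_on_keys)
  fix p assume "p \<in> Poly_Mapping.keys v"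
  then show "f (ket p) = g (ket p)"
    using assms(3) by (cases p) (auto simp: block_def supported_def intro!: assms(4))
qed

lemma in_window_mono: "in_window N s \<Longrightarrow> N \<le> N' \<Longrightarrow> in_window N' s"
  by (auto simp: in_window_def window_def)

lemma ex_in_window: "\<exists>N. in_window N s"
proof -
  have *: "i \<in> window (Suc n)" if "nat \<bar>i\<bar> \<le> n" for i n
    using that by (auto simp: window_def)
  have "i \<in> window (Suc (\<Sum>j\<in>excited s. nat \<bar>j\<bar>))" if "i \<in> excited s" for i
    using that by (intro * member_le_sum) auto
  then show ?thesis unfolding in_window_def by blast
qed

lemma deg_window: "in_window N s \<Longrightarrow> 0 \<le> deg s + int N"
  using card_occ[of N s] by simp

section \<open>The braiding matrix on a window of modes\<close>

text \<open>For \<open>i \<le> 1\<close>, the vector \<open>v\<close> is put on the strands \<open>i\<close> and \<open>i + 1\<close>, and \<open>u\<close> on the remaining one of three strands.\<close>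

definition place :: "nat \<Rightarrow> state \<Rightarrow> (state \<times> state \<Rightarrow>\<^sub>0 complex) \<Rightarrow> (config \<Rightarrow>\<^sub>0 complex)" where
  "place i u v = to_config (if i = 0 then left_of u v else right_of u v)"

lemma clin_place [simp]: "clin (place i u)"
  using linear_comp'[OF clin_left_of clin_to_config] linear_comp'[OF clin_right_of clin_to_config]
  by (cases "i = 0") (simp_all add: place_def[abs_def])

lemma place_eq_0: "place 0 u v = 0 \<Longrightarrow> v = 0"
proof -
  assume "place 0 u v = 0"
  then have "to_config (left_of u v) = to_config 0"
    by (simp add: place_def linear_0'[OF clin_to_config])
  then have "left_of u v = 0" by (rule injD[OF inj_to_config])
  moreover have "linext (\<lambda>(s, t, u). ket (s, t)) (left_of u w) = w" for w
  proof -
    have "clin (\<lambda>w. linext (\<lambda>(s, t, u). ket (s, t) :: state \<times> state \<Rightarrow>\<^sub>0 complex) (left_of u w))"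
      by (rule linear_comp'[OF clin_left_of clin_linext])
    moreover have "clin (\<lambda>w. w :: state \<times> state \<Rightarrow>\<^sub>0 complex)" by (rule clinI) simp_all
    ultimately show ?thesis
    proof (rule lin_eqI)
      fix p :: "state \<times> state"
      show "linext (\<lambda>(s, t, u). ket (s, t)) (left_of u (ket p)) = ket p"
        by (cases p) (simp add: left_of_ket)
    qed
  qed
  ultimately show "v = 0" using linear_0'[OF clin_linext] by metis
qed

lemma config_card:
  assumes "in_window N s"
  shows "card {m \<in> window N. m \<in> occ s} = nat (deg s + int N)"
  using card_occ[OF assms] by simp

lemma place_strand_grade:
  assumes "i \<le> 1" "v \<in> block N k k'"
  shows "place i u v \<in> strand_grade (window N) i (nat (k + int N))"
    and "place i u v \<in> strand_grade (window N) (Suc i) (nat (k' + int N))"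
proof -
  have key: "place i u v \<in> S" if S: "cvec.subspace S" and *: "\<And>s t. in_window N s \<Longrightarrow> in_window N t \<Longrightarrow> deg s = k
      \<Longrightarrow> deg t = k' \<Longrightarrow> ket (config_of (if i = 0 then (s, t, u) else (u, s, t))) \<in> S" for S
    unfolding lin_expand[OF clin_place, of i u v]
  proof (intro cvec.subspace_sum[OF S] cvec.subspace_scale[OF S])
    fix p assume p: "p \<in> Poly_Mapping.keys v"
    obtain s t where st: "p = (s, t)" by (cases p)
    have "ket (config_of (if i = 0 then (s, t, u) else (u, s, t))) \<in> S"
      using assms(2) p by (intro *) (auto simp: block_def supported_def st)
    then show "place i u (ket p) \<in> S"
      by (auto simp: st place_def left_of_ket right_of_ket to_config_ket simp del: gauge.simps intro: cvec.subspace_scale[OF S])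
  qed
  have i: "i = 0 \<or> i = 1" using assms(1) by auto
  show "place i u v \<in> strand_grade (window N) i (nat (k + int N))"
    by (rule key[OF subspace_strand_grade]) (use i in \<open>auto simp: ket_strand_grade config_of_mem config_card\<close>)
  show "place i u v \<in> strand_grade (window N) (Suc i) (nat (k' + int N))"
    by (rule key[OF subspace_strand_grade]) (use i in \<open>auto simp: ket_strand_grade config_of_mem config_card\<close>)
qed

context generic_q begin

lemma Eop_block: 
  assumes "v \<in> block N k k'"
  shows "Eop q v \<in> block N (k + 1) (k' - 1)"
  using clin_Eop assms
proof (rule clin_block)
  fix s t assume w: "in_window N s" "in_window N t" "deg s = k" "deg t = k'"
  have sub: "occ t - occ s \<subseteq> window N"
    using occ_outside[OF w(1)] occ_outside[OF w(2)] by auto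
  show "Eop q (ket (s, t)) \<in> block N (k + 1) (k' - 1)"
    unfolding Eop_ket[OF finite_window sub]
  proof (rule cvec.subspace_sum[OF subspace_block])
    fix i assume i: "i \<in> window N"
    show "(if i \<in> occ t \<and> i \<notin> occ s then (q powi occ_diff {j. i < j} (s, t) * hop_sign i s t) \<cdot> ket (toggle i s, toggle i t)
        else 0) \<in> block N (k + 1) (k' - 1)"
      using w i ket_block[of N "toggle i s" "toggle i t"]
      by (auto intro!: cvec.subspace_scale[OF subspace_block] cvec.subspace_0[OF subspace_block]
          simp: in_window_toggle deg_toggle)
  qed
qed

lemma Fop_block: 
  assumes "v \<in> block N k k'"
  shows "Fop q v \<in> block N (k - 1) (k' + 1)"
  using clin_Fop assms
proof (rule clin_block)
  fix s t assume w: "in_window N s" "in_window N t" "deg s = k" "deg t = k'"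
  have sub: "occ s - occ t \<subseteq> window N"
    using occ_outside[OF w(1)] occ_outside[OF w(2)] by auto
  show "Fop q (ket (s, t)) \<in> block N (k - 1) (k' + 1)"
    unfolding Fop_ket[OF finite_window sub]
  proof (rule cvec.subspace_sum[OF subspace_block])
    fix i assume i: "i \<in> window N"
    show "(if i \<in> occ s \<and> i \<notin> occ t then (q powi (- occ_diff {j. j < i} (s, t)) * - hop_sign i s t) \<cdot> ket (toggle i s, toggle i t)
        else 0) \<in> block N (k - 1) (k' + 1)"
      using w i ket_block[of N "toggle i s" "toggle i t"]
      by (auto intro!: cvec.subspace_scale[OF subspace_block] cvec.subspace_0[OF subspace_block]
          simp: in_window_toggle deg_toggle simp del: mult_minus_right)
  qed
qed

lemma place_Eop:
  assumes "i \<le> 1" "v \<in> block N k k'"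
  shows "place i u (Eop q v) = raise q (window N) i (place i u v)"
  using linear_comp'[OF clin_Eop clin_place] linear_comp'[OF clin_place clin_raise] assms(2)
proof (rule lin_eq_on_block)
  show "place i u (Eop q (ket (s, t))) = raise q (window N) i (place i u (ket (s, t)))"
    if "in_window N s" "in_window N t" for s t
    using assms(1) intertwine_E_ket[OF that, of u] by (cases "i = 0") (auto simp: place_def le_Suc_eq)
qed

lemma place_Fop:
  assumes "i \<le> 1" "v \<in> block N k k'"
  shows "place i u (Fop q v) = lower q (window N) i (place i u v)"
  using linear_comp'[OF clin_Fop clin_place] linear_comp'[OF clin_place clin_lower] assms(2)
proof (rule lin_eq_on_block)
  show "place i u (Fop q (ket (s, t))) = lower q (window N) i (place i u (ket (s, t)))"
    if "in_window N s" "in_window N t" for s t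
    using assms(1) intertwine_F_ket[OF that, of u] by (cases "i = 0") (auto simp: place_def le_Suc_eq)
qed

lemma place_Eop_divpow:
  assumes "i \<le> 1" "v \<in> block N k k'"
  shows "divpow q (Eop q) n v \<in> block N (k + int n) (k' - int n)"
    and "place i u (divpow q (Eop q) n v) = divpow q (raise q (window N) i) n (place i u v)"
proof -
  have *: "(Eop q ^^ n) v \<in> block N (k + int n) (k' - int n) \<and>
      place i u ((Eop q ^^ n) v) = (raise q (window N) i ^^ n) (place i u v)"
  proof (induction n)
    case (Suc n)
    then show ?case
      using Eop_block[of "(Eop q ^^ n) v" N "k + int n" "k' - int n"] place_Eop[OF assms(1), of "(Eop q ^^ n) v"]
      by (auto simp: add_ac diff_diff_eq)
  qed (use assms(2) in simp)
  show "divpow q (Eop q) n v \<in> block N (k + int n) (k' - int n)"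
    "place i u (divpow q (Eop q) n v) = divpow q (raise q (window N) i) n (place i u v)"
    using * by (simp_all add: divpow_def cvec.subspace_scale[OF subspace_block] linear_scale'[OF clin_place])
qed

lemma place_Fop_divpow:
  assumes "i \<le> 1" "v \<in> block N k k'"
  shows "divpow q (Fop q) n v \<in> block N (k - int n) (k' + int n)"
    and "place i u (divpow q (Fop q) n v) = divpow q (lower q (window N) i) n (place i u v)"
proof -
  have *: "(Fop q ^^ n) v \<in> block N (k - int n) (k' + int n) \<and>
      place i u ((Fop q ^^ n) v) = (lower q (window N) i ^^ n) (place i u v)"
  proof (induction n)
    case (Suc n)
    then show ?case
      using Fop_block[of "(Fop q ^^ n) v" N "k - int n" "k' + int n"] place_Fop[OF assms(1), of "(Fop q ^^ n) v"]
      by (auto simp: add_ac diff_diff_eq)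
  qed (use assms(2) in simp)
  show "divpow q (Fop q) n v \<in> block N (k - int n) (k' + int n)"
    "place i u (divpow q (Fop q) n v) = divpow q (lower q (window N) i) n (place i u v)"
    using * by (simp_all add: divpow_def cvec.subspace_scale[OF subspace_block] linear_scale'[OF clin_place])
qed

lemma EFop_eq: "EFop q m j x = divpow q (Eop q) (j + nat (- m)) (divpow q (Fop q) (j + nat m) x)"
  by (simp add: EFop_def)

lemma clin_EFop [simp]: "clin (EFop q m j)"
  unfolding EFop_eq[abs_def] by (rule linear_comp'[OF clin_divpow[OF clin_Fop] clin_divpow[OF clin_Eop]])

lemma EFop_block:
  assumes "v \<in> block N k k'"
  shows "EFop q m j v \<in> block N (k - m) (k' + m)"
proof -
  have "k - int (j + nat m) + int (j + nat (- m)) = k - m" "k' + int (j + nat m) - int (j + nat (- m)) = k' + m"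
    by simp_all
  with place_Eop_divpow(1)[OF le0 place_Fop_divpow(1)[OF le0 assms], of "j + nat (- m)" "j + nat m"]
  show ?thesis by (simp only: EFop_eq)
qed

lemma place_EFop:
  assumes "i \<le> 1" "v \<in> block N k k'"
  shows "place i u (EFop q m j v) = divpow q (raise q (window N) i) (j + nat (- m))
    (divpow q (lower q (window N) i) (j + nat m) (place i u v))"
  unfolding EFop_eq place_Eop_divpow(2)[OF assms(1) place_Fop_divpow(1)[OF assms]] place_Fop_divpow(2)[OF assms] ..

text \<open>There are only \<open>k + N\<close> particles that \<open>F\<close> could move.\<close>

lemma EFop_vanish:
  assumes "v \<in> block N k k'" "nat (k + int N) < j + nat m"
  shows "EFop q m j v = 0"
proof (rule place_eq_0)
  interpret W: strands q "raise q (window N)" "lower q (window N)" "strand_grade (window N)"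
    by (rule strands_config[OF finite_window])
  have "divpow q (lower q (window N) 0) (j + nat m) (place 0 (State {}) v) = 0"
    by (rule W.Fd_vanish[OF place_strand_grade(1)[OF le0 assms(1)]]) (rule assms(2))
  then show "place 0 (State {}) (EFop q m j v) = 0"
    unfolding place_EFop[OF le0 assms(1)] by (simp add: W.Ed_simps)
qed

lemma finite_EFop: "finite {j. EFop q m j x \<noteq> 0}"
proof (rule finite_subset)
  show "{j. EFop q m j x \<noteq> 0} \<subseteq> (\<Union>p\<in>Poly_Mapping.keys x. {j. EFop q m j (ket p) \<noteq> 0})"
  proof
    fix j assume j: "j \<in> {j. EFop q m j x \<noteq> 0}"
    have "\<not> (\<forall>p\<in>Poly_Mapping.keys x. EFop q m j (ket p) = 0)"
    proof
      assume "\<forall>p\<in>Poly_Mapping.keys x. EFop q m j (ket p) = 0"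
      then have "EFop q m j x = 0" unfolding lin_expand[OF clin_EFop, of m j x] by (intro sum.neutral) simp
      with j show False by simp
    qed
    then show "j \<in> (\<Union>p\<in>Poly_Mapping.keys x. {j. EFop q m j (ket p) \<noteq> 0})" by blast
  qed
  have "finite {j. EFop q m j (ket (s, t)) \<noteq> 0}" for s t
  proof -
    obtain N N' where "in_window N s" "in_window N' t" using ex_in_window by blast
    then have w: "in_window (max N N') s" "in_window (max N N') t" by (auto elim: in_window_mono)
    have "{j. EFop q m j (ket (s, t)) \<noteq> 0} \<subseteq> {..nat (deg s + int (max N N'))}"
      using EFop_vanish[OF ket_block[OF w], of _ m] by force
    then show ?thesis by (rule finite_subset) simp
  qed
  then show "finite (\<Union>p\<in>Poly_Mapping.keys x. {j. EFop q m j (ket p) \<noteq> 0})" by auto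
qed

lemma clin_Aop [simp]: "clin (Aop q m z)"
proof -
  have "finite {j. ((- q) ^ j * rcoef q m j z) \<cdot> EFop q m j x \<noteq> 0}" for x
    by (rule finite_subset[OF _ finite_EFop[of m x]]) auto
  with clin_Sum_any[of "\<lambda>j x. ((- q) ^ j * rcoef q m j z) \<cdot> EFop q m j x"] clin_scaled[OF clin_EFop]
  show ?thesis by (simp add: Aop_def[abs_def])
qed

lemma Aop_sum:
  assumes "v \<in> block N k k'" "nat (k + int N) < J + nat m"
  shows "Aop q m z v = (\<Sum>j<J. ((- q) ^ j * rcoef q m j z) \<cdot> EFop q m j v)"
  unfolding Aop_def
proof (intro Sum_any.expand_superset finite_lessThan subsetI)
  fix j assume "j \<in> {j. ((- q) ^ j * rcoef q m j z) \<cdot> EFop q m j v \<noteq> 0}"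
  then show "j \<in> {..<J}"
    using EFop_vanish[OF assms(1), of j m] assms(2) by (cases "j < J") auto
qed

lemma Aop_block:
  assumes "v \<in> block N k k'"
  shows "Aop q m z v \<in> block N (k - m) (k' + m)"
proof -
  have "nat (k + int N) < Suc (nat (k + int N)) + nat m" by simp
  from Aop_sum[OF assms this] show ?thesis
    by (simp only:) (intro cvec.subspace_sum[OF subspace_block] cvec.subspace_scale[OF subspace_block] EFop_block[OF assms])
qed

lemma place_Aop:
  assumes i: "i \<le> 1" and v: "v \<in> block N k k'" and pos: "0 \<le> k + int N" "0 \<le> k' + int N" and z: "generic z"
  shows "place i u (Aop q (k - k') z v) =
    braid (raise q (window N) i) (lower q (window N) i) (nat (k + int N)) (nat (k' + int N)) z (place i u v)"
proof -
  define a b where "a = nat (k + int N)" and "b = nat (k' + int N)"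
  have m: "nat (k - k') = a - b" "nat (- (k - k')) = b - a" "nat \<bar>k - k'\<bar> = nat \<bar>int a - int b\<bar>"
    using pos by (simp_all add: a_def b_def nat_diff_distrib)
  have c: "bcoef a b (a - b + j) z = (- q) ^ j * rcoef q (k - k') j z" for j
  proof -
    have "b + 2 * (a - b + j) - a = 2 * j + nat \<bar>int a - int b\<bar>" "min (b + (a - b + j) - a) (a - b + j) = j"
      by (cases "a \<le> b"; simp)+
    then show ?thesis using generic_denom[OF z] by (simp add: bcoef_def rcoef_def m(3))
  qed
  have "Aop q (k - k') z v = (\<Sum>j<Suc (min a b). ((- q) ^ j * rcoef q (k - k') j z) \<cdot> EFop q (k - k') j v)"
    using v by (rule Aop_sum) (use pos in \<open>simp add: m(1) a_def b_def\<close>)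
  then have "place i u (Aop q (k - k') z v) =
      (\<Sum>j\<le>min a b. ((- q) ^ j * rcoef q (k - k') j z) \<cdot> place i u (EFop q (k - k') j v))"
    by (simp add: linear_sum'[OF clin_place] linear_scale'[OF clin_place] lessThan_Suc_atMost)
  also have "\<dots> = braid (raise q (window N) i) (lower q (window N) i) a b z (place i u v)"
    unfolding braid_def sum_from_diff place_EFop[OF i v] c m
  proof (rule sum.cong)
    fix j
    have e: "b + (a - b + j) - a = j + (b - a)" by (cases "a \<le> b") auto
    show "((- q) ^ j * rcoef q (k - k') j z) \<cdot> divpow q (raise q (window N) i) (j + (b - a)) (divpow q (lower q (window N) i) (j + (a - b)) (place i u v)) =
      ((- q) ^ j * rcoef q (k - k') j z) \<cdot> divpow q (raise q (window N) i) (b + (a - b + j) - a) (divpow q (lower q (window N) i) (a - b + j) (place i u v))"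
      by (simp only: e add.commute[of j "a - b"])
  qed simp
  finally show ?thesis by (simp only: a_def b_def)
qed

end

section \<open>The operators on the triple tensor product\<close>

definition block3 :: "nat \<Rightarrow> int \<Rightarrow> int \<Rightarrow> int \<Rightarrow> (state \<times> state \<times> state \<Rightarrow>\<^sub>0 complex) set" where
  "block3 N k1 k2 k3 = supported (\<lambda>(s, t, u). in_window N s \<and> in_window N t \<and> in_window N u \<and>
     deg s = k1 \<and> deg t = k2 \<and> deg u = k3)"

lemma subspace_block3: "cvec.subspace (block3 N k1 k2 k3)"
  by (simp add: block3_def subspace_supported)

lemma ket_block3: "in_window N s \<Longrightarrow> in_window N t \<Longrightarrow> in_window N u \<Longrightarrow>
    ket (s, t, u) \<in> block3 N (deg s) (deg t) (deg u)"
  by (simp add: block3_def ket_supported)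

lemma clin_block3:
  assumes "clin f" "x \<in> block3 N k1 k2 k3" "cvec.subspace S"
    and "\<And>s t u. in_window N s \<Longrightarrow> in_window N t \<Longrightarrow> in_window N u \<Longrightarrow> deg s = k1 \<Longrightarrow> deg t = k2 \<Longrightarrow> deg u = k3 \<Longrightarrow>
      f (ket (s, t, u)) \<in> S"
  shows "f x \<in> S"
  unfolding lin_expand[OF assms(1), of x]
proof (intro cvec.subspace_sum[OF assms(3)] cvec.subspace_scale[OF assms(3)])
  fix p assume p: "p \<in> Poly_Mapping.keys x"
  obtain s t u where stu: "p = (s, t, u)" by (cases p)
  show "f (ket p) \<in> S"
    unfolding stu using p assms(2) by (intro assms(4)) (auto simp: block3_def supported_def stu)
qed

lemma lin_eq_on_block3:
  assumes "clin f" "clin g" "x \<in> block3 N k1 k2 k3"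
    and "\<And>s t u. in_window N s \<Longrightarrow> in_window N t \<Longrightarrow> in_window N u \<Longrightarrow> deg s = k1 \<Longrightarrow> deg t = k2 \<Longrightarrow> deg u = k3 \<Longrightarrow>
      f (ket (s, t, u)) = g (ket (s, t, u))"
  shows "f x = g x"
  using assms(1,2)
proof (rule lin_eq_on_keys)
  fix p assume p: "p \<in> Poly_Mapping.keys x"
  obtain s t u where stu: "p = (s, t, u)" by (cases p)
  show "f (ket p) = g (ket p)"
    unfolding stu using p assms(3) by (intro assms(4)) (auto simp: block3_def supported_def stu)
qed

lemma left_of_block3:
  assumes "v \<in> block N k1 k2" "in_window N u"
  shows "left_of u v \<in> block3 N k1 k2 (deg u)"
  using clin_left_of _ assms(1)[unfolded block_def] unfolding block3_def
  by (rule clin_supported) (auto simp: left_of_ket assms(2) intro!: ket_supported)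

lemma right_of_block3:
  assumes "v \<in> block N k2 k3" "in_window N s"
  shows "right_of s v \<in> block3 N (deg s) k2 k3"
  using clin_right_of _ assms(1)[unfolded block_def] unfolding block3_def
  by (rule clin_supported) (auto simp: right_of_ket assms(2) intro!: ket_supported)

lemma clin_on12 [simp]: "clin (on12 T)"
proof -
  have "clin (\<lambda>x. stensor T (id :: fock \<Rightarrow> fock) (unassoc x))"
    unfolding unassoc_def by (rule linear_comp'[OF clin_linext clin_stensor])
  then show ?thesis
    unfolding on12_def[abs_def] assoc_def by (rule linear_comp'[OF _ clin_linext])
qed

lemma clin_on23 [simp]: "clin (on23 T)"
  by (simp add: on23_def[abs_def])

lemma on12_ket: "on12 T (ket (s, t, u)) = left_of u (T (ket (s, t)))"
  by (simp add: on12_def unassoc_def stensor_def left_of_def)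

text \<open>There is no sign although \<open>T\<close> passes the first factor, because \<open>T\<close> preserves the total degree of this vector.\<close>

lemma on23_ket:
  assumes "T (ket (t, u)) \<in> block N k k'" "k + k' = deg t + deg u"
  shows "on23 T (ket (s, t, u)) = right_of s (T (ket (t, u)))"
proof -
  have "linext (\<lambda>b. (- 1) powi ((deg b - deg (t, u)) * deg s) \<cdot> ket b) (T (ket (t, u))) = linext ket (T (ket (t, u)))"
  proof (rule keys_sub_linext)
    fix b assume "b \<in> Poly_Mapping.keys (T (ket (t, u)))"
    then have "deg b = deg (t, u)"
      using assms by (cases b) (auto simp: block_def supported_def deg_prod_def)
    then show "(- 1) powi ((deg b - deg (t, u)) * deg s) \<cdot> ket b = ket b" by simp
  qed
  then show ?thesis by (simp add: on23_def stensor_def right_of_def)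
qed

lemma on12_scaled: "on12 (\<lambda>v. c \<cdot> T v) x = c \<cdot> on12 T x"
  using clin_on12 clin_scaled[OF clin_on12]
proof (rule lin_eqI)
  fix p :: "state \<times> state \<times> state"
  show "on12 (\<lambda>v. c \<cdot> T v) (ket p) = c \<cdot> on12 T (ket p)"
    by (cases p) (simp add: on12_ket linear_scale'[OF clin_left_of])
qed

lemma on23_scaled: "on23 (\<lambda>v. c \<cdot> T v) x = c \<cdot> on23 T x"
  using clin_on23 clin_scaled[OF clin_on23]
proof (rule lin_eqI)
  fix p :: "state \<times> state \<times> state"
  show "on23 (\<lambda>v. c \<cdot> T v) (ket p) = c \<cdot> on23 T (ket p)"
    by (cases p) (simp add: on23_def stensor_def tens_simps linear_scale'[OF clin_linext])
qed

lemma to_config_strand_grade: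
  assumes "x \<in> block3 N k1 k2 k3"
  shows "to_config x \<in> strand_grade (window N) 0 (nat (k1 + int N))"
    and "to_config x \<in> strand_grade (window N) (Suc 0) (nat (k2 + int N))"
    and "to_config x \<in> strand_grade (window N) (Suc (Suc 0)) (nat (k3 + int N))"
  by (rule clin_block3[OF clin_to_config assms subspace_strand_grade];
      auto simp: to_config_ket ket_strand_grade config_of_mem config_card simp del: gauge.simps
        intro!: cvec.subspace_scale[OF subspace_strand_grade])+

context generic_q begin

lemma on12_Aop_block3:
  assumes "x \<in> block3 N k1 k2 k3"
  shows "on12 (Aop q m z) x \<in> block3 N (k1 - m) (k2 + m) k3"
  by (rule clin_block3[OF clin_on12 assms subspace_block3])
    (use left_of_block3[OF Aop_block[OF ket_block]] in \<open>auto simp: on12_ket\<close>)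

lemma on23_Aop_ket:
  assumes "in_window N t" "in_window N u"
  shows "on23 (Aop q m z) (ket (s, t, u)) = right_of s (Aop q m z (ket (t, u)))"
  using on23_ket[where T = "Aop q m z", OF Aop_block[OF ket_block[OF assms]]] by simp

lemma on23_EFop_ket:
  assumes "in_window N t" "in_window N u"
  shows "on23 (EFop q m j) (ket (s, t, u)) = right_of s (EFop q m j (ket (t, u)))"
  using on23_ket[where T = "EFop q m j", OF EFop_block[OF ket_block[OF assms]]] by simp

lemma on23_Aop_block3:
  assumes "x \<in> block3 N k1 k2 k3"
  shows "on23 (Aop q m z) x \<in> block3 N k1 (k2 - m) (k3 + m)"
  by (rule clin_block3[OF clin_on23 assms subspace_block3])
    (use right_of_block3[OF Aop_block[OF ket_block]] in \<open>auto simp: on23_Aop_ket\<close>)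

lemma on12_EFop_block3:
  assumes "x \<in> block3 N k1 k2 k3"
  shows "on12 (EFop q m j) x \<in> block3 N (k1 - m) (k2 + m) k3"
  by (rule clin_block3[OF clin_on12 assms subspace_block3])
    (use left_of_block3[OF EFop_block[OF ket_block]] in \<open>auto simp: on12_ket\<close>)

lemma on23_EFop_block3:
  assumes "x \<in> block3 N k1 k2 k3"
  shows "on23 (EFop q m j) x \<in> block3 N k1 (k2 - m) (k3 + m)"
  by (rule clin_block3[OF clin_on23 assms subspace_block3])
    (use right_of_block3[OF EFop_block[OF ket_block]] in \<open>auto simp: on23_EFop_ket\<close>)

lemma to_config_on12:
  assumes x: "x \<in> block3 N k1 k2 k3" and z: "generic z"
  shows "to_config (on12 (Aop q (k1 - k2) z) x) =
    braid (raise q (window N) 0) (lower q (window N) 0) (nat (k1 + int N)) (nat (k2 + int N)) z (to_config x)"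
  using linear_comp'[OF clin_on12 clin_to_config] linear_comp'[OF clin_to_config clin_braid[OF clin_raise clin_lower]] x
proof (rule lin_eq_on_block3)
  fix s t u assume w: "in_window N s" "in_window N t" "in_window N u" "deg s = k1" "deg t = k2" "deg u = k3"
  show "to_config (on12 (Aop q (k1 - k2) z) (ket (s, t, u))) =
    braid (raise q (window N) 0) (lower q (window N) 0) (nat (k1 + int N)) (nat (k2 + int N)) z (to_config (ket (s, t, u)))"
    using place_Aop[OF le0 ket_block[OF w(1,2)] deg_window[OF w(1)] deg_window[OF w(2)] z, of u]
    by (simp only: on12_ket place_def simp_thms if_True left_of_ket w)
qed

lemma to_config_on23:
  assumes x: "x \<in> block3 N k1 k2 k3" and z: "generic z"
  shows "to_config (on23 (Aop q (k2 - k3) z) x) =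
    braid (raise q (window N) (Suc 0)) (lower q (window N) (Suc 0)) (nat (k2 + int N)) (nat (k3 + int N)) z (to_config x)"
  using linear_comp'[OF clin_on23 clin_to_config] linear_comp'[OF clin_to_config clin_braid[OF clin_raise clin_lower]] x
proof (rule lin_eq_on_block3)
  fix s t u assume w: "in_window N s" "in_window N t" "in_window N u" "deg s = k1" "deg t = k2" "deg u = k3"
  have "Suc 0 \<le> 1" by simp
  note P = place_Aop[OF this ket_block[OF w(2,3)] deg_window[OF w(2)] deg_window[OF w(3)] z, of s]
  show "to_config (on23 (Aop q (k2 - k3) z) (ket (s, t, u))) =
    braid (raise q (window N) (Suc 0)) (lower q (window N) (Suc 0)) (nat (k2 + int N)) (nat (k3 + int N)) z (to_config (ket (s, t, u)))"
    using P by (simp only: on23_Aop_ket[OF w(2,3)] place_def nat.simps if_False right_of_ket w)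
qed

lemma Aop_yang_baxter_generic:
  assumes v: "v \<in> block3 N k1 k2 k3" and pos: "1 \<le> k1 + int N" "1 \<le> k2 + int N" "1 \<le> k3 + int N"
    and x: "generic x" and y: "generic y" and xy: "generic (x * y)"
  shows "on12 (Aop q (k2 - k3) y) (on23 (Aop q (k1 - k3) (x * y)) (on12 (Aop q (k1 - k2) x) v)) =
    on23 (Aop q (k1 - k2) x) (on12 (Aop q (k1 - k3) (x * y)) (on23 (Aop q (k2 - k3) y) v))"
proof (rule injD[OF inj_to_config])
  interpret W: strands q "raise q (window N)" "lower q (window N)" "strand_grade (window N)"
    by (rule strands_config[OF finite_window])
  have YB: "W.yang_baxter 0 (nat (k1 + int N)) (nat (k2 + int N)) (nat (k3 + int N))"
    by (rule W.yang_baxter_all[OF empty_strand_insertion]) (use pos in linarith)+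
  have v1: "on12 (Aop q (k1 - k2) x) v \<in> block3 N k2 k1 k3"
    and w1: "on23 (Aop q (k2 - k3) y) v \<in> block3 N k1 k3 k2"
    using on12_Aop_block3[OF v, of "k1 - k2" x] on23_Aop_block3[OF v, of "k2 - k3" y] by simp_all
  have v2: "on23 (Aop q (k1 - k3) (x * y)) (on12 (Aop q (k1 - k2) x) v) \<in> block3 N k2 k3 k1"
    and w2: "on12 (Aop q (k1 - k3) (x * y)) (on23 (Aop q (k2 - k3) y) v) \<in> block3 N k3 k1 k2"
    using on23_Aop_block3[OF v1, of "k1 - k3" "x * y"] on12_Aop_block3[OF w1, of "k1 - k3" "x * y"] by simp_all
  show "to_config (on12 (Aop q (k2 - k3) y) (on23 (Aop q (k1 - k3) (x * y)) (on12 (Aop q (k1 - k2) x) v))) =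
    to_config (on23 (Aop q (k1 - k2) x) (on12 (Aop q (k1 - k3) (x * y)) (on23 (Aop q (k2 - k3) y) v)))"
    unfolding to_config_on12[OF v2 y] to_config_on23[OF v1 xy] to_config_on12[OF v x]
      to_config_on23[OF w2 x] to_config_on12[OF w1 xy] to_config_on23[OF v y]
    by (rule W.yang_baxterD[OF YB x y xy to_config_strand_grade[OF v]])
qed

lemma Aop_inverse_generic:
  assumes v: "v \<in> block N k k'" and pos: "0 \<le> k + int N" "0 \<le> k' + int N" and z: "generic z"
  shows "Aop q (k' - k) (1 / z) (Aop q (k - k') z v) = v"
proof -
  interpret W: strands q "raise q (window N)" "lower q (window N)" "strand_grade (window N)"
    by (rule strands_config[OF finite_window])
  have w: "Aop q (k - k') z v \<in> block N k' k" using Aop_block[OF v, of "k - k'" z] by simp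
  let ?p = "place 0 (State {})"
  have "?p (Aop q (k' - k) (1 / z) (Aop q (k - k') z v)) = ?p v"
    unfolding place_Aop[OF le0 w pos(2,1) generic_inverse[OF z]] place_Aop[OF le0 v pos z]
    by (rule W.A_inverse[OF place_strand_grade[OF le0 v] z])
  then have "?p (Aop q (k' - k) (1 / z) (Aop q (k - k') z v) - v) = 0"
    by (simp add: linear_diff'[OF clin_place])
  from place_eq_0[OF this] show ?thesis by simp
qed

section \<open>Passage to all regular values of the parameters\<close>

lemma isCont_rcoef:
  fixes f :: "real \<Rightarrow> complex"
  assumes "isCont f 0" "f 0 \<notin> poles q m"
  shows "isCont (\<lambda>t. rcoef q m j (f t)) 0"
proof (cases "j = 0")
  case False
  then have "1 - q ^ (2 * j + nat \<bar>m\<bar>) * f 0 \<noteq> 0"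
    using assms(2) by (auto simp: poles_def)
  with False show ?thesis
    using assms(1) by (simp add: rcoef_def)
qed (simp add: rcoef_def)

text \<open>Applied repeatedly, from the innermost factor to the outermost, this reduces the continuity of a product of operators
  that depend on \<open>t\<close> to that of their coefficients.\<close>

lemma isCont_expand:
  fixes c :: "nat \<Rightarrow> real \<Rightarrow> complex"
  assumes "\<And>t. clin (L t)" "\<And>t. w t = (\<Sum>j<J. c j t \<cdot> u j)" "\<And>j. isCont (c j) 0"
    and "\<And>j. isCont (\<lambda>t. Poly_Mapping.lookup (L t (u j)) p) 0"
  shows "isCont (\<lambda>t. Poly_Mapping.lookup (L t (w t)) p) 0"
proof -
  have "Poly_Mapping.lookup (L t (w t)) p = (\<Sum>j<J. c j t * Poly_Mapping.lookup (L t (u j)) p)" for t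
    unfolding assms(2) by (simp add: linear_sum'[OF assms(1)] linear_scale'[OF assms(1)] lookup_sum)
  then show ?thesis
    by (simp only:) (intro continuous_sum continuous_mult assms(3,4))
qed

lemma isCont_Aop:
  assumes "v \<in> block N k k'" "isCont f 0" "f 0 \<notin> poles q m" "\<And>t. clin (L t)"
    and "\<And>w. w \<in> block N (k - m) (k' + m) \<Longrightarrow> isCont (\<lambda>t. Poly_Mapping.lookup (L t w) p) 0"
  shows "isCont (\<lambda>t. Poly_Mapping.lookup (L t (Aop q m (f t) v)) p) (0::real)"
proof (rule isCont_expand[OF assms(4)])
  show "Aop q m (f t) v = (\<Sum>j<Suc (nat (k + int N)). ((- q) ^ j * rcoef q m j (f t)) \<cdot> EFop q m j v)" for t
    by (rule Aop_sum[OF assms(1)]) simp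
qed (intro continuous_mult isCont_rcoef assms(2,3) continuous_const assms(5) EFop_block[OF assms(1)])+

lemma isCont_on12_Aop:
  assumes "x \<in> block3 N k1 k2 k3" "isCont f 0" "f 0 \<notin> poles q m" "\<And>t. clin (L t)"
    and "\<And>w. w \<in> block3 N (k1 - m) (k2 + m) k3 \<Longrightarrow> isCont (\<lambda>t. Poly_Mapping.lookup (L t w) p) 0"
  shows "isCont (\<lambda>t. Poly_Mapping.lookup (L t (on12 (Aop q m (f t)) x)) p) (0::real)"
proof (rule isCont_expand[OF assms(4)])
  let ?J = "Suc (nat (k1 + int N))"
  show "on12 (Aop q m (f t)) x = (\<Sum>j<?J. ((- q) ^ j * rcoef q m j (f t)) \<cdot> on12 (EFop q m j) x)" for t
    using clin_on12 clin_sum[OF clin_scaled[OF clin_on12]] assms(1)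
  proof (rule lin_eq_on_block3)
    fix s s' u assume w: "in_window N s" "in_window N s'" "deg s = k1"
    have "Aop q m (f t) (ket (s, s')) = (\<Sum>j<?J. ((- q) ^ j * rcoef q m j (f t)) \<cdot> EFop q m j (ket (s, s')))"
      by (rule Aop_sum[OF ket_block[OF w(1,2)]]) (use w in simp)
    then show "on12 (Aop q m (f t)) (ket (s, s', u)) = (\<Sum>j<?J. ((- q) ^ j * rcoef q m j (f t)) \<cdot> on12 (EFop q m j) (ket (s, s', u)))"
      by (simp only: on12_ket linear_sum'[OF clin_left_of] linear_scale'[OF clin_left_of])
  qed
qed (intro continuous_mult isCont_rcoef assms(2,3) continuous_const assms(5) on12_EFop_block3[OF assms(1)])+

lemma isCont_on23_Aop:
  assumes "x \<in> block3 N k1 k2 k3" "isCont f 0" "f 0 \<notin> poles q m" "\<And>t. clin (L t)"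
    and "\<And>w. w \<in> block3 N k1 (k2 - m) (k3 + m) \<Longrightarrow> isCont (\<lambda>t. Poly_Mapping.lookup (L t w) p) 0"
  shows "isCont (\<lambda>t. Poly_Mapping.lookup (L t (on23 (Aop q m (f t)) x)) p) (0::real)"
proof (rule isCont_expand[OF assms(4)])
  let ?J = "Suc (nat (k2 + int N))"
  show "on23 (Aop q m (f t)) x = (\<Sum>j<?J. ((- q) ^ j * rcoef q m j (f t)) \<cdot> on23 (EFop q m j) x)" for t
    using clin_on23 clin_sum[OF clin_scaled[OF clin_on23]] assms(1)
  proof (rule lin_eq_on_block3)
    fix u s s' assume w: "in_window N s" "in_window N s'" "deg s = k2"
    have "Aop q m (f t) (ket (s, s')) = (\<Sum>j<?J. ((- q) ^ j * rcoef q m j (f t)) \<cdot> EFop q m j (ket (s, s')))"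
      by (rule Aop_sum[OF ket_block[OF w(1,2)]]) (use w in simp)
    then show "on23 (Aop q m (f t)) (ket (u, s, s')) = (\<Sum>j<?J. ((- q) ^ j * rcoef q m j (f t)) \<cdot> on23 (EFop q m j) (ket (u, s, s')))"
      by (simp only: on23_Aop_ket[OF w(1,2)] on23_EFop_ket[OF w(1,2)] linear_sum'[OF clin_right_of] linear_scale'[OF clin_right_of])
  qed
qed (intro continuous_mult isCont_rcoef assms(2,3) continuous_const assms(5) on23_EFop_block3[OF assms(1)])+

lemma countable_not_generic:
  assumes "0 < degree P"
  shows "countable {t :: real. \<not> generic (poly P (of_real t))}"
proof -
  let ?S = "insert 0 (range (\<lambda>n::int. q powi n))"
  have "finite {t :: real. poly P (of_real t) = c}" for c
  proof -
    have "P - [:c:] \<noteq> 0" using assms by auto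
    then have "finite {z. poly (P - [:c:]) z = 0}" by (rule poly_roots_finite)
    then have "finite (of_real -` {z. poly (P - [:c:]) z = 0} :: real set)"
      by (rule finite_vimageI) (simp add: inj_on_def)
    then show ?thesis by (simp add: vimage_def)
  qed
  then have "countable {t :: real. poly P (of_real t) = c}" for c by (rule countable_finite)
  moreover have "countable ?S" by simp
  ultimately have "countable (\<Union>c\<in>?S. {t :: real. poly P (of_real t) = c})" by blast
  moreover have "{t :: real. \<not> generic (poly P (of_real t))} = (\<Union>c\<in>?S. {t. poly P (of_real t) = c})"
    by (auto simp: generic_def)
  ultimately show ?thesis by simp
qed

lemma isCont_eq_0:
  fixes h :: "real \<Rightarrow> complex"
  assumes "isCont h 0" "countable B" "\<And>t. t \<notin> B \<Longrightarrow> h t = 0"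
  shows "h 0 = 0"
proof (rule ccontr)
  assume "h 0 \<noteq> 0"
  with assms(1) have "eventually (\<lambda>t. h t \<noteq> 0) (nhds 0)"
    unfolding isCont_def tendsto_at_iff_tendsto_nhds by (auto dest: tendsto_imp_eventually_ne)
  then obtain d where d: "0 < d" "\<And>t. dist t 0 < d \<Longrightarrow> h t \<noteq> 0"
    by (auto simp: eventually_nhds_metric)
  have "{- d<..<d} \<subseteq> B"
  proof
    fix t assume "t \<in> {- d<..<d}"
    then have "h t \<noteq> 0" by (intro d(2)) (auto simp: dist_real_def)
    then show "t \<in> B" using assms(3) by blast
  qed
  then have "countable {- d<..<d}" by (rule countable_subset) (rule assms(2))
  with d(1) show False using uncountable_open_interval[of "- d" d] by simp
qed

text \<open>Along the line \<open>(x + t, y + t)\<close> the parameters are generic for all but countably many real \<open>t\<close>, since \<open>x + t\<close>, \<open>y + t\<close>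
  and \<open>(x + t) (y + t)\<close> are non-constant polynomials in \<open>t\<close>.\<close>

lemma Aop_yang_baxter:
  assumes v: "v \<in> block3 N k1 k2 k3" and pos: "1 \<le> k1 + int N" "1 \<le> k2 + int N" "1 \<le> k3 + int N"
    and x: "x \<notin> poles q (k1 - k2)" and y: "y \<notin> poles q (k2 - k3)" and xy: "x * y \<notin> poles q (k1 - k3)"
  shows "on12 (Aop q (k2 - k3) y) (on23 (Aop q (k1 - k3) (x * y)) (on12 (Aop q (k1 - k2) x) v)) =
    on23 (Aop q (k1 - k2) x) (on12 (Aop q (k1 - k3) (x * y)) (on23 (Aop q (k2 - k3) y) v))"
proof (rule poly_mapping_eqI)
  fix p
  define X Y where "X = (\<lambda>t::real. x + of_real t)" and "Y = (\<lambda>t::real. y + of_real t)"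
  have X: "isCont X 0" "X 0 \<notin> poles q (k1 - k2)" and Y: "isCont Y 0" "Y 0 \<notin> poles q (k2 - k3)"
    and XY: "isCont (\<lambda>t. X t * Y t) 0" "X 0 * Y 0 \<notin> poles q (k1 - k3)"
    using x y xy by (simp_all add: X_def Y_def)
  define l where "l t = on12 (Aop q (k2 - k3) (Y t)) (on23 (Aop q (k1 - k3) (X t * Y t)) (on12 (Aop q (k1 - k2) (X t)) v))" for t
  define r where "r t = on23 (Aop q (k1 - k2) (X t)) (on12 (Aop q (k1 - k3) (X t * Y t)) (on23 (Aop q (k2 - k3) (Y t)) v))" for t
  note cl = linear_comp'[OF clin_on12 clin_on23] linear_comp'[OF clin_on23 clin_on12] clin_on12 clin_on23
  have id: "clin (\<lambda>w. w :: state \<times> state \<times> state \<Rightarrow>\<^sub>0 complex)" by (rule clinI) simp_all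
  have "isCont (\<lambda>t. Poly_Mapping.lookup (l t) p) 0"
    unfolding l_def
  proof (rule isCont_on12_Aop[OF v X cl(2)])
    fix w assume "w \<in> block3 N (k1 - (k1 - k2)) (k2 + (k1 - k2)) k3"
    then show "isCont (\<lambda>t. Poly_Mapping.lookup (on12 (Aop q (k2 - k3) (Y t)) (on23 (Aop q (k1 - k3) (X t * Y t)) w)) p) 0"
    proof (rule isCont_on23_Aop[OF _ XY clin_on12])
      show "isCont (\<lambda>t. Poly_Mapping.lookup (on12 (Aop q (k2 - k3) (Y t)) w) p) 0" if "w \<in> block3 N k k' k''" for w k k' k''
        by (rule isCont_on12_Aop[OF that Y id]) simp
    qed
  qed
  moreover have "isCont (\<lambda>t. Poly_Mapping.lookup (r t) p) 0"
    unfolding r_def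
  proof (rule isCont_on23_Aop[OF v Y cl(1)])
    fix w assume "w \<in> block3 N k1 (k2 - (k2 - k3)) (k3 + (k2 - k3))"
    then show "isCont (\<lambda>t. Poly_Mapping.lookup (on23 (Aop q (k1 - k2) (X t)) (on12 (Aop q (k1 - k3) (X t * Y t)) w)) p) 0"
    proof (rule isCont_on12_Aop[OF _ XY clin_on23])
      show "isCont (\<lambda>t. Poly_Mapping.lookup (on23 (Aop q (k1 - k2) (X t)) w) p) 0" if "w \<in> block3 N k k' k''" for w k k' k''
        by (rule isCont_on23_Aop[OF that X id]) simp
    qed
  qed
  ultimately have cont: "isCont (\<lambda>t. Poly_Mapping.lookup (l t) p - Poly_Mapping.lookup (r t) p) 0"
    by (rule continuous_diff)
  let ?B = "{t. \<not> generic (poly [:x, 1:] (of_real t))} \<union> {t. \<not> generic (poly [:y, 1:] (of_real t))} \<union>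
    {t. \<not> generic (poly ([:x, 1:] * [:y, 1:]) (of_real t))}"
  have "countable ?B" by (intro countable_Un countable_not_generic) (simp_all add: degree_mult_eq)
  moreover have "Poly_Mapping.lookup (l t) p - Poly_Mapping.lookup (r t) p = 0" if "t \<notin> ?B" for t
  proof -
    have "generic (X t)" "generic (Y t)" "generic (X t * Y t)"
      using that by (simp_all add: X_def Y_def algebra_simps)
    from Aop_yang_baxter_generic[OF v pos this] show ?thesis by (simp add: l_def r_def)
  qed
  ultimately have "Poly_Mapping.lookup (l 0) p - Poly_Mapping.lookup (r 0) p = 0"
    by (rule isCont_eq_0[OF cont])
  then show "Poly_Mapping.lookup (on12 (Aop q (k2 - k3) y) (on23 (Aop q (k1 - k3) (x * y)) (on12 (Aop q (k1 - k2) x) v))) p =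
    Poly_Mapping.lookup (on23 (Aop q (k1 - k2) x) (on12 (Aop q (k1 - k3) (x * y)) (on23 (Aop q (k2 - k3) y) v))) p"
    by (simp add: l_def r_def X_def Y_def)
qed

lemma Aop_inverse:
  assumes v: "v \<in> block N k k'" and pos: "0 \<le> k + int N" "0 \<le> k' + int N"
    and z: "z \<noteq> 0" "z \<notin> poles q (k - k')" "1 / z \<notin> poles q (k' - k)"
  shows "Aop q (k' - k) (1 / z) (Aop q (k - k') z v) = v"
proof (rule poly_mapping_eqI)
  fix p
  define Z where "Z = (\<lambda>t::real. z + of_real t)"
  have Z: "isCont Z 0" "Z 0 \<notin> poles q (k - k')" "isCont (\<lambda>t. 1 / Z t) 0" "1 / Z 0 \<notin> poles q (k' - k)"
    using z by (simp_all add: Z_def)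
  have id: "clin (\<lambda>w. w :: state \<times> state \<Rightarrow>\<^sub>0 complex)" by (rule clinI) simp_all
  have "isCont (\<lambda>t. Poly_Mapping.lookup (Aop q (k' - k) (1 / Z t) (Aop q (k - k') (Z t) v)) p) 0"
  proof (rule isCont_Aop[OF v Z(1,2) clin_Aop])
    show "isCont (\<lambda>t. Poly_Mapping.lookup (Aop q (k' - k) (1 / Z t) w) p) 0" if "w \<in> block N l l'" for w l l'
      by (rule isCont_Aop[OF that Z(3,4) id]) simp
  qed
  then have cont: "isCont (\<lambda>t. Poly_Mapping.lookup (Aop q (k' - k) (1 / Z t) (Aop q (k - k') (Z t) v)) p -
      Poly_Mapping.lookup v p) 0"
    by (intro continuous_diff continuous_const)
  have "countable {t. \<not> generic (poly [:z, 1:] (of_real t))}" by (rule countable_not_generic) simp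
  moreover have "Poly_Mapping.lookup (Aop q (k' - k) (1 / Z t) (Aop q (k - k') (Z t) v)) p - Poly_Mapping.lookup v p = 0"
    if "t \<notin> {t. \<not> generic (poly [:z, 1:] (of_real t))}" for t
    using that Aop_inverse_generic[OF v pos, of "Z t"] by (simp add: Z_def)
  ultimately have "Poly_Mapping.lookup (Aop q (k' - k) (1 / Z 0) (Aop q (k - k') (Z 0) v)) p - Poly_Mapping.lookup v p = 0"
    by (rule isCont_eq_0[OF cont])
  then show "Poly_Mapping.lookup (Aop q (k' - k) (1 / z) (Aop q (k - k') z v)) p = Poly_Mapping.lookup v p"
    by (simp add: Z_def)
qed

end

section \<open>Rationality, and the braiding relations on the Fock space\<close>

text \<open>Collecting the powers of \<open>z\<close> in the numerators gives the form required by \<^const>\<open>rational_off\<close>.\<close>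

lemma rational_offI:
  fixes P :: "complex set" and e :: "nat \<Rightarrow> ('a \<Rightarrow>\<^sub>0 complex)"
  assumes "d \<noteq> 0" "\<And>z. poly d z = 0 \<Longrightarrow> z \<in> P"
    and "\<And>z. z \<notin> P \<Longrightarrow> f z = (\<Sum>j<J. (poly (p j) z / poly d z) \<cdot> e j)"
  shows "rational_off P f"
proof -
  define n where "n = (\<Sum>j<J. degree (p j))"
  have p: "poly (p j) z = (\<Sum>k\<le>n. coeff (p j) k * z ^ k)" if "j < J" for j z
  proof -
    have "degree (p j) \<le> n" unfolding n_def by (rule member_le_sum) (use that in auto)
    then show ?thesis
      unfolding poly_altdef by (intro sum.mono_neutral_left) (auto simp: coeff_eq_0)
  qed
  have "f z = (1 / poly d z) \<cdot> (\<Sum>k\<le>n. z ^ k \<cdot> (\<Sum>j<J. coeff (p j) k \<cdot> e j))" if "z \<notin> P" for z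
  proof -
    have "(1 / poly d z) \<cdot> (\<Sum>k\<le>n. z ^ k \<cdot> (\<Sum>j<J. coeff (p j) k \<cdot> e j)) =
        (1 / poly d z) \<cdot> (\<Sum>j<J. \<Sum>k\<le>n. (coeff (p j) k * z ^ k) \<cdot> e j)"
      by (subst sum.swap) (simp add: cscale_sum mult.commute)
    also have "\<dots> = (\<Sum>j<J. (poly (p j) z / poly d z) \<cdot> e j)"
      unfolding cscale_sum[where I = "{..<J}"]
      by (rule sum.cong) (simp_all add: p flip: cvec.scale_sum_left)
    finally show ?thesis using assms(3)[OF that] by simp
  qed
  with assms(1,2) show ?thesis
    unfolding rational_off_def
    by (intro exI[of _ d] exI[of _ n] exI[of _ "\<lambda>k. \<Sum>j<J. coeff (p j) k \<cdot> e j"]) auto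
qed

context generic_q begin

lemma rational_off_Aop: "rational_off (poles q m) (\<lambda>z. Aop q m z x)"
proof -
  obtain J where J: "{j. EFop q m j x \<noteq> 0} \<subseteq> {..<J}"
    using finite_EFop[of m x] by (meson finite_nat_iff_bounded)
  define f where "f j = [:1, - (q ^ (2 * j + nat \<bar>m\<bar>)):]" for j
  have f: "poly (f j) z = 1 - q ^ (2 * j + nat \<bar>m\<bar>) * z" for j z
    by (simp add: f_def mult.commute)
  define d where "d = (\<Prod>i\<in>{1..<J}. f i)"
  define p where "p j = (if j = 0 then d else [:1, - (q ^ nat \<bar>m\<bar>):] * (\<Prod>i\<in>{1..<J} - {j}. f i))" for j
  have fd: "poly (f i) z \<noteq> 0" if "z \<notin> poles q m" "1 \<le> i" for i z
    using that by (auto simp: f poles_def)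
  show ?thesis
  proof (rule rational_offI[where d = d and p = p and J = J and e = "\<lambda>j. (- q) ^ j \<cdot> EFop q m j x"])
    show "d \<noteq> 0" by (simp add: d_def f_def)
    show "z \<in> poles q m" if "poly d z = 0" for z
      using that fd[of z] by (force simp: d_def poly_prod)
    fix z assume z: "z \<notin> poles q m"
    have c: "rcoef q m j z = poly (p j) z / poly d z" if "j < J" for j
    proof (cases "j = 0")
      case True
      then show ?thesis using fd[OF z] by (simp add: rcoef_def p_def d_def poly_prod)
    next
      case False
      then have "poly d z = poly (f j) z * poly (\<Prod>i\<in>{1..<J} - {j}. f i) z"
        using that by (simp add: d_def poly_prod) (rule prod.remove, simp_all)
      moreover have "poly (\<Prod>i\<in>{1..<J} - {j}. f i) z \<noteq> 0"
        using fd[OF z] by (simp add: poly_prod)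
      moreover have "poly (p j) z = (1 - q ^ nat \<bar>m\<bar> * z) * poly (\<Prod>i\<in>{1..<J} - {j}. f i) z"
        using False by (simp add: p_def algebra_simps)
      ultimately show ?thesis
        using False by (simp only: rcoef_def f if_False) (rule mult_divide_mult_cancel_right[symmetric])
    qed
    have "Aop q m z x = (\<Sum>j<J. ((- q) ^ j * rcoef q m j z) \<cdot> EFop q m j x)"
      unfolding Aop_def using J by (intro Sum_any.expand_superset) auto
    also have "\<dots> = (\<Sum>j<J. (poly (p j) z / poly d z) \<cdot> ((- q) ^ j \<cdot> EFop q m j x))"
      by (rule sum.cong) (simp_all add: c)
    finally show "Aop q m z x = (\<Sum>j<J. (poly (p j) z / poly d z) \<cdot> ((- q) ^ j \<cdot> EFop q m j x))" .
  qed
qed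

lemma Rcheck_scaled: "Rcheck q k k' z = (\<lambda>v. (- 1) powi min k k' \<cdot> Aop q (k - k') z v)"
  by (rule ext) (simp add: Rcheck_def)

lemma clin_Rcheck: "clin (Rcheck q k k' z)"
  unfolding Rcheck_scaled by (rule clin_scaled[OF clin_Aop])

lemma Rcheck_grade:
  assumes "x \<in> tens_sub (grade k) (grade k')"
  shows "Rcheck q k k' z x \<in> tens_sub (grade k') (grade k)"
  using clin_Rcheck _ assms unfolding grade_supported tens_sub_supported
proof (rule clin_supported)
  fix p :: "state \<times> state" assume p: "case p of (s, t) \<Rightarrow> deg s = k \<and> deg t = k'"
  obtain s t where st: "p = (s, t)" by (cases p)
  obtain N N' where "in_window N s" "in_window N' t" using ex_in_window by blast
  then have w: "in_window (max N N') s" "in_window (max N N') t" by (auto elim: in_window_mono)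
  have "Aop q (k - k') z (ket (s, t)) \<in> block (max N N') k' k"
    using Aop_block[OF ket_block[OF w], of "k - k'" z] p by (simp add: st)
  then have "Rcheck q k k' z (ket (s, t)) \<in> block (max N N') k' k"
    by (simp add: Rcheck_def cvec.subspace_scale[OF subspace_block])
  then show "Rcheck q k k' z (ket p) \<in> supported (\<lambda>(s, t). deg s = k' \<and> deg t = k)"
    unfolding block_def st by (rule supported_mono) auto
qed

lemma Rcheck_inverse:
  assumes z: "z \<noteq> 0" "z \<notin> poles q (k - k')" "inverse z \<notin> poles q (k' - k)"
    and x: "x \<in> tens_sub (grade k) (grade k')"
  shows "Rcheck q k' k (inverse z) (Rcheck q k k' z x) = x"
proof -
  have id: "clin (\<lambda>w. w :: state \<times> state \<Rightarrow>\<^sub>0 complex)" by (rule clinI) simp_all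
  from linear_comp'[OF clin_Rcheck clin_Rcheck] id show ?thesis
  proof (rule lin_eq_on_keys)
    fix p assume p: "p \<in> Poly_Mapping.keys x"
    obtain s t where st: "p = (s, t)" by (cases p)
    have deg: "deg s = k" "deg t = k'"
      using x p unfolding grade_supported tens_sub_supported by (auto simp: supported_def st)
    obtain N N' where "in_window N s" "in_window N' t" using ex_in_window by blast
    then have w: "in_window (max N N') s" "in_window (max N N') t" by (auto elim: in_window_mono)
    have "Aop q (k' - k) (inverse z) (Aop q (k - k') z (ket p)) = ket p"
      using Aop_inverse[OF ket_block[OF w] deg_window[OF w(1)] deg_window[OF w(2)], unfolded deg, OF z(1,2)] z(3)
      by (simp add: st inverse_eq_divide)
    moreover have "(- 1 :: complex) powi min k' k * (- 1) powi min k k' = 1"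
      by (simp add: min.commute flip: power_int_mult_distrib)
    ultimately show "Rcheck q k' k (inverse z) (Rcheck q k k' z (ket p)) = ket p"
      by (simp add: Rcheck_def linear_scale'[OF clin_Aop])
  qed
qed

lemma Rcheck_yang_baxter:
  assumes "z2 \<noteq> 0" and p12: "z1 / z2 \<notin> poles q (k1 - k2)" and p13: "z1 / z3 \<notin> poles q (k1 - k3)"
    and p23: "z2 / z3 \<notin> poles q (k2 - k3)"
    and x: "x \<in> tens_sub (grade k1) (tens_sub (grade k2) (grade k3))"
  shows "on12 (Rcheck q k2 k3 (z2 / z3)) (on23 (Rcheck q k1 k3 (z1 / z3)) (on12 (Rcheck q k1 k2 (z1 / z2)) x)) =
    on23 (Rcheck q k1 k2 (z1 / z2)) (on12 (Rcheck q k1 k3 (z1 / z3)) (on23 (Rcheck q k2 k3 (z2 / z3)) x))"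
  using linear_comp'[OF linear_comp'[OF clin_on12 clin_on23] clin_on12]
    linear_comp'[OF linear_comp'[OF clin_on23 clin_on12] clin_on23]
proof (rule lin_eq_on_keys)
  fix p assume p: "p \<in> Poly_Mapping.keys x"
  obtain s t u where stu: "p = (s, t, u)" by (cases p)
  have deg: "deg s = k1" "deg t = k2" "deg u = k3"
    using x p unfolding grade_supported tens_sub_supported by (auto simp: supported_def stu)
  obtain N N' N'' where "in_window N s" "in_window N' t" "in_window N'' u" using ex_in_window by blast
  then have w0: "in_window (max N (max N' N'')) s" "in_window (max N (max N' N'')) t" "in_window (max N (max N' N'')) u"
    by (auto elim: in_window_mono)
  \<comment> \<open>enlarging the window by one makes all three particle numbers positive\<close>
  define M where "M = Suc (max N (max N' N''))"
  have w: "in_window M s" "in_window M t" "in_window M u"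
    unfolding M_def by (rule in_window_mono[OF _ le_SucI[OF order_refl]], fact w0)+
  have pos: "1 \<le> k1 + int M" "1 \<le> k2 + int M" "1 \<le> k3 + int M"
    using deg_window[OF w0(1)] deg_window[OF w0(2)] deg_window[OF w0(3)] by (simp_all add: deg M_def)
  have v: "ket p \<in> block3 M k1 k2 k3"
    using ket_block3[OF w] by (simp only: deg stu)
  have z: "z1 / z2 * (z2 / z3) = z1 / z3" using assms(1) by simp
  show "on12 (Rcheck q k2 k3 (z2 / z3)) (on23 (Rcheck q k1 k3 (z1 / z3)) (on12 (Rcheck q k1 k2 (z1 / z2)) (ket p))) =
    on23 (Rcheck q k1 k2 (z1 / z2)) (on12 (Rcheck q k1 k3 (z1 / z3)) (on23 (Rcheck q k2 k3 (z2 / z3)) (ket p)))"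
    using Aop_yang_baxter[OF v pos p12 p23] p13 unfolding z
    by (simp add: Rcheck_scaled on12_scaled on23_scaled linear_scale'[OF clin_on12] linear_scale'[OF clin_on23] mult_ac)
qed

end

theorem theorem2p8:
  fixes q :: complex
  assumes "q \<noteq> 0" and "\<forall>n::nat. n > 0 \<longrightarrow> q ^ n \<noteq> 1"
  shows
    "(\<forall>m::int.
        (\<forall>x. finite {j. EFop q m j x \<noteq> 0}) \<and>
        (\<forall>z. z \<notin> poles q m \<longrightarrow> clin (Aop q m z)) \<and>
        (\<forall>x. rational_off (poles q m) (\<lambda>z. Aop q m z x))) \<and>
     (\<forall>(k::int) (k'::int) z. z \<notin> poles q (k - k') \<longrightarrow>
        (\<forall>x \<in> tens_sub (grade k) (grade k'). Rcheck q k k' z x \<in> tens_sub (grade k') (grade k))) \<and>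
     (\<forall>(k1::int) (k2::int) (k3::int) z1 z2 z3.
        z2 \<noteq> 0 \<longrightarrow> z3 \<noteq> 0 \<longrightarrow>
        z1 / z2 \<notin> poles q (k1 - k2) \<longrightarrow> z1 / z3 \<notin> poles q (k1 - k3) \<longrightarrow> z2 / z3 \<notin> poles q (k2 - k3) \<longrightarrow>
        (\<forall>x \<in> tens_sub (grade k1) (tens_sub (grade k2) (grade k3)).
           on12 (Rcheck q k2 k3 (z2 / z3)) (on23 (Rcheck q k1 k3 (z1 / z3)) (on12 (Rcheck q k1 k2 (z1 / z2)) x)) =
           on23 (Rcheck q k1 k2 (z1 / z2)) (on12 (Rcheck q k1 k3 (z1 / z3)) (on23 (Rcheck q k2 k3 (z2 / z3)) x)))) \<and>
     (\<forall>(k::int) (k'::int) z.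
        z \<noteq> 0 \<longrightarrow> z \<notin> poles q (k - k') \<longrightarrow> inverse z \<notin> poles q (k' - k) \<longrightarrow>
        (\<forall>x \<in> tens_sub (grade k) (grade k'). Rcheck q k' k (inverse z) (Rcheck q k k' z x) = x))"
proof -
  interpret generic_q q by unfold_locales (use assms in auto)
  show ?thesis
    by (intro conjI allI impI ballI finite_EFop clin_Aop rational_off_Aop Rcheck_grade Rcheck_yang_baxter Rcheck_inverse)
qed

end
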